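(* Let $\Omega_3$ be a Reidemeister move of type 3 (a triple-point crossing) applied to an oriented generic, possibly multi-component, plane curve, and let $j$ be the number of outward coorientations of the vanishing triangle before the move, i.e. the number of its three edges whose coorientation points out of the triangle. Then $$dSt_{(1)}(\Omega_3)=2j-3 .$$
   Context: A generic (multi-component) plane curve $C$ is a generic immersion of a disjoint union of finitely many circles $S^1\sqcup\cdots\sqcup S^1$ into the oriented plane $\mathbb{R}^2$ (the only singularities of the image are transverse double points), identified with its image. The orientation of the curve together with that of the plane induces a coorientation (a choice of normal direction) of the curve, by a fixed convention. Alexander numbering: each region (component of the complement of the curve) is assigned a number, called its index, so that the number increases by $1$ when the curve is crossed in the direction of its coorientation; the value on the unbounded region is a fixed constant, the same before and after the move. The index $\mathrm{ind}(d)$ of a double point $d$ is the average of the Alexander numbers of the four regions locally adjacent to $d$. With $D(C)$ the set of double points of $C$, define $$St_{(1)}(C)=\sum_{d\in D(C)}\mathrm{ind}(d).$$ A Reidemeister move $\Omega_3$ moves one strand of the curve across the crossing of two other strands inside a small disk, leaving the curve unchanged outside the disk. The vanishing triangle is the small triangle bounded by the three strands; it shrinks to a point and reappears inverted after the move. Define $$dSt_{(1)}(\Omega_3):=St_{(1)}(\text{curve after the move})-St_{(1)}(\text{curve before the move}).$$ *)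

theory Defs
  imports "HOL-Analysis.Analysis"
begin

text \<open>The oriented plane is \<^typ>\<open>complex\<close>.  A curve with components indexed by a finite
  type is given by one map of period 1 for each component, the circle being the real line
  modulo 1; the orientation is that of increasing parameter.\<close>

type_synonym 'i curve = "'i \<Rightarrow> real \<Rightarrow> complex"

definition curve_image :: "'i curve \<Rightarrow> complex set" where
  "curve_image C = (\<Union>i. range (C i))"

definition tangent :: "'i curve \<Rightarrow> 'i \<times> real \<Rightarrow> complex" where
  "tangent C b = vector_derivative (C (fst b)) (at (snd b))"

text \<open>The parameter interval contains each point of the circle exactly once.\<close>

definition branches :: "'i curve \<Rightarrow> complex \<Rightarrow> ('i \<times> real) set" where
  "branches C p = {(i, t). t \<in> {0..<1} \<and> C i t = p}"

definition double_points :: "'i curve \<Rightarrow> complex set" where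
  "double_points C = {p. card (branches C p) = 2}"

text \<open>Immersions are only required to be of class $C^1$.  The number
  \<open>Im (cnj u * v)\<close> is the determinant of the vectors \<open>u\<close> and \<open>v\<close>, so the last clause
  is transversality.\<close>

definition generic_curve :: "('i::finite) curve \<Rightarrow> bool" where
  "generic_curve C \<longleftrightarrow>
     (\<forall>i. (\<forall>t. C i (t + 1) = C i t) \<and> C i C1_differentiable_on UNIV \<and>
          (\<forall>t. tangent C (i, t) \<noteq> 0)) \<and>
     (\<forall>p. finite (branches C p) \<and> card (branches C p) \<le> 2) \<and>
     (\<forall>p. \<forall>b \<in> branches C p. \<forall>b' \<in> branches C p.
          b \<noteq> b' \<longrightarrow> Im (cnj (tangent C b) * tangent C b') \<noteq> 0)"

text \<open>The convention for the coorientation is a sign: for \<open>\<sigma> = 1\<close> the coorienting normal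
  points to the left of the curve, for \<open>\<sigma> = -1\<close> to the right.\<close>

definition coorientation :: "real \<Rightarrow> 'i curve \<Rightarrow> 'i \<times> real \<Rightarrow> complex" where
  "coorientation \<sigma> C b = of_real \<sigma> * \<i> * tangent C b"

definition region :: "'i curve \<Rightarrow> complex \<Rightarrow> complex set" where
  "region C z = connected_component_set (- curve_image C) z"

definition alexander_numbering ::
    "real \<Rightarrow> real \<Rightarrow> 'i curve \<Rightarrow> (complex set \<Rightarrow> real) \<Rightarrow> bool" where
  "alexander_numbering \<sigma> \<kappa> C N \<longleftrightarrow>
     (\<forall>i t. C i t \<notin> double_points C \<longrightarrow>
        (\<forall>\<^sub>F h in at_right 0.
           N (region C (C i t + of_real h * coorientation \<sigma> C (i, t))) =
           N (region C (C i t - of_real h * coorientation \<sigma> C (i, t))) + 1)) \<and>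
     (\<forall>R \<in> components (- curve_image C). \<not> bounded R \<longrightarrow> N R = \<kappa>)"

text \<open>At a double point with tangents \<open>u\<close> and \<open>v\<close> the four local regions are those
  entered in the directions \<open>\<plusminus>u \<plusminus> v\<close>; the choices of signs are encoded by the subsets of
  the two-element set of branches.  Two local regions may belong to the same global region,
  which then counts twice.\<close>

definition sector_direction :: "'i curve \<Rightarrow> complex \<Rightarrow> ('i \<times> real) set \<Rightarrow> complex" where
  "sector_direction C d B =
     (\<Sum>b\<in>B. tangent C b) - (\<Sum>b\<in>branches C d - B. tangent C b)"

definition ind :: "'i curve \<Rightarrow> (complex set \<Rightarrow> real) \<Rightarrow> complex \<Rightarrow> real" where
  "ind C N d =
     (\<Sum>B\<in>Pow (branches C d).
        Lim (at_right 0) (\<lambda>h. N (region C (d + of_real h * sector_direction C d B)))) / 4"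

definition St1 :: "'i curve \<Rightarrow> (complex set \<Rightarrow> real) \<Rightarrow> real" where
  "St1 C N = (\<Sum>d\<in>double_points C. ind C N d)"

text \<open>A strand \<open>(i, a, b)\<close> is the part of component \<open>i\<close> with parameters in \<open>{a..b}\<close>,
  taken modulo 1.\<close>

type_synonym 'i strand = "'i \<times> real \<times> real"

definition strand_points :: "'i strand \<Rightarrow> ('i \<times> real) set" where
  "strand_points = (\<lambda>(i, a, b). {(i, t) | t. \<exists>n::int. t + of_int n \<in> {a..b}})"

definition strand_arc :: "'i curve \<Rightarrow> 'i strand \<Rightarrow> complex set" where
  "strand_arc C = (\<lambda>(i, a, b). C i ` {a..b})"

text \<open>Inside the disk \<open>D\<close> the curve consists of three simple arcs, each running from boundary
  to boundary, any two of which cross exactly once.\<close>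

definition three_strands :: "complex set \<Rightarrow> 'i curve \<Rightarrow> 'i strand set \<Rightarrow> bool" where
  "three_strands D C S \<longleftrightarrow>
     card S = 3 \<and>
     (\<forall>(i, a, b) \<in> S. a < b \<and> b < a + 1 \<and> inj_on (C i) {a..b} \<and>
        C i a \<in> frontier D \<and> C i b \<in> frontier D \<and> C i ` {a<..<b} \<subseteq> interior D) \<and>
     (\<forall>i t. C i t \<in> D \<longleftrightarrow> (i, t) \<in> (\<Union>s\<in>S. strand_points s)) \<and>
     (\<forall>s \<in> S. \<forall>s' \<in> S. s \<noteq> s' \<longrightarrow>
        strand_points s \<inter> strand_points s' = {} \<and>
        (\<exists>p \<in> interior D. strand_arc C s \<inter> strand_arc C s' = {p}))"

text \<open>The strand \<open>m\<close> is moved inside \<open>D\<close> across the crossing of the other two, and the rest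
  of the curve is kept.  A simple arc between boundary points cuts \<open>D\<close> into two sides, each of
  which contains one of the two arcs of the boundary between its end points.  These end points
  are kept by the move, so the crossing \<open>p\<close> changes sides exactly when no boundary point is on
  the side of \<open>p\<close> both before and after the move.\<close>

definition Omega3 ::
    "complex set \<Rightarrow> 'i strand set \<Rightarrow> 'i strand \<Rightarrow> 'i curve \<Rightarrow> 'i curve \<Rightarrow> bool" where
  "Omega3 D S m C C' \<longleftrightarrow>
     D homeomorphic cball (0::complex) 1 \<and> m \<in> S \<and>
     three_strands D C S \<and> three_strands D C' S \<and>
     (\<forall>i t. (i, t) \<notin> strand_points m \<longrightarrow> C' i t = C i t) \<and>
     (\<forall>p \<in> (\<Inter>s \<in> S - {m}. strand_arc C s). \<forall>q \<in> frontier D.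
        \<not> (connected_component (D - strand_arc C m) p q \<and>
            connected_component (D - strand_arc C' m) p q))"

text \<open>The triangle cut out by three pairwise crossing strands: its edge on a strand is the part
  between the crossings with the two other strands.\<close>

definition edge_params :: "'i curve \<Rightarrow> 'i strand set \<Rightarrow> 'i strand \<Rightarrow> real set" where
  "edge_params C S = (\<lambda>(i, a, b).
     convex hull {t \<in> {a..b}. \<exists>s \<in> S - {(i, a, b)}. C i t \<in> strand_arc C s})"

definition triangle :: "'i curve \<Rightarrow> 'i strand set \<Rightarrow> complex set" where
  "triangle C S = inside (\<Union>s\<in>S. C (fst s) ` edge_params C S s)"

definition outward :: "real \<Rightarrow> 'i curve \<Rightarrow> 'i strand set \<Rightarrow> 'i strand \<Rightarrow> bool" where
  "outward \<sigma> C S s \<longleftrightarrow>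
     (\<forall>t \<in> interior (edge_params C S s). \<forall>\<^sub>F h in at_right 0.
        C (fst s) t + of_real h * coorientation \<sigma> C (fst s, t) \<notin> triangle C S)"

definition outward_count :: "real \<Rightarrow> 'i curve \<Rightarrow> 'i strand set \<Rightarrow> nat" where
  "outward_count \<sigma> C S = card {s \<in> S. outward \<sigma> C S s}"

end

theory Submission
  imports Defs
begin

text \<open>
  The \<^emph>\<open>level\<close> of the curve at a parameter is the mean of the Alexander numbers on its two sides.  Along
  the curve it is constant between double points; at a double point it jumps by \<open>\<plusminus>1\<close>, with a sign that
  depends only on \<open>\<sigma>\<close> and on how the two branches cross; and the index of the double point is the mean
  of the levels before and after it (\<open>numbering_crossing\<close>).  Hence the indices of the three crossings in
  the disk depend only on the levels at which the strands enter the disk, on the signs of the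
  crossings, and on the order in which each strand meets the other two (\<open>strand_indices\<close>).

  The Alexander numbering off the disk is the same before and after the move: the difference of the
  two numberings does not jump across the curve, the complement of the disk is connected, and the
  difference vanishes far away (\<open>agree_off_numbering\<close>).  So the double points off the disk keep their
  indices, and the strands keep their levels at both ends.  Equality of the final levels shows
  that the signs of the crossings are kept.  The orders are reversed.  For the two fixed strands this
  holds because their crossing changes sides: if the order on a fixed strand were kept, a piece of that
  strand would join the crossing to the boundary of the disk off the moving strand, both before and
  after the move (\<open>crossing_reaches_end\<close>).  For the moving strand it follows because the index of a
  crossing can be computed along either of its two strands.

  The coorientation of an edge of the triangle is governed by the same data (\<open>outward_iff\<close>).  Beyond
  its edge a strand runs out of the disk without meeting the triangle again.  At a vertex these tails
  put three of the four sectors outside the triangle, so the outer side of an edge is the side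
  away from the adjacent edge; that the other side is inside is the Jordan curve theorem.  What
  remains is the arithmetic of three signs and three orders (\<open>triangle_index_arithmetic\<close>).

  The local pictures come from the inverse function theorem, applied to the map
  \<open>(x, y) \<mapsto> \<gamma> (t + x) + \<eta> (u + y) - d\<close> for two curves \<open>\<gamma>\<close> and \<open>\<eta>\<close> that cross transversally at \<open>d\<close>.
\<close>

section \<open>Charts with two transversal curves as axes\<close>

definition det2 :: "complex \<Rightarrow> complex \<Rightarrow> real" where
  "det2 u v = Im (cnj u * v)"

lemma det2_eq: "det2 u v = Re u * Im v - Im u * Re v"
  by (simp add: det2_def)

definition square :: "real \<Rightarrow> complex set" where
  "square r = {z. \<bar>Re z\<bar> < r \<and> \<bar>Im z\<bar> < r}"

text \<open>The curve \<open>\<gamma>\<close> is the image of the real axis, and a curve \<open>\<eta>\<close> with \<open>\<eta> u = \<gamma> t\<close> that of the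
  imaginary axis.\<close>

definition grid :: "(real \<Rightarrow> complex) \<Rightarrow> real \<Rightarrow> (real \<Rightarrow> complex) \<Rightarrow> real \<Rightarrow> complex \<Rightarrow> complex" where
  "grid \<gamma> t \<eta> u z = \<gamma> (t + Re z) + \<eta> (u + Im z) - \<gamma> t"

lemma open_square: "open (square r)"
proof -
  have "square r = {z. Re z < r} \<inter> {z. Re z > -r} \<inter> {z. Im z < r} \<inter> {z. Im z > -r}"
    by (auto simp: square_def)
  then show ?thesis
    by (simp add: open_Int open_halfspace_Re_lt open_halfspace_Re_gt open_halfspace_Im_lt open_halfspace_Im_gt)
qed

lemma square_inside_open:
  assumes "open X" "0 \<in> X"
  obtains r where "r > 0" "square r \<subseteq> X"
proof -
  obtain e where e: "e > 0" "ball 0 e \<subseteq> X" using assms openE by blast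
  have "square (e/2) \<subseteq> ball 0 e"
  proof
    fix z assume "z \<in> square (e/2)"
    then have "\<bar>Re z\<bar> + \<bar>Im z\<bar> < e" by (simp add: square_def)
    then show "z \<in> ball 0 e" using cmod_le[of z] by simp
  qed
  then show thesis using that[of "e/2"] e by auto
qed

text \<open>Cramer's rule.\<close>

lemma coordinates_eq:
  assumes "v = Re w *\<^sub>R a + Im w *\<^sub>R b"
  shows "det2 a v = Im w * det2 a b" "det2 v b = Re w * det2 a b"
  unfolding assms det2_eq by (simp_all add: algebra_simps)

text \<open>Transversality makes the grid map a local diffeomorphism by the inverse function theorem.  The last
  clause is what the derivative of the inverse says about directions: a ray from a grid point in
  direction \<open>v\<close> moves up in the grid if \<open>v\<close> points to the left of \<open>\<gamma>\<close>, down if it points to the right,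
  and likewise for the other coordinate, the signs being read off from Cramer's rule.  The set \<open>X\<close>
  keeps the point of the grid close to where it started.\<close>

lemma grid_chart:
  fixes \<gamma> \<eta> :: "real \<Rightarrow> complex"
  assumes \<gamma>: "\<gamma> C1_differentiable_on UNIV" and \<eta>: "\<eta> C1_differentiable_on UNIV"
    and meet: "\<gamma> t = \<eta> u"
    and pos: "det2 (vector_derivative \<gamma> (at t)) (vector_derivative \<eta> (at u)) > 0"
  obtains r where "r > 0" "inj_on (grid \<gamma> t \<eta> u) (square r)"
    "\<And>X. open X \<Longrightarrow> X \<subseteq> square r \<Longrightarrow> open (grid \<gamma> t \<eta> u ` X)"
    "continuous_on UNIV (grid \<gamma> t \<eta> u)"
    "\<And>z v X. z \<in> square r \<Longrightarrow> open X \<Longrightarrow> z \<in> X \<Longrightarrow>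
       \<forall>\<^sub>F h in at_right 0. \<exists>z'\<in>X. grid \<gamma> t \<eta> u z' = grid \<gamma> t \<eta> u z + of_real h * v \<and>
          (det2 (vector_derivative \<gamma> (at (t + Re z))) v > 0 \<longrightarrow> Im z' > Im z) \<and>
          (det2 (vector_derivative \<gamma> (at (t + Re z))) v < 0 \<longrightarrow> Im z' < Im z) \<and>
          (det2 v (vector_derivative \<eta> (at (u + Im z))) > 0 \<longrightarrow> Re z' > Re z) \<and>
          (det2 v (vector_derivative \<eta> (at (u + Im z))) < 0 \<longrightarrow> Re z' < Re z)"
proof -
  define A where "A z = vector_derivative \<gamma> (at (t + Re z))" for z
  define B where "B z = vector_derivative \<eta> (at (u + Im z))" for z
  let ?\<phi> = "grid \<gamma> t \<eta> u"
  have contA: "continuous_on UNIV A" "continuous_on UNIV B"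
  proof -
    have "continuous_on UNIV (\<lambda>x. vector_derivative \<gamma> (at x))" "continuous_on UNIV (\<lambda>x. vector_derivative \<eta> (at x))"
      using \<gamma> \<eta> unfolding C1_differentiable_on_eq by auto
    then show "continuous_on UNIV A" "continuous_on UNIV B"
      unfolding A_def B_def
      by - (rule continuous_on_compose2, assumption, auto intro!: continuous_intros)+
  qed
  have d\<gamma>: "(\<gamma> has_vector_derivative A z) (at (t + Re z))" for z
    using \<gamma> unfolding A_def C1_differentiable_on_eq by (simp add: vector_derivative_works)
  have d\<eta>: "(\<eta> has_vector_derivative B z) (at (u + Im z))" for z
    using \<eta> unfolding B_def C1_differentiable_on_eq by (simp add: vector_derivative_works)
  define f' where "f' z = (blinfun_scaleR_left (A z) o\<^sub>L Blinfun Re) + (blinfun_scaleR_left (B z) o\<^sub>L Blinfun Im)" for z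
  have f'_apply: "blinfun_apply (f' z) h = Re h *\<^sub>R A z + Im h *\<^sub>R B z" for z h
    unfolding f'_def
    by (simp add: blinfun.add_left bounded_linear_Blinfun_apply bounded_linear_Re bounded_linear_Im)
  have der: "(?\<phi> has_derivative blinfun_apply (f' z)) (at z)" for z
  proof -
    have 1: "((\<lambda>z. \<gamma> (t + Re z)) has_derivative (\<lambda>h. Re h *\<^sub>R A z)) (at z)"
      by (rule has_derivative_compose[where f="\<lambda>z. t + Re z" and g="\<gamma>"])
        (use d\<gamma>[of z] in \<open>auto simp: has_vector_derivative_def intro!: derivative_eq_intros\<close>)
    have 2: "((\<lambda>z. \<eta> (u + Im z)) has_derivative (\<lambda>h. Im h *\<^sub>R B z)) (at z)"
      by (rule has_derivative_compose[where f="\<lambda>z. u + Im z" and g="\<eta>"])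
        (use d\<eta>[of z] in \<open>auto simp: has_vector_derivative_def intro!: derivative_eq_intros\<close>)
    have "blinfun_apply (f' z) = (\<lambda>h. Re h *\<^sub>R A z + Im h *\<^sub>R B z)"
      by (simp add: f'_apply fun_eq_iff)
    moreover have "(?\<phi> has_derivative (\<lambda>h. Re h *\<^sub>R A z + Im h *\<^sub>R B z - 0)) (at z)"
      unfolding grid_def by (intro has_derivative_diff has_derivative_add 1 2 has_derivative_const)
    ultimately show ?thesis by simp
  qed
  have contf: "continuous_on UNIV f'"
    unfolding f'_def
    by (intro continuous_intros contA bounded_linear.continuous_on[OF bounded_linear_blinfun_scaleR_left])
  have pos0: "det2 (A 0) (B 0) > 0" using pos by (simp add: A_def B_def)
  define inv0 where "inv0 v = Complex (det2 v (B 0) / det2 (A 0) (B 0)) (det2 (A 0) v / det2 (A 0) (B 0))" for v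
  have bl: "bounded_linear inv0"
    unfolding inv0_def linear_conv_bounded_linear[symmetric]
    by (rule linearI) (auto simp: complex_eq_iff det2_eq field_simps add_divide_distrib diff_divide_distrib)
  have left_inv: "Blinfun inv0 o\<^sub>L f' 0 = id_blinfun"
  proof (rule blinfun_eqI)
    fix h
    have "inv0 (Re h *\<^sub>R A 0 + Im h *\<^sub>R B 0) = h"
      using pos0 coordinates_eq[of "Re h *\<^sub>R A 0 + Im h *\<^sub>R B 0" h "A 0" "B 0"] unfolding inv0_def by (simp add: complex_eq_iff)
    then show "blinfun_apply (Blinfun inv0 o\<^sub>L f' 0) h = blinfun_apply id_blinfun h"
      by (simp add: f'_apply bounded_linear_Blinfun_apply[OF bl])
  qed
  obtain U V g g' where ift: "open U" "0 \<in> U" "open V" "homeomorphism U V ?\<phi> g"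
    "\<And>y. y \<in> V \<Longrightarrow> (g has_derivative (g' y)) (at y)"
    "\<And>y. y \<in> V \<Longrightarrow> g' y = inv (blinfun_apply (f' (g y)))"
    "\<And>y. y \<in> V \<Longrightarrow> bij (blinfun_apply (f' (g y)))"
    by (rule inverse_function_theorem[OF open_UNIV der contf UNIV_I left_inv]) (rule that)
  have "isCont (\<lambda>z. det2 (A z) (B z)) 0"
    using contA unfolding det2_def
    by (auto intro!: continuous_intros simp: continuous_on_eq_continuous_at)
  then have "\<forall>\<^sub>F z in at 0. det2 (A z) (B z) > 0"
    using pos0 by (metis isCont_def order_tendstoD(1))
  then obtain W where W: "open W" "0 \<in> W" "\<And>z. z \<in> W \<Longrightarrow> det2 (A z) (B z) > 0"
    unfolding eventually_at_topological using pos0 that by (metis UNIV_I)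
  obtain r where r: "r > 0" "square r \<subseteq> U \<inter> W"
    using square_inside_open[of "U \<inter> W"] ift W by blast
  have cont\<phi>: "continuous_on UNIV ?\<phi>"
    using der by (meson continuous_at_imp_continuous_on has_derivative_continuous)
  show thesis
  proof (rule that[OF r(1) _ _ cont\<phi>])
    show "inj_on ?\<phi> (square r)"
      using ift(4) r(2) by (metis homeomorphism_def inf.boundedE inj_on_inverseI inj_on_subset)
    show "open (?\<phi> ` X)" if "open X" "X \<subseteq> square r" for X
    proof -
      have "openin (top_of_set V) (?\<phi> ` X)"
        using homeomorphism_imp_open_map[OF ift(4)] that r(2)
        by (metis inf.boundedE open_subset order_trans)
      then show ?thesis using ift(3) openin_open_trans by blast
    qed
    fix z v X assume z: "z \<in> square r" and X: "open X" "z \<in> X"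
    have zU: "z \<in> U" and D: "det2 (A z) (B z) > 0" using z r(2) W(3) by auto
    have yV: "?\<phi> z \<in> V" and gz: "g (?\<phi> z) = z" using ift(4) zU unfolding homeomorphism_def by auto
    define w where "w = g' (?\<phi> z) v"
    have "v = blinfun_apply (f' z) w"
      using ift(6)[OF yV] ift(7)[OF yV] unfolding w_def gz by (simp add: bij_is_surj surj_f_inv_f)
    then have v: "v = Re w *\<^sub>R A z + Im w *\<^sub>R B z" by (simp add: f'_apply)
    have lim0: "((\<lambda>h. ?\<phi> z + of_real h * v) \<longlongrightarrow> ?\<phi> z) (at_right 0)"
      by (rule tendsto_eq_intros | simp)+
    have "((\<lambda>h. g (?\<phi> z + of_real h * v)) has_vector_derivative w) (at 0)"
    proof -
      have 1: "((\<lambda>h. ?\<phi> z + of_real h * v) has_derivative (\<lambda>h. of_real h * v)) (at 0)"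
        by (auto intro!: derivative_eq_intros)
      have 2: "(g has_derivative g' (?\<phi> z)) (at (?\<phi> z + of_real 0 * v))"
        using ift(5)[OF yV] by simp
      have lin: "linear (g' (?\<phi> z))" using ift(5)[OF yV] has_derivative_linear by blast
      have "g' (?\<phi> z) (of_real h * v) = h *\<^sub>R w" for h
        using linear_cmul[OF lin, of h v] by (simp add: w_def scaleR_conv_of_real)
      with has_derivative_compose[OF 1 2] show ?thesis
        by (simp add: has_vector_derivative_def)
    qed
    then have der_h: "((\<lambda>h. g (?\<phi> z + of_real h * v)) has_vector_derivative w) (at_right 0)"
      by (rule has_vector_derivative_at_within)
    have q1: "((\<lambda>h. (Im (g (?\<phi> z + of_real h * v)) - Im z) / h) \<longlongrightarrow> Im w) (at_right 0)"
      using bounded_linear.has_vector_derivative[OF bounded_linear_Im der_h] gz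
      unfolding has_real_derivative_iff_has_vector_derivative[symmetric] has_field_derivative_iff by simp
    have q2: "((\<lambda>h. (Re (g (?\<phi> z + of_real h * v)) - Re z) / h) \<longlongrightarrow> Re w) (at_right 0)"
      using bounded_linear.has_vector_derivative[OF bounded_linear_Re der_h] gz
      unfolding has_real_derivative_iff_has_vector_derivative[symmetric] has_field_derivative_iff by simp
    have "?\<phi> ` (X \<inter> U) = V \<inter> g -` (X \<inter> U)"
      using ift(4) unfolding homeomorphism_def by force
    moreover have "openin (top_of_set V) (?\<phi> ` (X \<inter> U))"
      using homeomorphism_imp_open_map[OF ift(4)] X ift(1) by (metis Int_commute openin_open_Int)
    ultimately have "open (V \<inter> g -` (X \<inter> U))" using ift(3) openin_open_trans by metis
    then have e1: "\<forall>\<^sub>F h in at_right 0. ?\<phi> z + of_real h * v \<in> V \<inter> g -` X"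
      using topological_tendstoD[OF lim0 \<open>open (V \<inter> g -` (X \<inter> U))\<close>] yV gz X zU
      by (auto elim!: eventually_mono)
    have pos_h: "\<forall>\<^sub>F h in at_right (0::real). h > 0" by (simp add: eventually_at_right_less)
    have s1: "\<forall>\<^sub>F h in at_right 0. Im w > 0 \<longrightarrow> Im (g (?\<phi> z + of_real h * v)) > Im z"
    proof (cases "Im w > 0")
      case True
      show ?thesis using order_tendstoD(1)[OF q1 True] pos_h
        by eventually_elim (use True in \<open>simp add: zero_less_divide_iff divide_less_0_iff\<close>)
    qed simp
    have s2: "\<forall>\<^sub>F h in at_right 0. Im w < 0 \<longrightarrow> Im (g (?\<phi> z + of_real h * v)) < Im z"
    proof (cases "Im w < 0")
      case True
      show ?thesis using order_tendstoD(2)[OF q1 True] pos_h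
        by eventually_elim (use True in \<open>simp add: zero_less_divide_iff divide_less_0_iff\<close>)
    qed simp
    have s3: "\<forall>\<^sub>F h in at_right 0. Re w > 0 \<longrightarrow> Re (g (?\<phi> z + of_real h * v)) > Re z"
    proof (cases "Re w > 0")
      case True
      show ?thesis using order_tendstoD(1)[OF q2 True] pos_h
        by eventually_elim (use True in \<open>simp add: zero_less_divide_iff divide_less_0_iff\<close>)
    qed simp
    have s4: "\<forall>\<^sub>F h in at_right 0. Re w < 0 \<longrightarrow> Re (g (?\<phi> z + of_real h * v)) < Re z"
    proof (cases "Re w < 0")
      case True
      show ?thesis using order_tendstoD(2)[OF q2 True] pos_h
        by eventually_elim (use True in \<open>simp add: zero_less_divide_iff divide_less_0_iff\<close>)
    qed simp
    have signs: "det2 (A z) v > 0 \<longleftrightarrow> Im w > 0" "det2 (A z) v < 0 \<longleftrightarrow> Im w < 0"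
      "det2 v (B z) > 0 \<longleftrightarrow> Re w > 0" "det2 v (B z) < 0 \<longleftrightarrow> Re w < 0"
      using coordinates_eq[OF v] D by (simp_all add: zero_less_mult_iff mult_less_0_iff)
    show "\<forall>\<^sub>F h in at_right 0. \<exists>z'\<in>X. ?\<phi> z' = ?\<phi> z + of_real h * v \<and>
          (det2 (vector_derivative \<gamma> (at (t + Re z))) v > 0 \<longrightarrow> Im z' > Im z) \<and>
          (det2 (vector_derivative \<gamma> (at (t + Re z))) v < 0 \<longrightarrow> Im z' < Im z) \<and>
          (det2 v (vector_derivative \<eta> (at (u + Im z))) > 0 \<longrightarrow> Re z' > Re z) \<and>
          (det2 v (vector_derivative \<eta> (at (u + Im z))) < 0 \<longrightarrow> Re z' < Re z)"
      using e1 s1 s2 s3 s4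
    proof eventually_elim
      case (elim h)
      then show ?case
        using ift(4) signs unfolding A_def B_def homeomorphism_def
        by (intro bexI[of _ "g (?\<phi> z + of_real h * v)"]) auto
    qed
  qed
qed

text \<open>All the one-sided limits of the definitions are over rays, and only the set in which a ray
  starts matters.\<close>

definition enters :: "complex \<Rightarrow> complex \<Rightarrow> complex set \<Rightarrow> bool" where
  "enters p v X \<longleftrightarrow> (\<forall>\<^sub>F h in at_right (0::real). p + of_real h * v \<in> X)"

text \<open>Strict inequalities on the coordinates of \<open>z\<close> persist on a short ray, and a zero coordinate gets
  the sign dictated by the direction \<open>v\<close>.  A proof that a ray enters a quadrant thus reduces to
  inspecting signs.\<close>

lemma grid_enters:
  assumes move: "\<And>X. open X \<Longrightarrow> z \<in> X \<Longrightarrow>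
       \<forall>\<^sub>F h in at_right 0. \<exists>z'\<in>X. \<phi> z' = \<phi> z + of_real h * v \<and>
          (a > 0 \<longrightarrow> Im z' > Im z) \<and> (a < 0 \<longrightarrow> Im z' < Im z) \<and>
          (b > 0 \<longrightarrow> Re z' > Re z) \<and> (b < (0::real) \<longrightarrow> Re z' < Re z)"
    and z: "z \<in> square s"
    and Q: "\<And>z'. z' \<in> square s \<Longrightarrow>
       (Re z > 0 \<longrightarrow> Re z' > 0) \<Longrightarrow> (Re z < 0 \<longrightarrow> Re z' < 0) \<Longrightarrow>
       (Im z > 0 \<longrightarrow> Im z' > 0) \<Longrightarrow> (Im z < 0 \<longrightarrow> Im z' < 0) \<Longrightarrow>
       ((a::real) > 0 \<longrightarrow> Im z' > Im z) \<Longrightarrow> (a < 0 \<longrightarrow> Im z' < Im z) \<Longrightarrow>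
       (b > 0 \<longrightarrow> Re z' > Re z) \<Longrightarrow> (b < 0 \<longrightarrow> Re z' < Re z) \<Longrightarrow> z' \<in> Q"
  shows "enters (\<phi> z) v (\<phi> ` Q)"
proof -
  let ?X = "square s \<inter> {z'. Re z > 0 \<longrightarrow> Re z' > 0} \<inter> {z'. Re z < 0 \<longrightarrow> Re z' < 0} \<inter>
    {z'. Im z > 0 \<longrightarrow> Im z' > 0} \<inter> {z'. Im z < 0 \<longrightarrow> Im z' < 0}"
  have imp: "open {z. P \<longrightarrow> S z}" if "open {z. S z}" for P and S :: "complex \<Rightarrow> bool"
    using that by (cases P) auto
  have op: "open ?X"
    by (intro open_Int open_square imp open_halfspace_Re_lt open_halfspace_Re_gt
        open_halfspace_Im_lt open_halfspace_Im_gt)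
  have "z \<in> ?X" using z by auto
  from move[OF op this] show ?thesis
    unfolding enters_def
  proof eventually_elim
    case (elim h)
    then obtain z' where z': "z' \<in> ?X" "\<phi> z' = \<phi> z + of_real h * v"
      "a > 0 \<longrightarrow> Im z' > Im z" "a < 0 \<longrightarrow> Im z' < Im z"
      "b > 0 \<longrightarrow> Re z' > Re z" "b < 0 \<longrightarrow> Re z' < Re z" by blast
    have "z' \<in> Q" by (rule Q) (use z' in auto)
    then show ?case using z'(2) by (metis imageI)
  qed
qed

lemma det2_ii_right: "det2 v (\<i> * v) = (norm v)\<^sup>2" "det2 v (- (\<i> * v)) = - (norm v)\<^sup>2"
  "det2 (\<i> * v) v = - (norm v)\<^sup>2" "det2 (- (\<i> * v)) v = (norm v)\<^sup>2"
  by (auto simp: det2_eq cmod_power2) (auto simp: power2_eq_square)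

section \<open>Parameters and branches of a generic curve\<close>

lemma generic_periodic:
  assumes "generic_curve C"
  shows "C i (t + of_int n) = C i t"
proof -
  have step: "C i (s + 1) = C i s" for s using assms by (simp add: generic_curve_def)
  have nat: "C i (s + of_nat m) = C i s" for s m
  proof (induction m)
    case (Suc m)
    then show ?case using step[of "s + of_nat m"] by (simp add: algebra_simps)
  qed simp
  show ?thesis
  proof (cases "n \<ge> 0")
    case True
    then show ?thesis using nat[of t "nat n"] by simp
  next
    case False
    then show ?thesis using nat[of "t + of_int n" "nat (-n)"] by simp
  qed
qed

lemma generic_frac [simp]: "generic_curve C \<Longrightarrow> C i (frac t) = C i t"
  using generic_periodic[of C i t "- \<lfloor>t\<rfloor>"] by (simp add: frac_def)

lemma frac_eq_obtain:
  assumes "frac t = frac (u::real)" obtains n :: int where "t = u + of_int n"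
  using assms that[of "\<lfloor>t\<rfloor> - \<lfloor>u\<rfloor>"] by (simp add: frac_def algebra_simps)

lemma generic_frac_eq: "generic_curve C \<Longrightarrow> frac t = frac u \<Longrightarrow> C i t = C i u"
  by (metis generic_frac)

lemma generic_vector_derivative:
  assumes "generic_curve C"
  shows "(C i has_vector_derivative tangent C (i, t)) (at t)"
  using assms by (simp add: generic_curve_def C1_differentiable_on_eq tangent_def vector_derivative_works)

lemma generic_continuous: "generic_curve C \<Longrightarrow> continuous_on X (C i)"
  using generic_vector_derivative[of C i]
  by (meson continuous_at_imp_continuous_on has_vector_derivative_continuous)

lemma tangent_frac_eq:
  assumes "generic_curve C" "frac t = frac u"
  shows "tangent C (i, t) = tangent C (i, u)"
proof -
  obtain n where n: "t = u + of_int n" using assms(2) by (rule frac_eq_obtain)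
  have "((\<lambda>x. C i (x + of_int n)) has_vector_derivative tangent C (i, t)) (at u)"
  proof -
    have "((\<lambda>x. x + of_int n) has_vector_derivative 1) (at u)"
      by (auto intro!: derivative_eq_intros)
    from vector_diff_chain_at[OF this, of "C i" "tangent C (i, t)"] show ?thesis
      using generic_vector_derivative[OF assms(1), of i t] n by (simp add: o_def)
  qed
  then have "(C i has_vector_derivative tangent C (i, t)) (at u)"
    by (simp add: generic_periodic[OF assms(1)])
  then show ?thesis
    using generic_vector_derivative[OF assms(1), of i u] vector_derivative_unique_at by blast
qed

lemma tangent_frac: "generic_curve C \<Longrightarrow> tangent C (i, frac t) = tangent C (i, t)"
  by (rule tangent_frac_eq) simp_all

lemma tangent_nonzero: "generic_curve C \<Longrightarrow> tangent C (i, t) \<noteq> 0"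
  by (simp add: generic_curve_def)

lemma frac_in_branches: "generic_curve C \<Longrightarrow> C i t = p \<Longrightarrow> (i, frac t) \<in> branches C p"
  by (simp add: branches_def frac_lt_1)

lemma branchesD: "(i, t) \<in> branches C p \<Longrightarrow> C i t = p \<and> frac t = t"
  by (auto simp: branches_def frac_eq)

text \<open>The parameters of a curve range over the reals, so equality on the circle is equality of
  fractional parts.\<close>

lemma simple_iff:
  assumes "generic_curve C"
  shows "C i t \<notin> double_points C \<longleftrightarrow> (\<forall>j u. C j u = C i t \<longrightarrow> j = i \<and> frac u = frac t)"
proof -
  let ?B = "branches C (C i t)"
  have fin: "finite ?B" "card ?B \<le> 2" using assms by (auto simp: generic_curve_def)
  have mem: "(i, frac t) \<in> ?B" using assms by (simp add: frac_in_branches)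
  have "C i t \<notin> double_points C \<longleftrightarrow> card ?B = 1"
  proof -
    have "card ?B > 0" using fin mem card_gt_0_iff by blast
    then show ?thesis using fin(2) unfolding double_points_def mem_Collect_eq by linarith
  qed
  also have "\<dots> \<longleftrightarrow> ?B = {(i, frac t)}"
    using mem by (auto simp: card_1_singleton_iff)
  also have "\<dots> \<longleftrightarrow> (\<forall>j u. C j u = C i t \<longrightarrow> j = i \<and> frac u = frac t)"
  proof
    assume "?B = {(i, frac t)}"
    then show "\<forall>j u. C j u = C i t \<longrightarrow> j = i \<and> frac u = frac t"
      using frac_in_branches[OF assms] by blast
  next
    assume "\<forall>j u. C j u = C i t \<longrightarrow> j = i \<and> frac u = frac t"
    then have "b = (i, frac t)" if "b \<in> ?B" for b
      using branchesD[of "fst b" "snd b" C "C i t"] that by (metis prod.collapse)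
    then show "?B = {(i, frac t)}" using mem by blast
  qed
  finally show ?thesis .
qed

lemma branches_double:
  assumes "generic_curve C" "C i t = p" "C j u = p" "(i, frac t) \<noteq> (j, frac u)"
  shows "branches C p = {(i, frac t), (j, frac u)}" "p \<in> double_points C"
proof -
  have fin: "finite (branches C p)" "card (branches C p) \<le> 2" using assms by (auto simp: generic_curve_def)
  have sub: "{(i, frac t), (j, frac u)} \<subseteq> branches C p"
    using assms frac_in_branches by blast
  show eq: "branches C p = {(i, frac t), (j, frac u)}"
    using card_seteq[OF fin(1) sub] fin(2) assms(4) by auto
  show "p \<in> double_points C"
    unfolding double_points_def using eq assms(4) by simp
qed

lemma transversal:
  assumes "generic_curve C" "C i t = C j u" "(i, frac t) \<noteq> (j, frac u)"
  shows "det2 (tangent C (i, t)) (tangent C (j, u)) \<noteq> 0"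
proof -
  have "(i, frac t) \<in> branches C (C i t)" "(j, frac u) \<in> branches C (C i t)"
    using assms frac_in_branches by metis+
  then have "det2 (tangent C (i, frac t)) (tangent C (j, frac u)) \<noteq> 0"
    using assms(1,3) unfolding generic_curve_def det2_def by blast
  then show ?thesis
    using tangent_frac_eq[OF assms(1), of "frac t" t i] tangent_frac_eq[OF assms(1), of "frac u" u j]
    by simp
qed

lemma double_point_cases:
  assumes "generic_curve C" "p \<in> double_points C"
  obtains i t j u where "C i t = p" "C j u = p"
    "det2 (tangent C (i, t)) (tangent C (j, u)) > 0" "(i, frac t) \<noteq> (j, frac u)"
proof -
  have "card (branches C p) = 2" using assms by (simp add: double_points_def)
  then obtain b b' where bb: "branches C p = {b, b'}" "b \<noteq> b'" by (meson card_2_iff)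
  obtain i t j u where ij: "b = (i, t)" "b' = (j, u)" by (metis surj_pair)
  have C: "C i t = p" "C j u = p" "frac t = t" "frac u = u"
    using branchesD[of i t C p] branchesD[of j u C p] by (simp_all add: bb ij)
  have ne: "det2 (tangent C (i, t)) (tangent C (j, u)) \<noteq> 0"
    using transversal[OF assms(1), of i t j u] C bb(2) ij by auto
  have sym: "det2 (tangent C (j, u)) (tangent C (i, t)) = - det2 (tangent C (i, t)) (tangent C (j, u))"
    by (simp add: det2_eq)
  show thesis
  proof (cases "det2 (tangent C (i, t)) (tangent C (j, u)) > 0")
    case True
    then show thesis using that[of i t j u] C bb(2) ij by auto
  next
    case False
    then show thesis using that[of j u i t] C bb(2) ij ne sym by auto
  qed
qed

lemma curve_image_iff: "p \<in> curve_image C \<longleftrightarrow> (\<exists>i t. C i t = p)"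
  by (auto simp: curve_image_def)

lemma double_points_on_curve: "p \<in> double_points C \<Longrightarrow> p \<in> curve_image C"
proof -
  assume "p \<in> double_points C"
  then have "branches C p \<noteq> {}" by (auto simp: double_points_def)
  then show ?thesis by (auto simp: branches_def curve_image_iff)
qed

lemma curve_image_eq:
  assumes gen: "generic_curve C"
  shows "curve_image C = (\<Union>i. C i ` {0..1})"
proof
  show "curve_image C \<subseteq> (\<Union>i. C i ` {0..1})"
  proof
    fix p assume "p \<in> curve_image C"
    then obtain i t where "C i t = p" by (auto simp: curve_image_def)
    then have "p = C i (frac t)" using gen by simp
    moreover have "frac t \<in> {0..1}" using frac_lt_1[of t] frac_ge_0[of t] by simp
    ultimately show "p \<in> (\<Union>i. C i ` {0..1})" by blast
  qed
qed (auto simp: curve_image_def)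

lemma compact_curve_image:
  fixes C :: "('i::finite) curve"
  shows "generic_curve C \<Longrightarrow> compact (curve_image C)"
  by (simp add: curve_image_eq compact_UN compact_continuous_image generic_continuous)

text \<open>The parameters in one period at distance at least \<open>\<rho>\<close> from the preimages of \<open>p\<close> form a compact set,
  whose image is closed and misses \<open>p\<close>.  No other part of the curve comes close to \<open>p\<close>.\<close>

lemma nearby_parameters:
  fixes C :: "('i::finite) curve"
  assumes gen: "generic_curve C" and \<rho>: "\<rho> > 0"
  obtains W where "open W" "p \<in> W" "\<And>k v. C k v \<in> W \<Longrightarrow> \<exists>v'. C k v' = p \<and> \<bar>v - v'\<bar> < \<rho>"
proof -
  define F where "F k = {0..1} \<inter> (\<Inter>v' \<in> {v'. C k v' = p}. {v. \<rho> \<le> \<bar>v - v'\<bar>})" for k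
  have cF: "compact (F k)" for k
    unfolding F_def by (intro compact_Int_closed closed_INT ballI closed_Collect_le continuous_intros) auto
  have "closed (\<Union>k. C k ` F k)"
    by (intro compact_imp_closed compact_UN compact_continuous_image generic_continuous gen cF) auto
  moreover have "p \<in> - (\<Union>k. C k ` F k)"
  proof -
    have "v \<notin> F k" if "C k v = p" for k v
      using \<rho> that unfolding F_def by (auto intro!: bexI[of _ v])
    then show ?thesis by auto
  qed
  moreover have "\<exists>v'. C k v' = p \<and> \<bar>v - v'\<bar> < \<rho>" if "C k v \<in> - (\<Union>k. C k ` F k)" for k v
  proof -
    have "frac v \<notin> F k"
    proof
      assume "frac v \<in> F k"
      then have "C k (frac v) \<in> (\<Union>k. C k ` F k)" by blast
      then show False using that gen by simp
    qed
    then obtain v' where v': "C k v' = p" "\<bar>frac v - v'\<bar> < \<rho>"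
      unfolding F_def using frac_lt_1[of v] frac_ge_0[of v] by (auto simp: not_le)
    then show ?thesis
      using generic_periodic[OF gen, of k v' "\<lfloor>v\<rfloor>"]
      by (intro exI[of _ "v' + of_int \<lfloor>v\<rfloor>"]) (auto simp: frac_def algebra_simps)
  qed
  ultimately show thesis using that[OF open_Compl] by blast
qed

section \<open>The local pictures of a generic curve\<close>

text \<open>Near a double point \<open>\<eta>\<close> is the second branch, and near a simple point it is an auxiliary transversal.
  The flag \<open>two\<close> tells whether the imaginary axis belongs to the curve, so that one chart serves both
  cases.\<close>

lemma local_model:
  fixes C :: "('i::finite) curve"
  assumes gen: "generic_curve C" and \<eta>: "\<eta> C1_differentiable_on UNIV"
    and d: "C i t = d" "\<eta> u = d"
    and pos: "det2 (tangent C (i, t)) (vector_derivative \<eta> (at u)) > 0"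
    and V: "open V" "d \<in> V"
    and two: "two \<Longrightarrow> \<eta> = C j"
    and br: "\<And>k v. C k v = d \<Longrightarrow> (k, frac v) = (i, frac t) \<or> two \<and> (k, frac v) = (j, frac u)"
  defines "\<phi> \<equiv> grid (C i) t \<eta> u"
  obtains r where "r > 0" "open (\<phi> ` square r)" "\<phi> ` square r \<subseteq> V"
    "continuous_on UNIV \<phi>"
    "\<And>z. z \<in> square r \<Longrightarrow> \<phi> z \<in> curve_image C \<longleftrightarrow> Im z = 0 \<or> two \<and> Re z = 0"
    "\<And>x. \<bar>x\<bar> < r \<Longrightarrow> x \<noteq> 0 \<or> \<not> two \<Longrightarrow> C i (t + x) \<notin> double_points C"
    "\<And>x. \<bar>x\<bar> < r \<Longrightarrow> x \<noteq> 0 \<Longrightarrow> two \<Longrightarrow> C j (u + x) \<notin> double_points C"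
    "\<And>z v Q a b. z \<in> square r \<Longrightarrow> a = det2 (tangent C (i, t + Re z)) v \<Longrightarrow>
       b = det2 v (vector_derivative \<eta> (at (u + Im z))) \<Longrightarrow>
       (\<And>z'. z' \<in> square r \<Longrightarrow>
         (Re z > 0 \<longrightarrow> Re z' > 0) \<Longrightarrow> (Re z < 0 \<longrightarrow> Re z' < 0) \<Longrightarrow>
         (Im z > 0 \<longrightarrow> Im z' > 0) \<Longrightarrow> (Im z < 0 \<longrightarrow> Im z' < 0) \<Longrightarrow>
         (a > 0 \<longrightarrow> Im z' > Im z) \<Longrightarrow> (a < 0 \<longrightarrow> Im z' < Im z) \<Longrightarrow>
         (b > 0 \<longrightarrow> Re z' > Re z) \<Longrightarrow> (b < 0 \<longrightarrow> Re z' < Re z) \<Longrightarrow> z' \<in> Q) \<Longrightarrow>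
       enters (\<phi> z) v (\<phi> ` Q)"
proof -
  have C1: "C i C1_differentiable_on UNIV" using gen by (simp add: generic_curve_def)
  have meet: "C i t = \<eta> u" using d by simp
  obtain r where r: "r > 0" "inj_on \<phi> (square r)"
    "\<And>X. open X \<Longrightarrow> X \<subseteq> square r \<Longrightarrow> open (\<phi> ` X)" "continuous_on UNIV \<phi>"
    and move: "\<And>z v X. z \<in> square r \<Longrightarrow> open X \<Longrightarrow> z \<in> X \<Longrightarrow>
       \<forall>\<^sub>F h in at_right 0. \<exists>z'\<in>X. \<phi> z' = \<phi> z + of_real h * v \<and>
          (det2 (vector_derivative (C i) (at (t + Re z))) v > 0 \<longrightarrow> Im z' > Im z) \<and>
          (det2 (vector_derivative (C i) (at (t + Re z))) v < 0 \<longrightarrow> Im z' < Im z) \<and>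
          (det2 v (vector_derivative \<eta> (at (u + Im z))) > 0 \<longrightarrow> Re z' > Re z) \<and>
          (det2 v (vector_derivative \<eta> (at (u + Im z))) < 0 \<longrightarrow> Re z' < Re z)"
    unfolding \<phi>_def
    by (rule grid_chart[OF C1 \<eta> meet]) (use pos in \<open>simp add: tangent_def\<close>, blast)
  obtain W where W: "open W" "d \<in> W" "\<And>k v. C k v \<in> W \<Longrightarrow> \<exists>v'. C k v' = d \<and> \<bar>v - v'\<bar> < r"
    using nearby_parameters[OF gen r(1)] by metis
  have \<phi>0: "\<phi> 0 = d" using d by (simp add: \<phi>_def grid_def)
  have "open (\<phi> -` (W \<inter> V))" using r(4) W(1) V(1) by (auto simp: continuous_on_open_vimage)
  then have "open (\<phi> -` (W \<inter> V) \<inter> square r)" "0 \<in> \<phi> -` (W \<inter> V) \<inter> square r"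
    using W V \<phi>0 r(1) open_square by (auto simp: square_def)
  then obtain s where s: "s > 0" "square s \<subseteq> \<phi> -` (W \<inter> V) \<inter> square r"
    by (rule square_inside_open)
  have sr: "square s \<subseteq> square r" using s by auto
  have ax1: "\<phi> (Complex x 0) = C i (t + x)" for x using d by (simp add: \<phi>_def grid_def)
  have ax2: "\<phi> (Complex 0 x) = \<eta> (u + x)" for x using d by (simp add: \<phi>_def grid_def)
  \<comment> \<open>A curve point in \<open>W\<close> has its parameter within \<open>r\<close> of a parameter of \<open>d\<close>, so it is also the
    image of a point on an axis of the large square, where \<open>\<phi>\<close> is injective.\<close>
  have on_axes: "(k = i \<and> (\<exists>x. frac v = frac (t + x) \<and> z = Complex x 0)) \<or>
      two \<and> k = j \<and> (\<exists>x. frac v = frac (u + x) \<and> z = Complex 0 x)"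
    if z: "z \<in> square s" and "C k v = \<phi> z" for z k v
  proof -
    have "C k v \<in> W" using that s by auto
    then obtain v' where v': "C k v' = d" "\<bar>v - v'\<bar> < r" using W by blast
    from br[OF v'(1)] show ?thesis
    proof (elim disjE conjE)
      assume "(k, frac v') = (i, frac t)"
      then obtain n where k: "k = i" and n: "v' = t + of_int n" using frac_eq_obtain by blast
      have fr: "frac v = frac (t + (v - v'))"
        unfolding n by (simp add: frac_def algebra_simps)
      have "\<phi> (Complex (v - v') 0) = \<phi> z"
        using generic_frac_eq[OF gen fr, of i] that(2) k by (simp add: ax1)
      moreover have "Complex (v - v') 0 \<in> square r" using v'(2) r(1) by (simp add: square_def)
      ultimately have "z = Complex (v - v') 0" using inj_onD[OF r(2)] sr z by blast
      then show ?thesis using k fr by blast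
    next
      assume tw: two and "(k, frac v') = (j, frac u)"
      then obtain n where k: "k = j" and n: "v' = u + of_int n" using frac_eq_obtain by blast
      have fr: "frac v = frac (u + (v - v'))"
        unfolding n by (simp add: frac_def algebra_simps)
      have "\<phi> (Complex 0 (v - v')) = \<phi> z"
        using generic_frac_eq[OF gen fr, of j] that(2) k two[OF tw] by (simp add: ax2)
      moreover have "Complex 0 (v - v') \<in> square r" using v'(2) r(1) by (simp add: square_def)
      ultimately have "z = Complex 0 (v - v')" using inj_onD[OF r(2)] sr z by blast
      then show ?thesis using k fr tw by blast
    qed
  qed
  show thesis
  proof (rule that[OF s(1)])
    show "open (\<phi> ` square s)" using r(3) sr open_square by blast
    show "\<phi> ` square s \<subseteq> V" using s by auto
    show "continuous_on UNIV \<phi>" by fact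
    show "\<phi> z \<in> curve_image C \<longleftrightarrow> Im z = 0 \<or> two \<and> Re z = 0" if z: "z \<in> square s" for z
    proof
      assume "\<phi> z \<in> curve_image C"
      then obtain k v where "C k v = \<phi> z" by (auto simp: curve_image_iff)
      from on_axes[OF z this] show "Im z = 0 \<or> two \<and> Re z = 0" by auto
    next
      assume "Im z = 0 \<or> two \<and> Re z = 0"
      then have "\<phi> z = C i (t + Re z) \<or> \<phi> z = C j (u + Im z)"
        using ax1[of "Re z"] ax2[of "Im z"] two by (metis complex.exhaust_sel)
      then show "\<phi> z \<in> curve_image C" by (metis curve_image_iff)
    qed
    show "C i (t + x) \<notin> double_points C" if x: "\<bar>x\<bar> < s" "x \<noteq> 0 \<or> \<not> two" for x
      unfolding simple_iff[OF gen]
    proof (intro allI impI)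
      fix k v assume "C k v = C i (t + x)"
      then have "C k v = \<phi> (Complex x 0)" by (simp add: ax1)
      moreover have "Complex x 0 \<in> square s" using x s(1) by (simp add: square_def)
      ultimately show "k = i \<and> frac v = frac (t + x)" using on_axes x(2) by fastforce
    qed
    show "C j (u + x) \<notin> double_points C" if x: "\<bar>x\<bar> < s" "x \<noteq> 0" two for x
      unfolding simple_iff[OF gen]
    proof (intro allI impI)
      fix k v assume "C k v = C j (u + x)"
      then have "C k v = \<phi> (Complex 0 x)" using two[OF x(3)] by (simp add: ax2)
      moreover have "Complex 0 x \<in> square s" using x s(1) by (simp add: square_def)
      ultimately show "k = j \<and> frac v = frac (u + x)" using on_axes x(2) by fastforce
    qed
    show "enters (\<phi> z) v (\<phi> ` Q)" if "z \<in> square s" "a = det2 (tangent C (i, t + Re z)) v"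
       "b = det2 v (vector_derivative \<eta> (at (u + Im z)))"
       "\<And>z'. z' \<in> square s \<Longrightarrow>
         (Re z > 0 \<longrightarrow> Re z' > 0) \<Longrightarrow> (Re z < 0 \<longrightarrow> Re z' < 0) \<Longrightarrow>
         (Im z > 0 \<longrightarrow> Im z' > 0) \<Longrightarrow> (Im z < 0 \<longrightarrow> Im z' < 0) \<Longrightarrow>
         (a > 0 \<longrightarrow> Im z' > Im z) \<Longrightarrow> (a < 0 \<longrightarrow> Im z' < Im z) \<Longrightarrow>
         (b > 0 \<longrightarrow> Re z' > Re z) \<Longrightarrow> (b < 0 \<longrightarrow> Re z' < Re z) \<Longrightarrow> z' \<in> Q"
       for z v Q a b
    proof (rule grid_enters)
      show "\<forall>\<^sub>F h in at_right 0. \<exists>z'\<in>X. \<phi> z' = \<phi> z + of_real h * v \<and>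
          (a > 0 \<longrightarrow> Im z' > Im z) \<and> (a < 0 \<longrightarrow> Im z' < Im z) \<and>
          (b > 0 \<longrightarrow> Re z' > Re z) \<and> (b < 0 \<longrightarrow> Re z' < Re z)" if "open X" "z \<in> X" for X
        using move[OF _ that] \<open>z \<in> square s\<close> sr
        unfolding \<open>a = _\<close> \<open>b = _\<close> by (simp add: tangent_def subset_iff)
    qed (use that in blast)+
  qed
qed

lemma connected_grid_image:
  fixes \<phi> :: "complex \<Rightarrow> complex"
  assumes "continuous_on UNIV \<phi>" "convex X" shows "connected (\<phi> ` X)"
  by (intro connected_continuous_image continuous_on_subset[OF assms(1)] convex_connected assms(2)) auto

lemma image_minus_condition:
  assumes "\<And>z. z \<in> A \<Longrightarrow> f z \<in> K \<longleftrightarrow> P z"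
  shows "f ` A - K = f ` {z \<in> A. \<not> P z}"
  using assms by blast

lemma convex_quadrants:
  "convex {z \<in> square r. Re z > 0 \<and> Im z > 0}" "convex {z \<in> square r. Re z < 0 \<and> Im z > 0}"
  "convex {z \<in> square r. Re z < 0 \<and> Im z < 0}" "convex {z \<in> square r. Re z > 0 \<and> Im z < 0}"
  "convex {z \<in> square r. Im z > 0}" "convex {z \<in> square r. Im z < 0}"
proof -
  have "square r = {z. Re z < r} \<inter> {z. Re z > -r} \<inter> {z. Im z < r} \<inter> {z. Im z > -r}"
    by (auto simp: square_def)
  then have "convex (square r)"
    by (simp add: convex_Int convex_halfspace_Re_lt convex_halfspace_Re_gt convex_halfspace_Im_lt convex_halfspace_Im_gt)
  moreover have h: "{z \<in> square r. P z \<and> Q z} = square r \<inter> {z. P z} \<inter> {z. Q z}"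
    "{z \<in> square r. P z} = square r \<inter> {z. P z}" for P Q by auto
  ultimately show "convex {z \<in> square r. Re z > 0 \<and> Im z > 0}" "convex {z \<in> square r. Re z < 0 \<and> Im z > 0}"
  "convex {z \<in> square r. Re z < 0 \<and> Im z < 0}" "convex {z \<in> square r. Re z > 0 \<and> Im z < 0}"
  "convex {z \<in> square r. Im z > 0}" "convex {z \<in> square r. Im z < 0}"
    unfolding h by (simp_all add: convex_Int convex_halfspace_Re_lt convex_halfspace_Re_gt convex_halfspace_Im_lt convex_halfspace_Im_gt)
qed

text \<open>A simple point has a left and a right side, one set for each on a whole piece of the curve.  The
  auxiliary transversal is the normal line.\<close>

lemma simple_neighbourhood:
  fixes C :: "('i::finite) curve"
  assumes gen: "generic_curve C" and simp: "C i t \<notin> double_points C"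
    and V: "open V" "C i t \<in> V"
  obtains U \<epsilon> L R where "open U" "C i t \<in> U" "U \<subseteq> V" "\<epsilon> > 0"
    "connected L" "connected R" "U - curve_image C = L \<union> R"
    "U \<inter> double_points C = {}"
    "\<And>x. \<bar>x\<bar> < \<epsilon> \<Longrightarrow> C i (t + x) \<in> U"
    "\<And>x. \<bar>x\<bar> < \<epsilon> \<Longrightarrow> enters (C i (t + x)) (\<i> * tangent C (i, t + x)) L"
    "\<And>x. \<bar>x\<bar> < \<epsilon> \<Longrightarrow> enters (C i (t + x)) (- (\<i> * tangent C (i, t + x))) R"
proof -
  define \<eta> where "\<eta> y = C i t + of_real y * (\<i> * tangent C (i, t))" for y
  have d\<eta>: "(\<eta> has_vector_derivative (\<i> * tangent C (i, t))) (at y)" for y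
    unfolding \<eta>_def by (auto intro!: derivative_eq_intros)
  have v\<eta>: "vector_derivative \<eta> (at y) = \<i> * tangent C (i, t)" for y
    using d\<eta> by (rule vector_derivative_at)
  have C1: "\<eta> C1_differentiable_on UNIV"
    unfolding C1_differentiable_on_eq v\<eta> using d\<eta> by (auto simp: differentiable_def has_vector_derivative_def)
  have nz: "tangent C (i, s) \<noteq> 0" for s using gen by (rule tangent_nonzero)
  have pos: "det2 (tangent C (i, t)) (vector_derivative \<eta> (at 0)) > 0"
    unfolding v\<eta> det2_ii_right using nz by simp
  have \<eta>0: "\<eta> 0 = C i t" by (simp add: \<eta>_def)
  have br: "(k, frac v) = (i, frac t) \<or> False \<and> (k, frac v) = (i, frac 0)" if "C k v = C i t" for k v
    using simp[unfolded simple_iff[OF gen]] that by blast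
  let ?\<phi> = "grid (C i) t \<eta> 0"
  show thesis
  proof (rule local_model[where two=False and j=i, OF gen C1 refl \<eta>0 pos V])
  show "\<eta> = C i" if False using that by simp
  show "(k, frac v) = (i, frac t) \<or> False \<and> (k, frac v) = (i, frac 0)" if "C k v = C i t" for k v
    using br that by blast
  fix r assume r: "r > 0" "open (?\<phi> ` square r)" "?\<phi> ` square r \<subseteq> V"
    "continuous_on UNIV ?\<phi>"
    and K: "\<And>z. z \<in> square r \<Longrightarrow> ?\<phi> z \<in> curve_image C \<longleftrightarrow> Im z = 0 \<or> False \<and> Re z = 0"
    and iso: "\<And>x. \<bar>x\<bar> < r \<Longrightarrow> x \<noteq> 0 \<or> \<not> False \<Longrightarrow> C i (t + x) \<notin> double_points C"
    and ent: "\<And>z v Q a b. z \<in> square r \<Longrightarrow> a = det2 (tangent C (i, t + Re z)) v \<Longrightarrow>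
       b = det2 v (vector_derivative \<eta> (at (0 + Im z))) \<Longrightarrow>
       (\<And>z'. z' \<in> square r \<Longrightarrow>
         (Re z > 0 \<longrightarrow> Re z' > 0) \<Longrightarrow> (Re z < 0 \<longrightarrow> Re z' < 0) \<Longrightarrow>
         (Im z > 0 \<longrightarrow> Im z' > 0) \<Longrightarrow> (Im z < 0 \<longrightarrow> Im z' < 0) \<Longrightarrow>
         (a > 0 \<longrightarrow> Im z' > Im z) \<Longrightarrow> (a < 0 \<longrightarrow> Im z' < Im z) \<Longrightarrow>
         (b > 0 \<longrightarrow> Re z' > Re z) \<Longrightarrow> (b < 0 \<longrightarrow> Re z' < Re z) \<Longrightarrow> z' \<in> Q) \<Longrightarrow>
       enters (?\<phi> z) v (?\<phi> ` Q)"
  have ax: "?\<phi> (Complex x 0) = C i (t + x)" for x by (simp add: grid_def \<eta>_def)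
  let ?L = "?\<phi> ` {z \<in> square r. Im z > 0}" and ?R = "?\<phi> ` {z \<in> square r. Im z < 0}"
  have sq: "Complex x 0 \<in> square r" if "\<bar>x\<bar> < r" for x using that by (simp add: square_def)
  have onU: "\<exists>x. \<bar>x\<bar> < r \<and> p = C i (t + x)" if p: "p \<in> ?\<phi> ` square r" "p \<in> curve_image C" for p
  proof -
    obtain z where z: "z \<in> square r" "p = ?\<phi> z" using p(1) by blast
    then have "z = Complex (Re z) 0" using K[OF z(1)] p(2) z(2) by (auto intro: complex_eqI)
    then show ?thesis using z ax by (metis (mono_tags, lifting) mem_Collect_eq square_def)
  qed
  show thesis
  proof (rule that[of "?\<phi> ` square r" r ?L ?R])
    show "C i t \<in> ?\<phi> ` square r" using ax[of 0] sq[of 0] r(1) by (metis abs_zero add_0_right imageI)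
    show "connected ?L" "connected ?R"
      using connected_grid_image[OF r(4)] convex_quadrants by blast+
    show "?\<phi> ` square r - curve_image C = ?L \<union> ?R"
    proof -
      have "?\<phi> ` square r - curve_image C = ?\<phi> ` {z \<in> square r. Im z \<noteq> 0}"
        using image_minus_condition[of "square r" ?\<phi>, OF K] by simp
      also have "{z \<in> square r. Im z \<noteq> 0} = {z \<in> square r. Im z > 0} \<union> {z \<in> square r. Im z < 0}" by auto
      finally show ?thesis by (simp add: image_Un)
    qed
    show "?\<phi> ` square r \<inter> double_points C = {}"
    proof -
      have "p \<notin> double_points C" if "p \<in> ?\<phi> ` square r" for p
        using onU[OF that] iso double_points_on_curve by metis
      then show ?thesis by blast
    qed
    show "C i (t + x) \<in> ?\<phi> ` square r" if "\<bar>x\<bar> < r" for x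
      using ax sq[OF that] by (metis imageI)
    show "enters (C i (t + x)) (\<i> * tangent C (i, t + x)) ?L" if "\<bar>x\<bar> < r" for x
      using ent[OF sq[OF that] refl refl, of "\<i> * tangent C (i, t + x)" "{z \<in> square r. Im z > 0}"] nz[of "t + x"]
      by (simp add: ax det2_ii_right)
    show "enters (C i (t + x)) (- (\<i> * tangent C (i, t + x))) ?R" if "\<bar>x\<bar> < r" for x
      using ent[OF sq[OF that] refl refl, of "- (\<i> * tangent C (i, t + x))" "{z \<in> square r. Im z < 0}"] nz[of "t + x"]
      by (simp add: ax det2_ii_right)
  qed (use r in auto)
  qed
qed

text \<open>The quadrants are numbered counterclockwise, starting from the sector ahead on both branches.  As
  the second branch crosses the first one from right to left, \<open>Q2\<close> is to the left of both and \<open>Q4\<close>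
  to the right of both.\<close>

lemma crossing_neighbourhood:
  fixes C :: "('i::finite) curve"
  assumes gen: "generic_curve C" and d: "C i t = d" "C j u = d"
    and pos: "det2 (tangent C (i, t)) (tangent C (j, u)) > 0"
    and V: "open V" "d \<in> V"
  obtains U \<epsilon> Q1 Q2 Q3 Q4 where "open U" "d \<in> U" "U \<subseteq> V" "\<epsilon> > 0"
    "connected Q1" "connected Q2" "connected Q3" "connected Q4"
    "U - curve_image C = Q1 \<union> Q2 \<union> Q3 \<union> Q4"
    "U \<inter> double_points C \<subseteq> {d}"
    "\<And>x. \<bar>x\<bar> < \<epsilon> \<Longrightarrow> C i (t + x) \<in> U \<and> (x \<noteq> 0 \<longrightarrow> C i (t + x) \<notin> double_points C)"
    "\<And>x. \<bar>x\<bar> < \<epsilon> \<Longrightarrow> C j (u + x) \<in> U \<and> (x \<noteq> 0 \<longrightarrow> C j (u + x) \<notin> double_points C)"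
    "\<And>x. 0 < x \<Longrightarrow> x < \<epsilon> \<Longrightarrow> enters (C i (t + x)) (\<i> * tangent C (i, t + x)) Q1 \<and>
       enters (C i (t + x)) (- (\<i> * tangent C (i, t + x))) Q4"
    "\<And>x. 0 < x \<Longrightarrow> x < \<epsilon> \<Longrightarrow> enters (C i (t - x)) (\<i> * tangent C (i, t - x)) Q2 \<and>
       enters (C i (t - x)) (- (\<i> * tangent C (i, t - x))) Q3"
    "\<And>x. 0 < x \<Longrightarrow> x < \<epsilon> \<Longrightarrow> enters (C j (u + x)) (\<i> * tangent C (j, u + x)) Q2 \<and>
       enters (C j (u + x)) (- (\<i> * tangent C (j, u + x))) Q1"
    "\<And>x. 0 < x \<Longrightarrow> x < \<epsilon> \<Longrightarrow> enters (C j (u - x)) (\<i> * tangent C (j, u - x)) Q3 \<and>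
       enters (C j (u - x)) (- (\<i> * tangent C (j, u - x))) Q4"
    "enters d (tangent C (i, t) + tangent C (j, u)) Q1"
    "enters d (tangent C (j, u) - tangent C (i, t)) Q2"
    "enters d (- tangent C (i, t) - tangent C (j, u)) Q3"
    "enters d (tangent C (i, t) - tangent C (j, u)) Q4"
proof -
  have C1: "C j C1_differentiable_on UNIV" using gen by (simp add: generic_curve_def)
  have nz: "tangent C b \<noteq> 0" for b using gen tangent_nonzero by (metis surj_pair)
  have pos': "det2 (tangent C (i, t)) (vector_derivative (C j) (at u)) > 0"
    using pos by (simp add: tangent_def)
  have ne: "(i, frac t) \<noteq> (j, frac u)"
    using pos tangent_frac_eq[OF gen, of t u i] by (auto simp: det2_eq)
  have br: "(k, frac v) = (i, frac t) \<or> True \<and> (k, frac v) = (j, frac u)" if "C k v = d" for k v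
    using branches_double[OF gen d ne] frac_in_branches[OF gen that] by auto
  let ?\<phi> = "grid (C i) t (C j) u"
  show thesis
  proof (rule local_model[where two=True and j=j, OF gen C1 d pos' V])
  show "C j = C j" by simp
  show "(k, frac v) = (i, frac t) \<or> True \<and> (k, frac v) = (j, frac u)" if "C k v = d" for k v
    using br that by blast
  fix r assume r: "r > 0" "open (?\<phi> ` square r)" "?\<phi> ` square r \<subseteq> V"
    "continuous_on UNIV ?\<phi>"
    and K: "\<And>z. z \<in> square r \<Longrightarrow> ?\<phi> z \<in> curve_image C \<longleftrightarrow> Im z = 0 \<or> True \<and> Re z = 0"
    and iso: "\<And>x. \<bar>x\<bar> < r \<Longrightarrow> x \<noteq> 0 \<or> \<not> True \<Longrightarrow> C i (t + x) \<notin> double_points C"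
      "\<And>x. \<bar>x\<bar> < r \<Longrightarrow> x \<noteq> 0 \<Longrightarrow> True \<Longrightarrow> C j (u + x) \<notin> double_points C"
    and ent: "\<And>z v Q a b. z \<in> square r \<Longrightarrow> a = det2 (tangent C (i, t + Re z)) v \<Longrightarrow>
       b = det2 v (vector_derivative (C j) (at (u + Im z))) \<Longrightarrow>
       (\<And>z'. z' \<in> square r \<Longrightarrow>
         (Re z > 0 \<longrightarrow> Re z' > 0) \<Longrightarrow> (Re z < 0 \<longrightarrow> Re z' < 0) \<Longrightarrow>
         (Im z > 0 \<longrightarrow> Im z' > 0) \<Longrightarrow> (Im z < 0 \<longrightarrow> Im z' < 0) \<Longrightarrow>
         (a > 0 \<longrightarrow> Im z' > Im z) \<Longrightarrow> (a < 0 \<longrightarrow> Im z' < Im z) \<Longrightarrow>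
         (b > 0 \<longrightarrow> Re z' > Re z) \<Longrightarrow> (b < 0 \<longrightarrow> Re z' < Re z) \<Longrightarrow> z' \<in> Q) \<Longrightarrow>
       enters (?\<phi> z) v (?\<phi> ` Q)"
  have ent': "enters (?\<phi> z) v (?\<phi> ` Q)" if "z \<in> square r" "a = det2 (tangent C (i, t + Re z)) v"
       "b = det2 v (tangent C (j, u + Im z))"
       "\<And>z'. z' \<in> square r \<Longrightarrow>
         (Re z > 0 \<longrightarrow> Re z' > 0) \<Longrightarrow> (Re z < 0 \<longrightarrow> Re z' < 0) \<Longrightarrow>
         (Im z > 0 \<longrightarrow> Im z' > 0) \<Longrightarrow> (Im z < 0 \<longrightarrow> Im z' < 0) \<Longrightarrow>
         (a > 0 \<longrightarrow> Im z' > Im z) \<Longrightarrow> (a < 0 \<longrightarrow> Im z' < Im z) \<Longrightarrow>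
         (b > 0 \<longrightarrow> Re z' > Re z) \<Longrightarrow> (b < 0 \<longrightarrow> Re z' < Re z) \<Longrightarrow> z' \<in> Q" for z v Q a b
    by (rule ent[OF that(1,2)]) (use that in \<open>simp_all add: tangent_def\<close>)
  have ax1: "?\<phi> (Complex x 0) = C i (t + x)" for x using d by (simp add: grid_def)
  have ax2: "?\<phi> (Complex 0 x) = C j (u + x)" for x using d by (simp add: grid_def)
  have \<phi>0: "?\<phi> 0 = d" using d by (simp add: grid_def)
  have sq1: "Complex x 0 \<in> square r" "Complex 0 x \<in> square r" if "\<bar>x\<bar> < r" for x
    using that by (simp_all add: square_def)
  have sq0: "0 \<in> square r" using r(1) by (simp add: square_def)
  let ?U = "?\<phi> ` square r"
  let ?Q1 = "{z \<in> square r. Re z > 0 \<and> Im z > 0}" and ?Q2 = "{z \<in> square r. Re z < 0 \<and> Im z > 0}"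
    and ?Q3 = "{z \<in> square r. Re z < 0 \<and> Im z < 0}" and ?Q4 = "{z \<in> square r. Re z > 0 \<and> Im z < 0}"
  show thesis
  proof (rule that[of ?U r "?\<phi> ` ?Q1" "?\<phi> ` ?Q2" "?\<phi> ` ?Q3" "?\<phi> ` ?Q4"])
    show "d \<in> ?U" using \<phi>0 sq0 by (metis imageI)
    show "connected (?\<phi> ` ?Q1)" "connected (?\<phi> ` ?Q2)" "connected (?\<phi> ` ?Q3)" "connected (?\<phi> ` ?Q4)"
      using connected_grid_image[OF r(4)] convex_quadrants by blast+
    show "?U - curve_image C = ?\<phi> ` ?Q1 \<union> ?\<phi> ` ?Q2 \<union> ?\<phi> ` ?Q3 \<union> ?\<phi> ` ?Q4"
    proof -
      have "?U - curve_image C = ?\<phi> ` {z \<in> square r. Im z \<noteq> 0 \<and> Re z \<noteq> 0}"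
        using image_minus_condition[of "square r" ?\<phi>, OF K] by simp
      also have "{z \<in> square r. Im z \<noteq> 0 \<and> Re z \<noteq> 0} = ?Q1 \<union> ?Q2 \<union> ?Q3 \<union> ?Q4" by auto
      finally show ?thesis by (simp add: image_Un)
    qed
    show "?U \<inter> double_points C \<subseteq> {d}"
    proof
      fix p assume p: "p \<in> ?U \<inter> double_points C"
      then obtain z where z: "z \<in> square r" "p = ?\<phi> z" by blast
      have "Im z = 0 \<or> Re z = 0" using K[OF z(1)] p z(2) double_points_on_curve by auto
      then show "p \<in> {d}"
      proof
        assume "Im z = 0"
        then have "z = Complex (Re z) 0" by (auto intro: complex_eqI)
        then have pe: "p = C i (t + Re z)" using z(2) ax1 by metis
        then have "Re z = 0" using iso(1)[of "Re z"] p z(1) pe by (auto simp: square_def)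
        then show ?thesis using pe d by simp
      next
        assume "Re z = 0"
        then have "z = Complex 0 (Im z)" by (auto intro: complex_eqI)
        then have pe: "p = C j (u + Im z)" using z(2) ax2 by metis
        then have "Im z = 0" using iso(2)[of "Im z"] p z(1) pe by (auto simp: square_def)
        then show ?thesis using pe d by simp
      qed
    qed
    show "C i (t + x) \<in> ?U \<and> (x \<noteq> 0 \<longrightarrow> C i (t + x) \<notin> double_points C)"
      "C j (u + x) \<in> ?U \<and> (x \<noteq> 0 \<longrightarrow> C j (u + x) \<notin> double_points C)" if "\<bar>x\<bar> < r" for x
      using ax1[of x] ax2[of x] sq1[OF that] iso[OF that] by (metis imageI)+
    show "enters (C i (t + x)) (\<i> * tangent C (i, t + x)) (?\<phi> ` ?Q1) \<and>
       enters (C i (t + x)) (- (\<i> * tangent C (i, t + x))) (?\<phi> ` ?Q4)" if "0 < x" "x < r" for x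
      using ent'[OF sq1(1)[of x] refl refl, of "\<i> * tangent C (i, t + x)" ?Q1]
        ent'[OF sq1(1)[of x] refl refl, of "- (\<i> * tangent C (i, t + x))" ?Q4] nz[of "(i, t + x)"] that
      by (simp add: ax1 det2_ii_right)
    show "enters (C i (t - x)) (\<i> * tangent C (i, t - x)) (?\<phi> ` ?Q2) \<and>
       enters (C i (t - x)) (- (\<i> * tangent C (i, t - x))) (?\<phi> ` ?Q3)" if "0 < x" "x < r" for x
      using ent'[OF sq1(1)[of "-x"] refl refl, of "\<i> * tangent C (i, t - x)" ?Q2]
        ent'[OF sq1(1)[of "-x"] refl refl, of "- (\<i> * tangent C (i, t - x))" ?Q3] nz[of "(i, t - x)"] that
      by (simp add: ax1 det2_ii_right)
    show "enters (C j (u + x)) (\<i> * tangent C (j, u + x)) (?\<phi> ` ?Q2) \<and>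
       enters (C j (u + x)) (- (\<i> * tangent C (j, u + x))) (?\<phi> ` ?Q1)" if "0 < x" "x < r" for x
      using ent'[OF sq1(2)[of x] refl refl, of "\<i> * tangent C (j, u + x)" ?Q2]
        ent'[OF sq1(2)[of x] refl refl, of "- (\<i> * tangent C (j, u + x))" ?Q1] nz[of "(j, u + x)"] that
      by (simp add: ax2 det2_ii_right)
    show "enters (C j (u - x)) (\<i> * tangent C (j, u - x)) (?\<phi> ` ?Q3) \<and>
       enters (C j (u - x)) (- (\<i> * tangent C (j, u - x))) (?\<phi> ` ?Q4)" if "0 < x" "x < r" for x
      using ent'[OF sq1(2)[of "-x"] refl refl, of "\<i> * tangent C (j, u - x)" ?Q3]
        ent'[OF sq1(2)[of "-x"] refl refl, of "- (\<i> * tangent C (j, u - x))" ?Q4] nz[of "(j, u - x)"] that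
      by (simp add: ax2 det2_ii_right)
    have det_simps: "det2 a (a + b) = det2 a b" "det2 (a + b) b = det2 a b"
      "det2 a (b - a) = det2 a b" "det2 (b - a) b = - det2 a b"
      "det2 a (- a - b) = - det2 a b" "det2 (- a) b = - det2 a b"
      "det2 a (a - b) = - det2 a b" "det2 (a - b) b = det2 a b" for a b
      by (simp_all add: det2_eq algebra_simps)
    show "enters d (tangent C (i, t) + tangent C (j, u)) (?\<phi> ` ?Q1)"
      using ent'[OF sq0 refl refl, of "tangent C (i, t) + tangent C (j, u)" ?Q1] pos
      by (simp add: \<phi>0 det_simps)
    show "enters d (tangent C (j, u) - tangent C (i, t)) (?\<phi> ` ?Q2)"
      using ent'[OF sq0 refl refl, of "tangent C (j, u) - tangent C (i, t)" ?Q2] pos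
      by (simp add: \<phi>0 det_simps)
    show "enters d (- tangent C (i, t) - tangent C (j, u)) (?\<phi> ` ?Q3)"
      using ent'[OF sq0 refl refl, of "- tangent C (i, t) - tangent C (j, u)" ?Q3] pos
      by (simp add: \<phi>0 det_simps)
    show "enters d (tangent C (i, t) - tangent C (j, u)) (?\<phi> ` ?Q4)"
      using ent'[OF sq0 refl refl, of "tangent C (i, t) - tangent C (j, u)" ?Q4] pos
      by (simp add: \<phi>0 det_simps)
  qed (use r in auto)
  qed
qed

lemma enters_mono: "enters p v X \<Longrightarrow> X \<subseteq> Y \<Longrightarrow> enters p v Y"
  unfolding enters_def by (auto elim: eventually_mono)

lemma enters_Int: "enters p v X \<Longrightarrow> enters p v Y \<Longrightarrow> enters p v (X \<inter> Y)"
  unfolding enters_def by (auto intro: eventually_conj)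

lemma enters_nonempty: "enters p v X \<Longrightarrow> X \<noteq> {}"
  unfolding enters_def using eventually_happens trivial_limit_at_right_real by fastforce

lemma enters_open:
  assumes "open X" "p \<in> X" shows "enters p v X"
proof -
  have "((\<lambda>h. p + of_real h * v) \<longlongrightarrow> p) (at_right 0)"
    by (rule tendsto_eq_intros | simp)+
  then show ?thesis unfolding enters_def using assms by (rule topological_tendstoD)
qed

lemma enters_constant:
  assumes "enters p v X" "\<And>z. z \<in> X \<Longrightarrow> g z = c"
  shows "((\<lambda>h. g (p + of_real h * v)) \<longlongrightarrow> c) (at_right 0)"
  using assms unfolding enters_def by (intro tendsto_eventually) (auto elim: eventually_mono)

text \<open>Double points are isolated by the local pictures and lie in a compact set.  Were there
  infinitely many of them, the sum that defines the invariant would be zero by default.\<close>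

lemma finite_double_points:
  fixes C :: "('i::finite) curve"
  assumes gen: "generic_curve C"
  shows "finite (double_points C)"
proof (rule ccontr)
  assume "infinite (double_points C)"
  moreover have "bounded (double_points C)"
    using compact_curve_image[OF gen] double_points_on_curve bounded_subset compact_imp_bounded
    by (metis subsetI)
  ultimately obtain x where x: "x islimpt double_points C"
    using bounded_infinite_imp_islimpt by blast
  have "\<exists>U. open U \<and> x \<in> U \<and> U \<inter> double_points C \<subseteq> {x}"
  proof (cases "x \<in> curve_image C")
    case False
    then show ?thesis
      using compact_imp_closed[OF compact_curve_image[OF gen]] double_points_on_curve
      by (intro exI[of _ "- curve_image C"]) auto
  next
    case True
    show ?thesis
    proof (cases "x \<in> double_points C")
      case True
      then obtain i t j u where "C i t = x" "C j u = x" "det2 (tangent C (i, t)) (tangent C (j, u)) > 0"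
        using double_point_cases[OF gen] by metis
      then obtain U where "open U" "x \<in> U" "U \<inter> double_points C \<subseteq> {x}"
        using crossing_neighbourhood[OF gen, of i t x j u UNIV] by (metis UNIV_I open_UNIV)
      then show ?thesis by blast
    next
      case False
      obtain i t where it: "C i t = x" using True curve_image_iff by metis
      then obtain U where "open U" "x \<in> U" "U \<inter> double_points C = {}"
        using simple_neighbourhood[OF gen, of i t UNIV] False by (metis UNIV_I open_UNIV)
      then show ?thesis by blast
    qed
  qed
  then show False using x unfolding islimpt_def by blast
qed

text \<open>A \<open>C\<^sup>1\<close> image of the line in the plane has measure zero.\<close>

lemma curve_image_nowhere_dense:
  fixes C :: "('i::finite) curve"
  assumes gen: "generic_curve C" and "open U" "U \<noteq> {}"
  shows "\<exists>z\<in>U. z \<notin> curve_image C"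
proof (rule ccontr)
  assume "\<not> ?thesis"
  then have sub: "U \<subseteq> curve_image C" by blast
  have "negligible (range (C i))" for i
  proof (rule negligible_differentiable_image_lowdim)
    show "C i differentiable_on UNIV"
      using generic_vector_derivative[OF gen, of i]
      by (auto simp: differentiable_on_def differentiable_def has_vector_derivative_def)
  qed simp
  then have "negligible (curve_image C)"
    unfolding curve_image_def by (intro negligible_Union_nat negligible_Union) auto
  then show False
    using sub assms(2,3) negligible_subset open_not_negligible by blast
qed

section \<open>Numberings and levels\<close>

text \<open>The two properties of Alexander numberings that matter locally, for a function on points instead of
  regions and for a jump \<open>\<delta>\<close> from the right side to the left side.  The difference of two numberings
  has them with \<open>\<delta> = 0\<close>.\<close>

definition numbering :: "complex set \<Rightarrow> real \<Rightarrow> (complex \<Rightarrow> real) \<Rightarrow> 'i curve \<Rightarrow> bool" where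
  "numbering V \<delta> g C \<longleftrightarrow>
     (\<forall>Q. connected Q \<and> Q \<subseteq> V - curve_image C \<longrightarrow> (\<forall>z\<in>Q. \<forall>w\<in>Q. g z = g w)) \<and>
     (\<forall>i t. C i t \<in> V \<and> C i t \<notin> double_points C \<longrightarrow>
        (\<forall>\<^sub>F h in at_right 0. g (C i t + of_real h * (\<i> * tangent C (i, t))) =
           g (C i t + of_real h * (- (\<i> * tangent C (i, t)))) + \<delta>))"

text \<open>The level \<open>c\<close> is the mean of the numbers on the two sides, which differ by \<open>\<delta>\<close>.\<close>

definition level :: "real \<Rightarrow> (complex \<Rightarrow> real) \<Rightarrow> 'i curve \<Rightarrow> 'i \<Rightarrow> real \<Rightarrow> real \<Rightarrow> bool" where
  "level \<delta> g C i t c \<longleftrightarrow>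
     enters (C i t) (\<i> * tangent C (i, t)) {z. z \<notin> curve_image C \<and> g z = c + \<delta>/2} \<and>
     enters (C i t) (- (\<i> * tangent C (i, t))) {z. z \<notin> curve_image C \<and> g z = c - \<delta>/2}"

lemma level_unique: "level \<delta> g C i t c \<Longrightarrow> level \<delta> g C i t c' \<Longrightarrow> c = c'"
proof -
  assume "level \<delta> g C i t c" "level \<delta> g C i t c'"
  then have "enters (C i t) (\<i> * tangent C (i, t))
    ({z. z \<notin> curve_image C \<and> g z = c + \<delta>/2} \<inter> {z. z \<notin> curve_image C \<and> g z = c' + \<delta>/2})"
    by (simp add: level_def enters_Int)
  from enters_nonempty[OF this] show ?thesis by auto
qed

lemma numbering_eq:
  "numbering V \<delta> g C \<Longrightarrow> connected Q \<Longrightarrow> Q \<subseteq> V - curve_image C \<Longrightarrow> z \<in> Q \<Longrightarrow> w \<in> Q \<Longrightarrow> g z = g w"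
  unfolding numbering_def by blast

lemma numbering_jump_eventually:
  "numbering V \<delta> g C \<Longrightarrow> C i t \<in> V \<Longrightarrow> C i t \<notin> double_points C \<Longrightarrow>
     \<forall>\<^sub>F h in at_right 0. g (C i t + of_real h * (\<i> * tangent C (i, t))) =
           g (C i t + of_real h * (- (\<i> * tangent C (i, t)))) + \<delta>"
  unfolding numbering_def by blast

lemma numbering_constant:
  assumes "numbering V \<delta> g C" "connected Q" "Q \<subseteq> V - curve_image C"
  obtains q where "\<And>z. z \<in> Q \<Longrightarrow> g z = q"
proof (cases "Q = {}")
  case False
  then obtain w where "w \<in> Q" by blast
  then have "g z = g w" if "z \<in> Q" for z
    using assms that unfolding numbering_def by blast
  then show thesis using that by blast
qed (use that in blast)

lemma numbering_jump:
  assumes num: "numbering V \<delta> g C" and V: "C i t \<in> V" "C i t \<notin> double_points C"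
    and L: "enters (C i t) (\<i> * tangent C (i, t)) L" "\<And>z. z \<in> L \<Longrightarrow> g z = l"
    and R: "enters (C i t) (- (\<i> * tangent C (i, t))) R" "\<And>z. z \<in> R \<Longrightarrow> g z = r"
  shows "l = r + \<delta>"
proof -
  have "\<forall>\<^sub>F h in at_right 0. g (C i t + of_real h * (\<i> * tangent C (i, t))) =
           g (C i t + of_real h * (- (\<i> * tangent C (i, t)))) + \<delta>"
    using num V unfolding numbering_def by blast
  then have "\<forall>\<^sub>F h in at_right (0::real). l = r + \<delta>"
    using L(1) R(1) unfolding enters_def
    by eventually_elim (use L(2) R(2) in metis)
  then show ?thesis by (simp add: trivial_limit_at_right_real)
qed

lemma levelI:
  assumes "enters (C i t) (\<i> * tangent C (i, t)) L" "\<And>z. z \<in> L \<Longrightarrow> z \<notin> curve_image C \<and> g z = c + \<delta>/2"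
    and "enters (C i t) (- (\<i> * tangent C (i, t))) R" "\<And>z. z \<in> R \<Longrightarrow> z \<notin> curve_image C \<and> g z = c - \<delta>/2"
  shows "level \<delta> g C i t c"
  unfolding level_def using assms by (auto intro: enters_mono)

text \<open>Since the two sides keep their numbers along a short piece of the curve, the level is locally
  constant.  For \<open>\<delta> = 0\<close> the last clause says that \<open>g\<close> extends continuously across the curve.\<close>

lemma numbering_simple:
  fixes C :: "('i::finite) curve"
  assumes gen: "generic_curve C" and num: "numbering V \<delta> g C" and V: "open V" "C i t \<in> V"
    and simple: "C i t \<notin> double_points C"
  obtains c \<epsilon> U where "\<epsilon> > 0" "\<And>x. \<bar>x\<bar> < \<epsilon> \<Longrightarrow> level \<delta> g C i (t + x) c"
    "open U" "C i t \<in> U" "\<And>z. z \<in> U - curve_image C \<Longrightarrow> g z = c + \<delta>/2 \<or> g z = c - \<delta>/2"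
proof (rule simple_neighbourhood[OF gen simple V])
  fix U \<epsilon> L R
  assume U: "open U" "C i t \<in> U" "U \<subseteq> V" "\<epsilon> > 0" "connected L" "connected R"
    and LR: "U - curve_image C = L \<union> R"
    and enL: "\<And>x. \<bar>x\<bar> < \<epsilon> \<Longrightarrow> enters (C i (t + x)) (\<i> * tangent C (i, t + x)) L"
    and enR: "\<And>x. \<bar>x\<bar> < \<epsilon> \<Longrightarrow> enters (C i (t + x)) (- (\<i> * tangent C (i, t + x))) R"
  have sub: "L \<subseteq> V - curve_image C" "R \<subseteq> V - curve_image C" using LR U(3) by blast+
  obtain l where l: "\<And>z. z \<in> L \<Longrightarrow> g z = l" using numbering_constant[OF num U(5) sub(1)] by blast
  obtain r where r: "\<And>z. z \<in> R \<Longrightarrow> g z = r" using numbering_constant[OF num U(6) sub(2)] by blast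
  have lr: "l = r + \<delta>"
    using numbering_jump[OF num V(2) simple, of L l R r] enL[of 0] enR[of 0] l r U(4) by simp
  show thesis
  proof (rule that[OF U(4) _ U(1,2)])
    show "level \<delta> g C i (t + x) (r + \<delta>/2)" if "\<bar>x\<bar> < \<epsilon>" for x
      using sub l r lr by (intro levelI[OF enL[OF that] _ enR[OF that]]) auto
    show "g z = r + \<delta>/2 + \<delta>/2 \<or> g z = r + \<delta>/2 - \<delta>/2" if "z \<in> U - curve_image C" for z
      using that LR l r lr by auto
  qed
qed

lemma sum_Pow_doubleton:
  fixes F :: "_ \<Rightarrow> real"
  assumes "b \<noteq> b'"
  shows "(\<Sum>B\<in>Pow {b, b'}. F B) = F {} + F {b} + F {b'} + F {b, b'}"
proof -
  have "Pow {b, b'} = {{}, {b}, {b'}, {b, b'}}" by (auto simp: Pow_insert)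
  moreover have "{b, b'} \<noteq> {b}" "{b, b'} \<noteq> {b'}" "{b} \<noteq> {b'}" using assms by auto
  ultimately show ?thesis by (simp add: eq_commute[of _ "{b, b'}"])
qed

lemma sector_direction_doubleton:
  assumes "branches C d = {b, b'}" "b \<noteq> b'"
  shows "sector_direction C d {} = - tangent C b - tangent C b'"
    "sector_direction C d {b} = tangent C b - tangent C b'"
    "sector_direction C d {b'} = tangent C b' - tangent C b"
    "sector_direction C d {b, b'} = tangent C b + tangent C b'"
  using assms by (auto simp: sector_direction_def insert_Diff_if)

text \<open>The four directions \<open>\<plusminus>u \<plusminus> v\<close> point into the four quadrants, so each limit in the index is the number
  of one quadrant.\<close>

lemma ind_eq:
  assumes gen: "generic_curve C" and b: "branches C d = {(i, frac t), (j, frac u)}" "(i, frac t) \<noteq> (j, frac u)"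
    and Q: "enters d (tangent C (i, t) + tangent C (j, u)) Q1"
    "enters d (tangent C (j, u) - tangent C (i, t)) Q2"
    "enters d (- tangent C (i, t) - tangent C (j, u)) Q3"
    "enters d (tangent C (i, t) - tangent C (j, u)) Q4"
    and q: "\<And>z. z \<in> Q1 \<Longrightarrow> N (region C z) = q1" "\<And>z. z \<in> Q2 \<Longrightarrow> N (region C z) = q2"
      "\<And>z. z \<in> Q3 \<Longrightarrow> N (region C z) = q3" "\<And>z. z \<in> Q4 \<Longrightarrow> N (region C z) = q4"
  shows "ind C N d = (q1 + q2 + q3 + q4) / 4"
proof -
  let ?b = "(i, frac t)" and ?b' = "(j, frac u)"
  have tan: "tangent C ?b = tangent C (i, t)" "tangent C ?b' = tangent C (j, u)"
    by (rule tangent_frac[OF gen])+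
  have dir: "sector_direction C d {} = - tangent C (i, t) - tangent C (j, u)"
    "sector_direction C d {?b} = tangent C (i, t) - tangent C (j, u)"
    "sector_direction C d {?b'} = tangent C (j, u) - tangent C (i, t)"
    "sector_direction C d {?b, ?b'} = tangent C (i, t) + tangent C (j, u)"
    using sector_direction_doubleton[OF b(1) b(2)] tan by simp_all
  have lim: "Lim (at_right 0) (\<lambda>h. N (region C (d + of_real h * v))) = q"
    if "enters d v Q" "\<And>z. z \<in> Q \<Longrightarrow> N (region C z) = q" for v Q q
    using enters_constant[of d v Q "\<lambda>z. N (region C z)" q] that
    by (intro tendsto_Lim) (auto simp: trivial_limit_at_right_real)
  have "ind C N d = (q3 + q4 + q2 + q1) / 4"
    unfolding ind_def b(1) sum_Pow_doubleton[OF b(2)]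
    by (simp add: dir lim[OF Q(1) q(1)] lim[OF Q(2) q(2)] lim[OF Q(3) q(3)] lim[OF Q(4) q(4)])
  then show ?thesis by simp
qed

text \<open>With the number \<open>c\<close> in \<open>Q1\<close>, the jumps across three of the half-branches give \<open>c + \<delta>\<close> in \<open>Q2\<close>, \<open>c\<close> in
  \<open>Q3\<close> and \<open>c - \<delta>\<close> in \<open>Q4\<close>.  The average is \<open>c\<close>, and the level drops by \<open>\<delta>\<close> along the first branch
  and rises by \<open>\<delta>\<close> along the second.\<close>

lemma numbering_crossing_pos:
  fixes C :: "('i::finite) curve"
  assumes gen: "generic_curve C" and num: "numbering V \<delta> g C" and V: "open V" "d \<in> V"
    and d: "C i t = d" "C j u = d"
    and pos: "det2 (tangent C (i, t)) (tangent C (j, u)) > 0"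
  obtains c \<epsilon> U where "\<epsilon> > 0" 
    "\<And>x. 0 < x \<Longrightarrow> x < \<epsilon> \<Longrightarrow> level \<delta> g C i (t - x) (c + \<delta>/2) \<and> level \<delta> g C i (t + x) (c - \<delta>/2) \<and>
       level \<delta> g C j (u - x) (c - \<delta>/2) \<and> level \<delta> g C j (u + x) (c + \<delta>/2)"
    "open U" "d \<in> U" "\<And>z. z \<in> U - curve_image C \<Longrightarrow> g z = c \<or> g z = c + \<delta> \<or> g z = c - \<delta>"
    "\<And>N. g = (\<lambda>z. N (region C z)) \<Longrightarrow> ind C N d = c"
proof (rule crossing_neighbourhood[OF gen d pos V])
  fix U \<epsilon> Q1 Q2 Q3 Q4
  assume U: "open U" "d \<in> U" "U \<subseteq> V" "\<epsilon> > 0"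
    and con: "connected Q1" "connected Q2" "connected Q3" "connected Q4"
    and Q: "U - curve_image C = Q1 \<union> Q2 \<union> Q3 \<union> Q4"
    and iso: "U \<inter> double_points C \<subseteq> {d}"
    and near: "\<And>x. \<bar>x\<bar> < \<epsilon> \<Longrightarrow> C i (t + x) \<in> U \<and> (x \<noteq> 0 \<longrightarrow> C i (t + x) \<notin> double_points C)"
      "\<And>x. \<bar>x\<bar> < \<epsilon> \<Longrightarrow> C j (u + x) \<in> U \<and> (x \<noteq> 0 \<longrightarrow> C j (u + x) \<notin> double_points C)"
    and e: "\<And>x. 0 < x \<Longrightarrow> x < \<epsilon> \<Longrightarrow> enters (C i (t + x)) (\<i> * tangent C (i, t + x)) Q1 \<and>
       enters (C i (t + x)) (- (\<i> * tangent C (i, t + x))) Q4"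
    "\<And>x. 0 < x \<Longrightarrow> x < \<epsilon> \<Longrightarrow> enters (C i (t - x)) (\<i> * tangent C (i, t - x)) Q2 \<and>
       enters (C i (t - x)) (- (\<i> * tangent C (i, t - x))) Q3"
    "\<And>x. 0 < x \<Longrightarrow> x < \<epsilon> \<Longrightarrow> enters (C j (u + x)) (\<i> * tangent C (j, u + x)) Q2 \<and>
       enters (C j (u + x)) (- (\<i> * tangent C (j, u + x))) Q1"
    "\<And>x. 0 < x \<Longrightarrow> x < \<epsilon> \<Longrightarrow> enters (C j (u - x)) (\<i> * tangent C (j, u - x)) Q3 \<and>
       enters (C j (u - x)) (- (\<i> * tangent C (j, u - x))) Q4"
    and s: "enters d (tangent C (i, t) + tangent C (j, u)) Q1"
    "enters d (tangent C (j, u) - tangent C (i, t)) Q2"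
    "enters d (- tangent C (i, t) - tangent C (j, u)) Q3"
    "enters d (tangent C (i, t) - tangent C (j, u)) Q4"
  have sub: "Q1 \<subseteq> V - curve_image C" "Q2 \<subseteq> V - curve_image C" "Q3 \<subseteq> V - curve_image C" "Q4 \<subseteq> V - curve_image C"
    using Q U(3) by blast+
  obtain q1 where q1: "\<And>z. z \<in> Q1 \<Longrightarrow> g z = q1" using numbering_constant[OF num con(1) sub(1)] by blast
  obtain q2 where q2: "\<And>z. z \<in> Q2 \<Longrightarrow> g z = q2" using numbering_constant[OF num con(2) sub(2)] by blast
  obtain q3 where q3: "\<And>z. z \<in> Q3 \<Longrightarrow> g z = q3" using numbering_constant[OF num con(3) sub(3)] by blast
  obtain q4 where q4: "\<And>z. z \<in> Q4 \<Longrightarrow> g z = q4" using numbering_constant[OF num con(4) sub(4)] by blast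
  define x where "x = \<epsilon>/2"
  have x: "0 < x" "x < \<epsilon>" "\<bar>x\<bar> < \<epsilon>" "\<bar>-x\<bar> < \<epsilon>" "x \<noteq> 0" using U(4) by (auto simp: x_def)
  have at: "C i (t + x) \<in> V \<and> C i (t + x) \<notin> double_points C" "C i (t - x) \<in> V \<and> C i (t - x) \<notin> double_points C"
    "C j (u + x) \<in> V \<and> C j (u + x) \<notin> double_points C" "C j (u - x) \<in> V \<and> C j (u - x) \<notin> double_points C"
    using near[OF x(3)] near[OF x(4)] x(5) U(3) by auto
  have j1: "q1 = q4 + \<delta>"
    by (rule numbering_jump[OF num conjunct1[OF at(1)] conjunct2[OF at(1)]
          conjunct1[OF e(1)[OF x(1,2)]] q1 conjunct2[OF e(1)[OF x(1,2)]] q4])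
  have j2: "q2 = q3 + \<delta>"
    by (rule numbering_jump[OF num conjunct1[OF at(2)] conjunct2[OF at(2)]
          conjunct1[OF e(2)[OF x(1,2)]] q2 conjunct2[OF e(2)[OF x(1,2)]] q3])
  have j3: "q2 = q1 + \<delta>"
    by (rule numbering_jump[OF num conjunct1[OF at(3)] conjunct2[OF at(3)]
          conjunct1[OF e(3)[OF x(1,2)]] q2 conjunct2[OF e(3)[OF x(1,2)]] q1])
  have q234: "q2 = q1 + \<delta>" "q3 = q1" "q4 = q1 - \<delta>" using j1 j2 j3 by simp_all
  show thesis
  proof (rule that[OF U(4) _ U(1,2)])
    show "level \<delta> g C i (t - x) (q1 + \<delta>/2) \<and> level \<delta> g C i (t + x) (q1 - \<delta>/2) \<and>
       level \<delta> g C j (u - x) (q1 - \<delta>/2) \<and> level \<delta> g C j (u + x) (q1 + \<delta>/2)" if "0 < x" "x < \<epsilon>" for x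
    proof (intro conjI)
      show "level \<delta> g C i (t - x) (q1 + \<delta>/2)"
        using sub q2 q3 q234 e(2)[OF that] by (intro levelI[of C i _ Q2 g _ \<delta> Q3]) auto
      show "level \<delta> g C i (t + x) (q1 - \<delta>/2)"
        using sub q1 q4 q234 e(1)[OF that] by (intro levelI[of C i _ Q1 g _ \<delta> Q4]) auto
      show "level \<delta> g C j (u - x) (q1 - \<delta>/2)"
        using sub q3 q4 q234 e(4)[OF that] by (intro levelI[of C j _ Q3 g _ \<delta> Q4]) auto
      show "level \<delta> g C j (u + x) (q1 + \<delta>/2)"
        using sub q2 q1 q234 e(3)[OF that] by (intro levelI[of C j _ Q2 g _ \<delta> Q1]) auto
    qed
    show "g z = q1 \<or> g z = q1 + \<delta> \<or> g z = q1 - \<delta>" if "z \<in> U - curve_image C" for z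
      using that Q q1 q2 q3 q4 q234 by auto
    show "ind C N d = q1" if "g = (\<lambda>z. N (region C z))" for N
    proof -
      have ne: "(i, frac t) \<noteq> (j, frac u)"
        using pos tangent_frac_eq[OF gen, of t u i] by (auto simp: det2_eq)
      have "ind C N d = (q1 + q2 + q3 + q4) / 4"
        by (rule ind_eq[OF gen branches_double(1)[OF gen d ne] ne s]) (use q1 q2 q3 q4 that in auto)
      then show ?thesis using q234 by simp
    qed
  qed
qed

text \<open>The index of a double point is the mean of the levels just before and just after it, on either
  branch.  When the branches cross with the negative sign they are interchanged.\<close>

lemma numbering_crossing:
  fixes C :: "('i::finite) curve"
  assumes gen: "generic_curve C" and num: "numbering UNIV \<delta> (\<lambda>z. N (region C z)) C"
    and d: "C i t = d" "C j u = d" and ne: "(i, frac t) \<noteq> (j, frac u)"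
  defines "e \<equiv> sgn (det2 (tangent C (i, t)) (tangent C (j, u)))"
  shows "\<exists>\<epsilon>>0. \<forall>x. 0 < x \<and> x < \<epsilon> \<longrightarrow>
    level \<delta> (\<lambda>z. N (region C z)) C i (t - x) (ind C N d + \<delta> * e/2) \<and>
    level \<delta> (\<lambda>z. N (region C z)) C i (t + x) (ind C N d - \<delta> * e/2)"
proof -
  have nz: "det2 (tangent C (i, t)) (tangent C (j, u)) \<noteq> 0"
    using transversal[OF gen _ ne] d by simp
  show ?thesis
  proof (cases "det2 (tangent C (i, t)) (tangent C (j, u)) > 0")
    case True
    then have e: "e = 1" by (simp add: e_def)
    show ?thesis
    proof (rule numbering_crossing_pos[OF gen num open_UNIV UNIV_I d True])
      fix c \<epsilon>
      assume "\<epsilon> > 0" and lev: "\<And>x. 0 < x \<Longrightarrow> x < \<epsilon> \<Longrightarrow>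
         level \<delta> (\<lambda>z. N (region C z)) C i (t - x) (c + \<delta>/2) \<and>
         level \<delta> (\<lambda>z. N (region C z)) C i (t + x) (c - \<delta>/2) \<and>
         level \<delta> (\<lambda>z. N (region C z)) C j (u - x) (c - \<delta>/2) \<and>
         level \<delta> (\<lambda>z. N (region C z)) C j (u + x) (c + \<delta>/2)"
        and "\<And>M. (\<lambda>z. N (region C z)) = (\<lambda>z. M (region C z)) \<Longrightarrow> ind C M d = c"
      then have "ind C N d = c" by blast
      then show ?thesis using lev \<open>\<epsilon> > 0\<close> e by auto
    qed
  next
    case False
    then have neg: "det2 (tangent C (i, t)) (tangent C (j, u)) < 0" using nz by simp
    then have e: "e = -1" by (simp add: e_def)
    have pos: "det2 (tangent C (j, u)) (tangent C (i, t)) > 0" using neg by (simp add: det2_eq mult.commute)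
    show ?thesis
    proof (rule numbering_crossing_pos[OF gen num open_UNIV UNIV_I d(2,1) pos])
      fix c \<epsilon>
      assume "\<epsilon> > 0" and lev: "\<And>x. 0 < x \<Longrightarrow> x < \<epsilon> \<Longrightarrow>
         level \<delta> (\<lambda>z. N (region C z)) C j (u - x) (c + \<delta>/2) \<and>
         level \<delta> (\<lambda>z. N (region C z)) C j (u + x) (c - \<delta>/2) \<and>
         level \<delta> (\<lambda>z. N (region C z)) C i (t - x) (c - \<delta>/2) \<and>
         level \<delta> (\<lambda>z. N (region C z)) C i (t + x) (c + \<delta>/2)"
        and "\<And>M. (\<lambda>z. N (region C z)) = (\<lambda>z. M (region C z)) \<Longrightarrow> ind C M d = c"
      then have "ind C N d = c" by blast
      then show ?thesis using lev \<open>\<epsilon> > 0\<close> e by auto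
    qed
  qed
qed

lemma level_interval:
  fixes C :: "('i::finite) curve"
  assumes gen: "generic_curve C" and num: "numbering V \<delta> g C" and V: "open V"
    and I: "\<And>x. a \<le> x \<Longrightarrow> x \<le> b \<Longrightarrow> C i x \<in> V \<and> C i x \<notin> double_points C"
    and ab: "a \<le> b" "level \<delta> g C i a c"
  shows "level \<delta> g C i b c"
proof (rule connected_induction_simple[of "{a..b}" a b "\<lambda>x. level \<delta> g C i x c"])
  fix t assume t: "t \<in> {a..b}"
  then have t': "C i t \<in> V" "C i t \<notin> double_points C" using I by auto
  obtain c' \<epsilon> where e: "\<epsilon> > 0" "\<And>x. \<bar>x\<bar> < \<epsilon> \<Longrightarrow> level \<delta> g C i (t + x) c'"
    using numbering_simple[OF gen num V t'] by metis
  have lev: "level \<delta> g C i x c'" if "x \<in> ball t \<epsilon>" for x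
    using e(2)[of "x - t"] that by (simp add: dist_real_def abs_minus_commute)
  show "\<exists>T. openin (top_of_set {a..b}) T \<and> t \<in> T \<and>
      (\<forall>x\<in>T. \<forall>y\<in>T. level \<delta> g C i x c \<longrightarrow> level \<delta> g C i y c)"
  proof (intro exI[of _ "{a..b} \<inter> ball t \<epsilon>"] conjI ballI impI)
    fix x y assume xy: "x \<in> {a..b} \<inter> ball t \<epsilon>" "y \<in> {a..b} \<inter> ball t \<epsilon>" and "level \<delta> g C i x c"
    then have "c' = c" using level_unique[OF lev[of x]] by simp
    then show "level \<delta> g C i y c" using lev[of y] xy by simp
  qed (use t e(1) in \<open>simp_all add: openin_open_Int\<close>)
qed (use ab in auto)

text \<open>For \<open>\<sigma> = -1\<close> the coorientation points to the right, and the two sides of the jump condition are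
  interchanged.\<close>

lemma numbering_alexander:
  assumes "alexander_numbering \<sigma> \<kappa> C N" "\<sigma> \<in> {1, -1}"
  shows "numbering UNIV \<sigma> (\<lambda>z. N (region C z)) C"
  unfolding numbering_def
proof (intro conjI allI impI ballI)
  fix Q z w assume "connected Q \<and> Q \<subseteq> UNIV - curve_image C" "z \<in> Q" "w \<in> Q"
  then have "connected_component (- curve_image C) z w" unfolding connected_component_def by blast
  then show "N (region C z) = N (region C w)" unfolding region_def by (simp add: connected_component_eq)
next
  fix i t assume "C i t \<in> UNIV \<and> C i t \<notin> double_points C"
  then have "\<forall>\<^sub>F h in at_right 0.
           N (region C (C i t + of_real h * coorientation \<sigma> C (i, t))) =
           N (region C (C i t - of_real h * coorientation \<sigma> C (i, t))) + 1"
    using assms(1) unfolding alexander_numbering_def by blast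
  then show "\<forall>\<^sub>F h in at_right 0. N (region C (C i t + of_real h * (\<i> * tangent C (i, t)))) =
           N (region C (C i t + of_real h * (- (\<i> * tangent C (i, t))))) + \<sigma>"
    using assms(2) by (auto simp: coorientation_def mult.assoc elim!: eventually_mono)
qed

section \<open>Curves that agree off a disk\<close>

definition agree_off :: "complex set \<Rightarrow> 'i curve \<Rightarrow> 'i curve \<Rightarrow> bool" where
  "agree_off D C C' \<longleftrightarrow> (\<forall>i t. C i t \<notin> D \<or> C' i t \<notin> D \<longrightarrow> C' i t = C i t)"

lemma agree_off_image:
  "agree_off D C C' \<Longrightarrow> z \<notin> D \<Longrightarrow> z \<in> curve_image C' \<longleftrightarrow> z \<in> curve_image C"
  unfolding agree_off_def curve_image_iff by metis

lemma agree_off_branches: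
  "agree_off D C C' \<Longrightarrow> z \<notin> D \<Longrightarrow> branches C' z = branches C z"
  unfolding agree_off_def branches_def by (auto; metis)

lemma agree_off_double_points:
  "agree_off D C C' \<Longrightarrow> z \<notin> D \<Longrightarrow> z \<in> double_points C' \<longleftrightarrow> z \<in> double_points C"
  unfolding double_points_def using agree_off_branches by fastforce

lemma agree_off_tangent:
  assumes ag: "agree_off D C C'" and gen: "generic_curve C" "generic_curve C'"
    and D: "closed D" "C i t \<notin> D"
  shows "tangent C' (i, t) = tangent C (i, t)"
proof -
  have "open (C i -` (- D))"
    using D(1) generic_continuous[OF gen(1), of UNIV i] by (auto simp: continuous_on_open_vimage)
  moreover have "C' i x = C i x" if "x \<in> C i -` (- D)" for x
    using ag that unfolding agree_off_def by auto
  ultimately have "(C' i has_vector_derivative tangent C (i, t)) (at t)"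
    using D(2) by (intro has_vector_derivative_transform_within_open[OF generic_vector_derivative[OF gen(1)]]) auto
  then show ?thesis
    using generic_vector_derivative[OF gen(2)] vector_derivative_unique_at by blast
qed

text \<open>The difference of the two numberings is constant on the connected set \<open>- D\<close>: it is locally constant
  off the curve, it does not jump at simple points of the curve because both numberings jump by the
  same amount there, and the local pictures extend this to double points.  Its value is read off
  far away, where both numberings are \<open>\<kappa>\<close>.\<close>

lemma agree_off_numbering:
  fixes C C' :: "('i::finite) curve"
  assumes ag: "agree_off D C C'" and gen: "generic_curve C" "generic_curve C'"
    and D: "compact D" "connected (- D)"
    and \<sigma>: "\<sigma> \<in> {1, -1}" and N: "alexander_numbering \<sigma> \<kappa> C N" and N': "alexander_numbering \<sigma> \<kappa> C' N'"
    and z: "z \<notin> D" "z \<notin> curve_image C"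
  shows "N' (region C' z) = N (region C z)"
proof -
  let ?K = "curve_image C" and ?K' = "curve_image C'"
  have oD: "open (- D)" using D(1) compact_imp_closed by blast
  define f where "f z = N' (region C' z) - N (region C z)" for z
  note num = numbering_alexander[OF N \<sigma>] and num' = numbering_alexander[OF N' \<sigma>]
  have f: "numbering (- D) 0 f C"
    unfolding numbering_def
  proof (intro conjI allI impI ballI)
    fix Q z w assume Q: "connected Q \<and> Q \<subseteq> - D - ?K" "z \<in> Q" "w \<in> Q"
    then have "Q \<subseteq> UNIV - ?K'" "Q \<subseteq> UNIV - ?K" using agree_off_image[OF ag] by auto
    then show "f z = f w"
      using numbering_eq[OF num _ _ Q(2,3)] numbering_eq[OF num' _ _ Q(2,3)] Q(1) by (simp add: f_def)
  next
    fix i t assume it: "C i t \<in> - D \<and> C i t \<notin> double_points C"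
    then have same: "C' i t = C i t" "tangent C' (i, t) = tangent C (i, t)"
      using ag agree_off_tangent[OF ag gen compact_imp_closed[OF D(1)], of i t] unfolding agree_off_def by auto
    have "C' i t \<notin> double_points C'" using agree_off_double_points[OF ag] it same by auto
    from numbering_jump_eventually[OF num' UNIV_I this]
    have "\<forall>\<^sub>F h in at_right 0. N' (region C' (C i t + of_real h * (\<i> * tangent C (i, t)))) =
           N' (region C' (C i t + of_real h * (- (\<i> * tangent C (i, t))))) + \<sigma>"
      unfolding same .
    moreover have "\<forall>\<^sub>F h in at_right 0. N (region C (C i t + of_real h * (\<i> * tangent C (i, t)))) =
           N (region C (C i t + of_real h * (- (\<i> * tangent C (i, t))))) + \<sigma>"
      using numbering_jump_eventually[OF num UNIV_I] it by blast
    ultimately show "\<forall>\<^sub>F h in at_right 0. f (C i t + of_real h * (\<i> * tangent C (i, t))) =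
           f (C i t + of_real h * (- (\<i> * tangent C (i, t)))) + 0"
      unfolding f_def by eventually_elim simp
  qed
  have "bounded (?K \<union> ?K' \<union> D)"
    using compact_curve_image[OF gen(1)] compact_curve_image[OF gen(2)] D(1) by (simp add: compact_imp_bounded)
  then obtain r where r: "?K \<union> ?K' \<union> D \<subseteq> ball 0 r" using bounded_subset_ballD by blast
  have far: "connected (- ball (0::complex) r)"
    by (rule connected_complement_bounded_convex) auto
  have unb: "\<not> bounded (- ball (0::complex) r)"
    using bounded_ball[of "0::complex" r] cobounded_imp_unbounded by blast
  then obtain w where w: "w \<in> - ball (0::complex) r" by (metis bounded_empty ex_in_conv)
  have reg: "\<not> bounded (region B w)" "region B w \<in> components (- curve_image B)"
    if "curve_image B \<subseteq> ball 0 r" for B :: "'i curve"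
  proof -
    have "- ball 0 r \<subseteq> region B w"
      unfolding region_def using far w that by (intro connected_component_maximal) auto
    then show "\<not> bounded (region B w)" using unb bounded_subset by blast
    show "region B w \<in> components (- curve_image B)"
      unfolding region_def using w that by (auto simp: components_iff)
  qed
  have "N (region C w) = \<kappa>" "N' (region C' w) = \<kappa>"
    using N N' reg[of C] reg[of C'] r unfolding alexander_numbering_def by auto
  then have fw: "f w = 0" by (simp add: f_def)
  have "f z = f w"
  proof (rule connected_equivalence_relation_gen[of "- D" z w "\<lambda>z. z \<notin> ?K" "\<lambda>z w. f z = f w"])
    show "\<exists>z. z \<in> T \<and> z \<notin> ?K" if "openin (top_of_set (- D)) T" "a \<in> T" for T a
      using that oD curve_image_nowhere_dense[OF gen(1), of T] openin_open_trans by blast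
    fix a assume a: "a \<in> - D"
    have "\<exists>U c. open U \<and> a \<in> U \<and> (\<forall>z\<in>U - ?K. f z = c)"
    proof (cases "a \<in> ?K")
      case False
      then have "a \<in> - D - ?K" "open (- D - ?K)"
        using a oD compact_curve_image[OF gen(1)] compact_imp_closed by blast+
      then obtain e where e: "e > 0" "ball a e \<subseteq> - D - ?K" by (meson openE)
      then obtain q where "\<And>z. z \<in> ball a e \<Longrightarrow> f z = q"
        using numbering_constant[OF f connected_ball] by blast
      then show ?thesis using e(1) by (intro exI[of _ "ball a e"]) auto
    next
      case True
      then obtain i t where it: "C i t = a" by (metis curve_image_iff)
      show ?thesis
      proof (cases "a \<in> double_points C")
        case False
        show ?thesis
          by (rule numbering_simple[OF gen(1) f oD, of i t]) (use False it a in auto)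
      next
        case True
        then obtain i t j u where d: "C i t = a" "C j u = a" "det2 (tangent C (i, t)) (tangent C (j, u)) > 0"
          using double_point_cases[OF gen(1)] by metis
        show ?thesis
          by (rule numbering_crossing_pos[OF gen(1) f oD a d]) auto
      qed
    qed
    then show "\<exists>T. openin (top_of_set (- D)) T \<and> a \<in> T \<and>
        (\<forall>x\<in>T. \<forall>y\<in>T. x \<notin> ?K \<and> y \<notin> ?K \<longrightarrow> f x = f y)"
      using a by (metis DiffI IntD2 IntI openin_open_Int)
  qed (use z w r D(2) in auto)
  then show ?thesis using fw by (simp add: f_def)
qed

lemma agree_off_level:
  fixes C C' :: "('i::finite) curve"
  assumes ag: "agree_off D C C'" and gen: "generic_curve C" "generic_curve C'"
    and D: "compact D" "connected (- D)"
    and \<sigma>: "\<sigma> \<in> {1, -1}" and N: "alexander_numbering \<sigma> \<kappa> C N" and N': "alexander_numbering \<sigma> \<kappa> C' N'"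
    and it: "C i t \<notin> D"
    and lev: "level \<sigma> (\<lambda>z. N (region C z)) C i t c"
  shows "level \<sigma> (\<lambda>z. N' (region C' z)) C' i t c"
proof -
  have cl: "closed D" using D(1) by (rule compact_imp_closed)
  have same: "C' i t = C i t" "tangent C' (i, t) = tangent C (i, t)"
    using ag it agree_off_tangent[OF ag gen cl it] unfolding agree_off_def by auto
  have off: "enters (C i t) v (- D)" for v using cl it by (intro enters_open) auto
  have "enters (C i t) v {z. z \<notin> curve_image C' \<and> N' (region C' z) = q}"
    if "enters (C i t) v {z. z \<notin> curve_image C \<and> N (region C z) = q}" for v q
    using enters_Int[OF off that]
    by (rule enters_mono)
      (use agree_off_image[OF ag] agree_off_numbering[OF ag gen D \<sigma> N N'] in auto)
  then show ?thesis using lev unfolding level_def same by blast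
qed

section \<open>Strands and their crossings\<close>

abbreviation lo :: "'i strand \<Rightarrow> real" where "lo s \<equiv> fst (snd s)"
abbreviation hi :: "'i strand \<Rightarrow> real" where "hi s \<equiv> snd (snd s)"

lemma strand_points_iff: "(i, t) \<in> strand_points s \<longleftrightarrow> i = fst s \<and> (\<exists>n::int. t + of_int n \<in> {lo s..hi s})"
  by (cases s) (auto simp: strand_points_def)

lemma strand_pointsI: "x \<in> {lo s..hi s} \<Longrightarrow> (fst s, x) \<in> strand_points s"
  unfolding strand_points_iff by (auto intro: exI[of _ 0])

lemma strand_pointsE:
  assumes "(i, t) \<in> strand_points s"
  obtains n :: int where "i = fst s" "t + of_int n \<in> {lo s..hi s}"
  using assms strand_points_iff[of i t s] by blast

lemma strand_arc_eq: "strand_arc C s = C (fst s) ` {lo s..hi s}"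
  by (cases s) (simp add: strand_arc_def)

lemma three_strandsD:
  assumes "three_strands D C S" "s \<in> S"
  shows "lo s < hi s" "hi s < lo s + 1" "inj_on (C (fst s)) {lo s..hi s}"
    "C (fst s) (lo s) \<in> frontier D" "C (fst s) (hi s) \<in> frontier D"
    "\<And>x. lo s < x \<Longrightarrow> x < hi s \<Longrightarrow> C (fst s) x \<in> interior D"
    "\<And>s'. s' \<in> S \<Longrightarrow> s \<noteq> s' \<Longrightarrow> strand_points s \<inter> strand_points s' = {}"
    "\<And>s'. s' \<in> S \<Longrightarrow> s \<noteq> s' \<Longrightarrow> \<exists>p \<in> interior D. strand_arc C s \<inter> strand_arc C s' = {p}"
proof -
  have "\<forall>(i, a, b) \<in> S. a < b \<and> b < a + 1 \<and> inj_on (C i) {a..b} \<and>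
        C i a \<in> frontier D \<and> C i b \<in> frontier D \<and> C i ` {a<..<b} \<subseteq> interior D"
    using assms(1) unfolding three_strands_def by (elim conjE)
  note all = bspec[OF this assms(2)]
  obtain i a b where s: "s = (i, a, b)" by (cases s)
  have "lo s < hi s \<and> hi s < lo s + 1 \<and> inj_on (C (fst s)) {lo s..hi s} \<and>
    C (fst s) (lo s) \<in> frontier D \<and> C (fst s) (hi s) \<in> frontier D \<and> C (fst s) ` {lo s<..<hi s} \<subseteq> interior D"
    using all unfolding s prod.case fst_conv snd_conv .
  then show "lo s < hi s" "hi s < lo s + 1" "inj_on (C (fst s)) {lo s..hi s}"
    "C (fst s) (lo s) \<in> frontier D" "C (fst s) (hi s) \<in> frontier D"
    "\<And>x. lo s < x \<Longrightarrow> x < hi s \<Longrightarrow> C (fst s) x \<in> interior D"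
    by (simp_all add: image_subset_iff)
  have "\<forall>s \<in> S. \<forall>s' \<in> S. s \<noteq> s' \<longrightarrow>
        strand_points s \<inter> strand_points s' = {} \<and>
        (\<exists>p \<in> interior D. strand_arc C s \<inter> strand_arc C s' = {p})"
    using assms(1) unfolding three_strands_def by (elim conjE)
  with assms(2) show "\<And>s'. s' \<in> S \<Longrightarrow> s \<noteq> s' \<Longrightarrow> strand_points s \<inter> strand_points s' = {}"
    "\<And>s'. s' \<in> S \<Longrightarrow> s \<noteq> s' \<Longrightarrow> \<exists>p \<in> interior D. strand_arc C s \<inter> strand_arc C s' = {p}" by blast+
qed

lemma three_strands_in_D:
  assumes "three_strands D C S"
  shows "C i t \<in> D \<longleftrightarrow> (\<exists>s\<in>S. (i, t) \<in> strand_points s)"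
  using assms unfolding three_strands_def by blast

definition crossing_param :: "'i curve \<Rightarrow> 'i strand \<Rightarrow> 'i strand \<Rightarrow> real" where
  "crossing_param C s s' = (THE x. x \<in> {lo s..hi s} \<and> C (fst s) x \<in> strand_arc C s')"

locale strands =
  fixes D :: "complex set" and C :: "('i::finite) curve" and S :: "'i strand set"
  assumes gen: "generic_curve C" and ts: "three_strands D C S" and closed_D: "closed D"
begin

lemma crossing_param_ex1:
  assumes "s \<in> S" "s' \<in> S" "s \<noteq> s'"
  shows "\<exists>!x. x \<in> {lo s..hi s} \<and> C (fst s) x \<in> strand_arc C s'"
proof -
  obtain p where p: "strand_arc C s \<inter> strand_arc C s' = {p}"
    using three_strandsD(8)[OF ts assms] by blast
  then have "p \<in> strand_arc C s" by blast
  then obtain x where x: "x \<in> {lo s..hi s}" "C (fst s) x = p" by (auto simp: strand_arc_eq)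
  show ?thesis
  proof (rule ex1I[of _ x])
    have "p \<in> strand_arc C s'" using p by blast
    then show "x \<in> {lo s..hi s} \<and> C (fst s) x \<in> strand_arc C s'" using x by simp
    fix y assume y: "y \<in> {lo s..hi s} \<and> C (fst s) y \<in> strand_arc C s'"
    then have "C (fst s) y \<in> strand_arc C s" by (simp add: strand_arc_eq)
    then have "C (fst s) y = C (fst s) x" using p x(2) y by blast
    then show "y = x" using inj_onD[OF three_strandsD(3)[OF ts assms(1)], of y x] x(1) y by blast
  qed
qed

lemma crossing_param_iff:
  assumes "s \<in> S" "s' \<in> S" "s \<noteq> s'" "x \<in> {lo s..hi s}"
  shows "C (fst s) x \<in> strand_arc C s' \<longleftrightarrow> x = crossing_param C s s'"
proof
  assume "C (fst s) x \<in> strand_arc C s'"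
  then have "x \<in> {lo s..hi s} \<and> C (fst s) x \<in> strand_arc C s'" using assms(4) by simp
  from the1_equality[OF crossing_param_ex1[OF assms(1-3)] this] show "x = crossing_param C s s'" by (simp add: crossing_param_def)
next
  assume "x = crossing_param C s s'"
  then show "C (fst s) x \<in> strand_arc C s'"
    using theI'[OF crossing_param_ex1[OF assms(1-3)]] by (simp add: crossing_param_def)
qed

lemma crossing_param_bounds:
  assumes "s \<in> S" "s' \<in> S" "s \<noteq> s'"
  shows "lo s < crossing_param C s s'" "crossing_param C s s' < hi s"
proof -
  have t: "crossing_param C s s' \<in> {lo s..hi s}" "C (fst s) (crossing_param C s s') \<in> strand_arc C s'"
    using theI'[OF crossing_param_ex1[OF assms]] unfolding crossing_param_def by blast+
  moreover have "C (fst s) (crossing_param C s s') \<in> strand_arc C s" using t(1) unfolding strand_arc_eq by (rule imageI)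
  moreover obtain p where "p \<in> interior D" "strand_arc C s \<inter> strand_arc C s' = {p}"
    using three_strandsD(8)[OF ts assms] by blast
  ultimately have "C (fst s) (crossing_param C s s') \<in> interior D" using t(2) by auto
  then have "crossing_param C s s' \<noteq> lo s" "crossing_param C s s' \<noteq> hi s"
    using three_strandsD(4,5)[OF ts assms(1)] by (auto simp: frontier_def)
  then show "lo s < crossing_param C s s'" "crossing_param C s s' < hi s" using t(1) by auto
qed

lemma crossing_param_in: 
  assumes "s \<in> S" "s' \<in> S" "s \<noteq> s'" shows "crossing_param C s s' \<in> {lo s..hi s}"
  using crossing_param_bounds[OF assms] by simp

lemma crossing_param_point_sym:
  assumes "s \<in> S" "s' \<in> S" "s \<noteq> s'"
  shows "C (fst s) (crossing_param C s s') = C (fst s') (crossing_param C s' s)"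
proof -
  have "C (fst s) (crossing_param C s s') \<in> strand_arc C s'" using crossing_param_iff[OF assms crossing_param_in[OF assms]] by simp
  then obtain y where y: "y \<in> {lo s'..hi s'}" "C (fst s') y = C (fst s) (crossing_param C s s')"
    unfolding strand_arc_eq by force
  then have "C (fst s') y \<in> strand_arc C s" using crossing_param_in[OF assms] unfolding strand_arc_eq by force
  then have "y = crossing_param C s' s" using crossing_param_iff[of s' s y] assms y by auto
  then show ?thesis using y by simp
qed

lemma strand_param_distinct:
  assumes "s \<in> S" "s' \<in> S" "s \<noteq> s'" "x \<in> {lo s..hi s}" "y \<in> {lo s'..hi s'}"
  shows "(fst s, frac x) \<noteq> (fst s', frac y)"
proof
  assume eq: "(fst s, frac x) = (fst s', frac y)"
  then have "frac y = frac x" by simp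
  then obtain n where n: "y = x + of_int n" by (rule frac_eq_obtain)
  have "(fst s, x) \<in> strand_points s'"
    unfolding strand_points_iff using eq n assms(5) by auto
  moreover have "(fst s, x) \<in> strand_points s" using assms(4) by (rule strand_pointsI)
  ultimately show False using three_strandsD(7)[OF ts assms(1-3)] by blast
qed

lemma crossing_distinct:
  assumes "s \<in> S" "s' \<in> S" "s \<noteq> s'"
  shows "(fst s, frac (crossing_param C s s')) \<noteq> (fst s', frac (crossing_param C s' s))"
  using strand_param_distinct assms crossing_param_in by metis

lemma crossing_param_double:
  assumes "s \<in> S" "s' \<in> S" "s \<noteq> s'"
  shows "C (fst s) (crossing_param C s s') \<in> double_points C"
  using branches_double(2)[OF gen refl crossing_param_point_sym[OF assms, symmetric] crossing_distinct[OF assms]] .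

lemma crossing_param_neq:
  assumes "s \<in> S" "s' \<in> S" "s'' \<in> S" "s \<noteq> s'" "s \<noteq> s''" "s' \<noteq> s''"
  shows "crossing_param C s s' \<noteq> crossing_param C s s''"
proof
  assume eq: "crossing_param C s s' = crossing_param C s s''"
  let ?p = "C (fst s) (crossing_param C s s')"
  have "C (fst s'') (crossing_param C s'' s) = ?p" using crossing_param_point_sym[of s s''] assms eq by simp
  then have "(fst s'', frac (crossing_param C s'' s)) \<in> branches C ?p" by (rule frac_in_branches[OF gen])
  moreover have "branches C ?p = {(fst s, frac (crossing_param C s s')), (fst s', frac (crossing_param C s' s))}"
    using branches_double(1)[OF gen refl crossing_param_point_sym[of s s', symmetric] crossing_distinct] assms by blast
  ultimately show False
    using strand_param_distinct[of s'' s "crossing_param C s'' s" "crossing_param C s s'"] strand_param_distinct[of s'' s' "crossing_param C s'' s" "crossing_param C s' s"]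
      assms crossing_param_in[of s'' s] crossing_param_in[of s s'] crossing_param_in[of s' s] by auto
qed

text \<open>A curve point in \<open>D\<close> lies on one of the three strands.\<close>

lemma strand_inside:
  assumes "s \<in> S" "x \<in> {lo s..hi s}" "C j u = C (fst s) x"
  shows "(j = fst s \<and> frac u = frac x) \<or> (\<exists>s'\<in>S. s' \<noteq> s \<and> x = crossing_param C s s')"
proof -
  have "C (fst s) x \<in> D" using three_strands_in_D[OF ts] strand_pointsI[OF assms(2)] assms(1) by blast
  then have "C j u \<in> D" using assms(3) by simp
  then obtain s' where s': "s' \<in> S" "(j, u) \<in> strand_points s'" using three_strands_in_D[OF ts] by blast
  then obtain n :: int where j: "j = fst s'" and n: "u + of_int n \<in> {lo s'..hi s'}"
    by (auto elim: strand_pointsE)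
  have eq: "C (fst s') (u + of_int n) = C (fst s) x"
    using assms(3) j generic_periodic[OF gen] by simp
  show ?thesis
  proof (cases "s' = s")
    case True
    then have "u + of_int n = x"
      using inj_onD[OF three_strandsD(3)[OF ts assms(1)]] eq n assms(2) by blast
    then show ?thesis using True j by (auto simp: frac_def)
  next
    case False
    have "C (fst s) x \<in> strand_arc C s'" using n eq unfolding strand_arc_eq by force
    then show ?thesis using crossing_param_iff[OF assms(1) s'(1) False[symmetric] assms(2)] s'(1) False by blast
  qed
qed

lemma strand_double_iff:
  assumes "s \<in> S" "x \<in> {lo s..hi s}"
  shows "C (fst s) x \<in> double_points C \<longleftrightarrow> (\<exists>s'\<in>S. s' \<noteq> s \<and> x = crossing_param C s s')"
  using strand_inside[OF assms] simple_iff[OF gen] crossing_param_double assms(1) by metis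

text \<open>Just beyond an end point the curve is off \<open>D\<close>: the other strands stay away from the end point, as they
  meet \<open>s\<close> only in the interior, and \<open>s\<close> itself returns only after a full period.\<close>

lemma strand_beyond:
  assumes s: "s \<in> S" and e: "x = lo s \<or> x = hi s"
  obtains \<epsilon> where "\<epsilon> > 0" "\<And>y. \<bar>y - x\<bar> < \<epsilon> \<Longrightarrow> C (fst s) y \<notin> double_points C"
    "\<And>y. \<bar>y - x\<bar> < \<epsilon> \<Longrightarrow> y \<notin> {lo s..hi s} \<Longrightarrow> C (fst s) y \<notin> D"
proof -
  note st = three_strandsD(1,2)[OF ts s]
  have x: "x \<in> {lo s..hi s}" using e st(1) by auto
  have nt: "x \<noteq> crossing_param C s s'" if "s' \<in> S" "s' \<noteq> s" for s' using crossing_param_bounds[of s s'] that s e by auto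
  have sim: "C (fst s) x \<notin> double_points C" using strand_double_iff[OF s x] nt by blast
  obtain U \<epsilon>1 where U: "\<epsilon>1 > 0" "U \<inter> double_points C = {}" "\<And>y. \<bar>y\<bar> < \<epsilon>1 \<Longrightarrow> C (fst s) (x + y) \<in> U"
    using simple_neighbourhood[OF gen sim open_UNIV UNIV_I] by metis
  let ?A = "\<Union>s'\<in>S - {s}. strand_arc C s'"
  have "card S = 3" using ts unfolding three_strands_def by blast
  then have "finite S" by (metis card.infinite zero_neq_numeral)
  then have "closed ?A"
    unfolding strand_arc_eq
    by (intro closed_UN finite_Diff ballI compact_imp_closed compact_continuous_image generic_continuous[OF gen]) auto
  moreover have "C (fst s) x \<notin> ?A"
    using crossing_param_iff[OF s _ _ x] nt by blast
  moreover have "continuous_on UNIV (C (fst s))" by (rule generic_continuous[OF gen])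
  ultimately have "open (C (fst s) -` (- ?A))" "x \<in> C (fst s) -` (- ?A)"
    by (auto simp: continuous_on_open_vimage)
  then obtain \<epsilon>2 where e2: "\<epsilon>2 > 0" "ball x \<epsilon>2 \<subseteq> C (fst s) -` (- ?A)" by (meson openE)
  define \<epsilon> where "\<epsilon> = min (min \<epsilon>1 \<epsilon>2) (1 - (hi s - lo s))"
  show thesis
  proof (rule that[of \<epsilon>])
    show "\<epsilon> > 0" using U(1) e2(1) st by (simp add: \<epsilon>_def)
    show "C (fst s) y \<notin> double_points C" if "\<bar>y - x\<bar> < \<epsilon>" for y
      using U(2) U(3)[of "y - x"] that by (auto simp: \<epsilon>_def)
    show "C (fst s) y \<notin> D" if y: "\<bar>y - x\<bar> < \<epsilon>" "y \<notin> {lo s..hi s}" for y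
    proof
      assume "C (fst s) y \<in> D"
      then obtain s' where s': "s' \<in> S" "(fst s, y) \<in> strand_points s'" using three_strands_in_D[OF ts] by blast
      then obtain n :: int where n: "fst s = fst s'" "y + of_int n \<in> {lo s'..hi s'}"
        by (auto elim: strand_pointsE)
      show False
      proof (cases "s' = s")
        case True
        have "\<bar>y - x\<bar> < 1 - (hi s - lo s)" using y(1) by (simp add: \<epsilon>_def)
        then have "lo s - 1 < y - 0" "y < hi s + 1" "hi s - 1 < y" "y < lo s + 1" using e st by auto
        then have "of_int n < (1::real)" "of_int n > (-1::real)" using n(2) True by auto
        then have "n = 0" by linarith
        then show False using n(2) y(2) True by simp
      next
        case False
        have "C (fst s) y = C (fst s') (y + of_int n)" using n(1) generic_periodic[OF gen] by simp
        then have "C (fst s) y \<in> strand_arc C s'" using n(2) unfolding strand_arc_eq by simp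
        moreover have "y \<in> ball x \<epsilon>2" using y(1) by (auto simp: \<epsilon>_def dist_real_def)
        ultimately show False using e2(2) s'(1) False by blast
      qed
    qed
  qed
qed

definition crossing_sign :: "'i strand \<Rightarrow> 'i strand \<Rightarrow> real" where
  "crossing_sign s s' = sgn (det2 (tangent C (fst s, crossing_param C s s')) (tangent C (fst s', crossing_param C s' s)))"

lemma crossing_sign_antisym: "crossing_sign s s' = - crossing_sign s' s"
proof -
  have "det2 u v = - det2 v u" for u v by (simp add: det2_eq)
  then show ?thesis unfolding crossing_sign_def by (metis sgn_minus)
qed

lemma crossing_sign_cases:
  assumes "s \<in> S" "s' \<in> S" "s \<noteq> s'"
  shows "crossing_sign s s' = 1 \<or> crossing_sign s s' = -1"
  using transversal[OF gen crossing_param_point_sym[OF assms] crossing_distinct[OF assms]]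
  unfolding crossing_sign_def by (simp add: sgn_real_def)

text \<open>Along a piece with a single crossing the level is constant on each side of it.\<close>

lemma level_past_crossing:
  assumes s: "s \<in> S" "s' \<in> S" "s \<noteq> s'" and N: "numbering UNIV \<sigma> (\<lambda>z. N (region C z)) C"
    and x: "x < crossing_param C s s'" "crossing_param C s s' < y"
    and simple: "\<And>z. x \<le> z \<Longrightarrow> z \<le> y \<Longrightarrow> z \<noteq> crossing_param C s s' \<Longrightarrow> C (fst s) z \<notin> double_points C"
    and lev: "level \<sigma> (\<lambda>z. N (region C z)) C (fst s) x n"
  shows "ind C N (C (fst s) (crossing_param C s s')) = n - \<sigma> * crossing_sign s s' / 2"
    "level \<sigma> (\<lambda>z. N (region C z)) C (fst s) y (n - \<sigma> * crossing_sign s s')"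
proof -
  let ?t = "crossing_param C s s'" and ?g = "\<lambda>z. N (region C z)"
  let ?c = "ind C N (C (fst s) ?t)"
  obtain \<epsilon> where e: "\<epsilon> > 0"
    and c: "\<And>x. 0 < x \<Longrightarrow> x < \<epsilon> \<Longrightarrow> level \<sigma> ?g C (fst s) (?t - x) (?c + \<sigma> * crossing_sign s s'/2) \<and>
       level \<sigma> ?g C (fst s) (?t + x) (?c - \<sigma> * crossing_sign s s'/2)"
    using numbering_crossing[OF gen N refl crossing_param_point_sym[OF s, symmetric] crossing_distinct[OF s]]
    unfolding crossing_sign_def[symmetric] by blast
  define h where "h = min (\<epsilon>/2) (min (?t - x) (y - ?t))"
  have h: "0 < h" "h < \<epsilon>" "h \<le> ?t - x" "h \<le> y - ?t" using e x by (auto simp: h_def)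
  have "level \<sigma> ?g C (fst s) (?t - h) n"
    by (rule level_interval[OF gen N open_UNIV _ _ lev]) (use h simple in auto)
  then have n: "n = ?c + \<sigma> * crossing_sign s s'/2"
    by (rule level_unique) (use c[OF h(1,2)] in blast)
  then show "ind C N (C (fst s) (crossing_param C s s')) = n - \<sigma> * crossing_sign s s' / 2" by simp
  have "level \<sigma> ?g C (fst s) y (?c - \<sigma> * crossing_sign s s'/2)"
    by (rule level_interval[OF gen N open_UNIV _ _ conjunct2[OF c[OF h(1,2)]]]) (use h simple x in auto)
  then show "level \<sigma> ?g C (fst s) y (n - \<sigma> * crossing_sign s s')" using n by simp
qed

text \<open>The two halves of the strand, cut midway between the crossings, contain one crossing each.\<close>

lemma strand_levels:
  assumes S: "S = {s, s', s''}" "s \<noteq> s'" "s \<noteq> s''" "s' \<noteq> s''"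
    and N: "numbering UNIV \<sigma> (\<lambda>z. N (region C z)) C"
    and x: "x < lo s" "hi s < y"
    and simple: "\<And>z. x \<le> z \<Longrightarrow> z < lo s \<Longrightarrow> C (fst s) z \<notin> double_points C"
      "\<And>z. hi s < z \<Longrightarrow> z \<le> y \<Longrightarrow> C (fst s) z \<notin> double_points C"
    and lev: "level \<sigma> (\<lambda>z. N (region C z)) C (fst s) x n"
    and order: "crossing_param C s s' < crossing_param C s s''"
  shows "ind C N (C (fst s) (crossing_param C s s')) = n - \<sigma> * crossing_sign s s' / 2"
    "ind C N (C (fst s) (crossing_param C s s'')) = n - \<sigma> * crossing_sign s s' - \<sigma> * crossing_sign s s'' / 2"
    "level \<sigma> (\<lambda>z. N (region C z)) C (fst s) y (n - \<sigma> * crossing_sign s s' - \<sigma> * crossing_sign s s'')"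
proof -
  have in_S: "s \<in> S" "s' \<in> S" "s'' \<in> S" using S(1) by auto
  note b = crossing_param_bounds[OF in_S(1,2) S(2)] crossing_param_bounds[OF in_S(1,3) S(3)]
  define m where "m = (crossing_param C s s' + crossing_param C s s'') / 2"
  have m: "crossing_param C s s' < m" "m < crossing_param C s s''" using order by (auto simp: m_def)
  have sim: "C (fst s) z \<notin> double_points C"
    if "x \<le> z" "z \<le> y" "z \<noteq> crossing_param C s s'" "z \<noteq> crossing_param C s s''" for z
  proof (cases "z \<in> {lo s..hi s}")
    case True
    then show ?thesis using strand_double_iff[OF in_S(1) True] that S(1) by auto
  qed (use simple that in auto)
  note 1 = level_past_crossing[OF in_S(1,2) S(2) N _ m(1) _ lev]
  show i1: "ind C N (C (fst s) (crossing_param C s s')) = n - \<sigma> * crossing_sign s s' / 2"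
    by (rule 1) (use b m x sim in auto)
  have l: "level \<sigma> (\<lambda>z. N (region C z)) C (fst s) m (n - \<sigma> * crossing_sign s s')"
    by (rule 1) (use b m x sim in auto)
  note 2 = level_past_crossing[OF in_S(1,3) S(3) N m(2) _ _ l, of y]
  show "ind C N (C (fst s) (crossing_param C s s'')) = n - \<sigma> * crossing_sign s s' - \<sigma> * crossing_sign s s'' / 2"
    by (rule 2) (use b m x sim in auto)
  show "level \<sigma> (\<lambda>z. N (region C z)) C (fst s) y (n - \<sigma> * crossing_sign s s' - \<sigma> * crossing_sign s s'')"
    by (rule 2) (use b m x sim in auto)
qed

end

section \<open>The vanishing triangle\<close>

locale strands_in_disk = strands +
  assumes compact_D: "compact D" and connected_off_D: "connected (- D)"
begin

definition triangle_edge :: "'a strand \<Rightarrow> 'a strand \<Rightarrow> 'a strand \<Rightarrow> real \<Rightarrow> complex" where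
  "triangle_edge s p q = C (fst s) \<circ> linepath (crossing_param C s p) (crossing_param C s q)"

definition triangle_boundary :: "complex set" where
  "triangle_boundary = (\<Union>s\<in>S. C (fst s) ` edge_params C S s)"

lemma triangle_eq: "triangle C S = inside triangle_boundary"
  by (simp add: triangle_def triangle_boundary_def)

lemma edge_params_eq:
  assumes "S = {s, q, r}" "s \<noteq> q" "s \<noteq> r" "q \<noteq> r"
  shows "edge_params C S s = closed_segment (crossing_param C s q) (crossing_param C s r)"
proof -
  have in_S: "s \<in> S" "q \<in> S" "r \<in> S" using assms by auto
  have *: "{t \<in> {lo s..hi s}. \<exists>s' \<in> S - {s}. C (fst s) t \<in> strand_arc C s'} = {crossing_param C s q, crossing_param C s r}" (is "?A = _")
  proof -
    have "S - {s} = {q, r}" using assms by auto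
    then show ?thesis
      using crossing_param_iff[OF in_S(1,2) assms(2)] crossing_param_iff[OF in_S(1,3) assms(3)]
        crossing_param_in[OF in_S(1,2) assms(2)] crossing_param_in[OF in_S(1,3) assms(3)] by auto
  qed
  have "edge_params C S s = convex hull ?A"
    unfolding edge_params_def by (cases s) simp
  then show ?thesis unfolding * segment_convex_hull .
qed

lemma edge_params_sub:
  assumes "S = {s, q, r}" "s \<noteq> q" "s \<noteq> r" "q \<noteq> r"
  shows "edge_params C S s \<subseteq> {lo s<..<hi s}"
proof -
  have in_S: "s \<in> S" "q \<in> S" "r \<in> S" using assms by auto
  show ?thesis
    unfolding edge_params_eq[OF assms] closed_segment_eq_real_ivl
    using crossing_param_bounds[OF in_S(1,2) assms(2)] crossing_param_bounds[OF in_S(1,3) assms(3)] by auto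
qed

lemma edges_meet:
  assumes "s \<in> S" "s' \<in> S" "s \<noteq> s'" "A \<subseteq> {lo s..hi s}" "B \<subseteq> {lo s'..hi s'}"
  shows "C (fst s) ` A \<inter> C (fst s') ` B \<subseteq> {C (fst s) (crossing_param C s s')}"
proof
  fix p assume "p \<in> C (fst s) ` A \<inter> C (fst s') ` B"
  then obtain x y where x: "x \<in> A" "p = C (fst s) x" and y: "y \<in> B" "p = C (fst s') y" by blast
  have "p \<in> strand_arc C s'" using y assms(5) unfolding strand_arc_eq by blast
  then have "C (fst s) x \<in> strand_arc C s'" using x(2) by simp
  then show "p \<in> {C (fst s) (crossing_param C s s')}" using crossing_param_iff[OF assms(1-3), of x] x assms(4) by auto
qed

lemma arc_triangle_edge:
  assumes "s \<in> S" "p \<in> S" "q \<in> S" "s \<noteq> p" "s \<noteq> q" "p \<noteq> q"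
  shows "arc (triangle_edge s p q)"
    "path_image (triangle_edge s p q) = C (fst s) ` closed_segment (crossing_param C s p) (crossing_param C s q)"
    "pathstart (triangle_edge s p q) = C (fst s) (crossing_param C s p)"
    "pathfinish (triangle_edge s p q) = C (fst s) (crossing_param C s q)"
proof -
  show im: "path_image (triangle_edge s p q) = C (fst s) ` closed_segment (crossing_param C s p) (crossing_param C s q)"
    unfolding triangle_edge_def by (simp add: path_image_compose)
  show "pathstart (triangle_edge s p q) = C (fst s) (crossing_param C s p)"
    "pathfinish (triangle_edge s p q) = C (fst s) (crossing_param C s q)"
    by (simp_all add: triangle_edge_def pathstart_compose pathfinish_compose)
  have sub: "closed_segment (crossing_param C s p) (crossing_param C s q) \<subseteq> {lo s..hi s}"
    unfolding closed_segment_eq_real_ivl using crossing_param_in[of s p] crossing_param_in[of s q] assms by auto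
  have "inj_on (linepath (crossing_param C s p) (crossing_param C s q)) {0..1}"
    using arc_linepath[OF crossing_param_neq[OF assms]] by (simp add: arc_def)
  moreover have "inj_on (C (fst s)) (linepath (crossing_param C s p) (crossing_param C s q) ` {0..1})"
    using three_strandsD(3)[OF ts assms(1)] sub inj_on_subset by (metis path_image_def path_image_linepath)
  moreover have "path (triangle_edge s p q)"
    unfolding triangle_edge_def by (intro path_continuous_image path_linepath generic_continuous[OF gen])
  ultimately show "arc (triangle_edge s p q)"
    unfolding arc_def triangle_edge_def by (simp add: comp_inj_on)
qed

text \<open>The three edges form a simple closed curve, so the Jordan curve theorem applies to the boundary
  of the triangle.\<close>

lemma jordan_triangle:
  shows "open (inside triangle_boundary)" "open (outside triangle_boundary)"
    "inside triangle_boundary \<inter> outside triangle_boundary = {}"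
    "inside triangle_boundary \<union> outside triangle_boundary = - triangle_boundary"
    "frontier (inside triangle_boundary) = triangle_boundary"
    "frontier (outside triangle_boundary) = triangle_boundary"
proof -
  have "card S = 3" using ts unfolding three_strands_def by blast
  then obtain s q r where S: "S = {s, q, r}" "s \<noteq> q" "s \<noteq> r" "q \<noteq> r" by (metis card_3_iff)
  have in_S: "s \<in> S" "q \<in> S" "r \<in> S" using S by auto
  have S': "S = {q, s, r}" "S = {r, s, q}" using S by auto
  let ?a = "triangle_edge s r q" and ?b = "triangle_edge q s r" and ?c = "triangle_edge r q s"
  note a = arc_triangle_edge[OF in_S(1,3,2) S(3,2) S(4)[symmetric]]
  note b = arc_triangle_edge[OF in_S(2,1,3) S(2)[symmetric] S(4) S(3)]
  note c = arc_triangle_edge[OF in_S(3,2,1) S(4)[symmetric] S(3)[symmetric] S(2)[symmetric]]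
  have X: "C (fst s) (crossing_param C s q) = C (fst q) (crossing_param C q s)" "C (fst q) (crossing_param C q r) = C (fst r) (crossing_param C r q)"
    "C (fst r) (crossing_param C r s) = C (fst s) (crossing_param C s r)"
    using crossing_param_point_sym in_S S(2-4) by metis+
  have sub: "closed_segment (crossing_param C x y) (crossing_param C x z) \<subseteq> {lo x..hi x}"
    if "x \<in> S" "y \<in> S" "z \<in> S" "x \<noteq> y" "x \<noteq> z" for x y z
    unfolding closed_segment_eq_real_ivl using crossing_param_in[of x y] crossing_param_in[of x z] that by auto
  have subs: "closed_segment (crossing_param C s r) (crossing_param C s q) \<subseteq> {lo s..hi s}"
    "closed_segment (crossing_param C q s) (crossing_param C q r) \<subseteq> {lo q..hi q}"
    "closed_segment (crossing_param C r q) (crossing_param C r s) \<subseteq> {lo r..hi r}"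
    using sub in_S S(2-4) by metis+
  have "path_image ?a \<inter> path_image ?b \<subseteq> {pathstart ?b}"
    unfolding a b X(1)[symmetric] using edges_meet[OF in_S(1,2) S(2) subs(1,2)] .
  then have ab: "arc (?a +++ ?b)"
    using a b X by (intro arc_join) simp_all
  have "path_image (?a +++ ?b) \<inter> path_image ?c \<subseteq> {pathstart (?a +++ ?b), pathstart ?c}"
    using edges_meet[OF in_S(1,3) S(3) subs(1,3)] edges_meet[OF in_S(2,3) S(4) subs(2,3)] a b c X
    by (auto simp: path_image_join)
  then have simple: "simple_path ((?a +++ ?b) +++ ?c)" "pathfinish ((?a +++ ?b) +++ ?c) = pathstart ((?a +++ ?b) +++ ?c)"
    using ab c a b X by (auto intro!: simple_path_join_loop)
  have "path_image ((?a +++ ?b) +++ ?c) = path_image ?a \<union> path_image ?b \<union> path_image ?c"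
    using a b c X by (simp add: path_image_join)
  also have "\<dots> = triangle_boundary"
    unfolding triangle_boundary_def a(2) b(2) c(2)
    using edge_params_eq[OF S] edge_params_eq[OF S'(1)] edge_params_eq[OF S'(2)] S
    by (auto simp: closed_segment_commute)
  finally have im: "path_image ((?a +++ ?b) +++ ?c) = triangle_boundary" .
  show "open (inside triangle_boundary)" "open (outside triangle_boundary)"
    "inside triangle_boundary \<inter> outside triangle_boundary = {}"
    "inside triangle_boundary \<union> outside triangle_boundary = - triangle_boundary"
    "frontier (inside triangle_boundary) = triangle_boundary"
    "frontier (outside triangle_boundary) = triangle_boundary"
    using Jordan_inside_outside[OF simple] unfolding im by blast+
qed

lemma connected_side:
  assumes "connected Q" "Q \<inter> triangle_boundary = {}"
  shows "Q \<subseteq> inside triangle_boundary \<or> Q \<subseteq> outside triangle_boundary"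
proof -
  have "Q \<subseteq> inside triangle_boundary \<union> outside triangle_boundary"
    using assms(2) jordan_triangle(4) by blast
  then show ?thesis
    using connectedD[OF assms(1) jordan_triangle(1,2)] jordan_triangle(3) by blast
qed

lemma triangle_boundary_sub: "triangle_boundary \<subseteq> curve_image C" "triangle_boundary \<subseteq> D"
proof -
  show "triangle_boundary \<subseteq> curve_image C"
    unfolding triangle_boundary_def curve_image_def by blast
  have "card S = 3" using ts unfolding three_strands_def by blast
  then obtain s1 q1 r1 where S: "S = {s1, q1, r1}" "s1 \<noteq> q1" "s1 \<noteq> r1" "q1 \<noteq> r1" by (metis card_3_iff)
  have "edge_params C S s \<subseteq> {lo s..hi s}" if "s \<in> S" for s
    using that edge_params_sub[of s1 q1 r1] edge_params_sub[of q1 s1 r1] edge_params_sub[of r1 s1 q1] S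
    by fastforce
  then show "triangle_boundary \<subseteq> D"
    unfolding triangle_boundary_def using three_strands_in_D[OF ts] strand_pointsI by blast
qed

text \<open>The complement of \<open>D\<close> is connected and unbounded, and the triangle lies in \<open>D\<close>.\<close>

lemma off_D_outside: "z \<notin> D \<Longrightarrow> z \<in> outside triangle_boundary"
proof -
  assume z: "z \<notin> D"
  have "- D \<subseteq> connected_component_set (- triangle_boundary) z"
    using z connected_off_D triangle_boundary_sub(2) by (intro connected_component_maximal) auto
  moreover have "\<not> bounded (- D)"
    using compact_D compact_imp_bounded cobounded_imp_unbounded by blast
  ultimately have "\<not> bounded (connected_component_set (- triangle_boundary) z)"
    using bounded_subset by blast
  then show ?thesis using z triangle_boundary_sub(2) by (auto simp: outside)
qed

text \<open>Beyond its edge a strand does not meet the boundary of the triangle again in \<open>D\<close>, so it runs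
  off \<open>D\<close> on one side of that boundary.\<close>

lemma tail_outside:
  assumes S: "S = {s, q, r}" "s \<noteq> q" "s \<noteq> r" "q \<noteq> r"
    and x: "x \<in> {lo s..hi s}" "x \<notin> edge_params C S s"
  shows "C (fst s) x \<in> outside triangle_boundary"
proof -
  have in_S: "s \<in> S" "q \<in> S" "r \<in> S" using S by auto
  have S': "S = {q, s, r}" "S = {r, s, q}" using S by auto
  have not_T: "C (fst s) y \<notin> triangle_boundary" if y: "y \<in> {lo s..hi s}" "y \<notin> edge_params C S s" for y
  proof
    assume "C (fst s) y \<in> triangle_boundary"
    then obtain s' w where s': "s' \<in> S" "w \<in> edge_params C S s'" "C (fst s) y = C (fst s') w"
      unfolding triangle_boundary_def by blast
    have w: "w \<in> {lo s'..hi s'}"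
      using s' edge_params_sub[OF S] edge_params_sub[OF S'(1)] edge_params_sub[OF S'(2)] S by fastforce
    show False
    proof (cases "s' = s")
      case True
      then show False using inj_onD[OF three_strandsD(3)[OF ts in_S(1)]] s' w y by metis
    next
      case False
      have "C (fst s) y \<in> strand_arc C s'" using s' w unfolding strand_arc_eq by auto
      then have "y = crossing_param C s s'" using crossing_param_iff[OF in_S(1) s'(1) False[symmetric] y(1)] by simp
      then have "y \<in> edge_params C S s" unfolding edge_params_eq[OF S] using s'(1) False S by auto
      then show False using y by simp
    qed
  qed
  have main: "C (fst s) x \<in> outside triangle_boundary"
    if J: "connected J" "x \<in> J" "y \<in> J" "C (fst s) y \<notin> D"
      "\<And>w. w \<in> J \<Longrightarrow> w \<in> {lo s..hi s} - edge_params C S s \<or> C (fst s) w \<notin> D" for J y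
  proof -
    have "connected (C (fst s) ` J)"
      by (intro connected_continuous_image generic_continuous[OF gen] J(1))
    moreover have "C (fst s) ` J \<inter> triangle_boundary = {}"
      using J(5) not_T triangle_boundary_sub(2) by blast
    ultimately have "C (fst s) ` J \<subseteq> inside triangle_boundary \<or> C (fst s) ` J \<subseteq> outside triangle_boundary"
      by (rule connected_side)
    then show ?thesis using off_D_outside[OF J(4)] J(2,3) jordan_triangle(3) by blast
  qed
  note b = crossing_param_bounds[OF in_S(1,2) S(2)] crossing_param_bounds[OF in_S(1,3) S(3)]
  have E: "edge_params C S s = {min (crossing_param C s q) (crossing_param C s r)..max (crossing_param C s q) (crossing_param C s r)}"
    unfolding edge_params_eq[OF S] closed_segment_eq_real_ivl by auto
  show ?thesis
  proof (cases "x < min (crossing_param C s q) (crossing_param C s r)")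
    case True
    obtain \<epsilon> where e: "\<epsilon> > 0" "\<And>y. \<bar>y - lo s\<bar> < \<epsilon> \<Longrightarrow> y \<notin> {lo s..hi s} \<Longrightarrow> C (fst s) y \<notin> D"
      using strand_beyond[OF in_S(1) disjI1[OF refl]] by metis
    show ?thesis
    proof (rule main[of "{lo s - \<epsilon>/2..x}" "lo s - \<epsilon>/2"])
      show "C (fst s) (lo s - \<epsilon>/2) \<notin> D" using e by auto
      fix w assume w: "w \<in> {lo s - \<epsilon>/2..x}"
      show "w \<in> {lo s..hi s} - edge_params C S s \<or> C (fst s) w \<notin> D"
        using e(1) e(2)[of w] w x True E by (cases "w < lo s") auto
    qed (use e(1) x in auto)
  next
    case False
    then have gt: "x > max (crossing_param C s q) (crossing_param C s r)" using x(2) E by auto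
    obtain \<epsilon> where e: "\<epsilon> > 0" "\<And>y. \<bar>y - hi s\<bar> < \<epsilon> \<Longrightarrow> y \<notin> {lo s..hi s} \<Longrightarrow> C (fst s) y \<notin> D"
      using strand_beyond[OF in_S(1) disjI2[OF refl]] by metis
    show ?thesis
    proof (rule main[of "{x..hi s + \<epsilon>/2}" "hi s + \<epsilon>/2"])
      show "C (fst s) (hi s + \<epsilon>/2) \<notin> D" using e by auto
      fix w assume w: "w \<in> {x..hi s + \<epsilon>/2}"
      show "w \<in> {lo s..hi s} - edge_params C S s \<or> C (fst s) w \<notin> D"
        using e(1) e(2)[of w] w x gt E by (cases "w > hi s") auto
    qed (use e(1) x in auto)
  qed
qed

lemma region_outside:
  assumes "connected Q" "Q \<inter> curve_image C = {}" "enters p v Q" "p \<in> outside triangle_boundary"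
  shows "Q \<subseteq> outside triangle_boundary"
proof -
  have "enters p v (Q \<inter> outside triangle_boundary)"
    by (rule enters_Int[OF assms(3) enters_open[OF jordan_triangle(2) assms(4)]])
  then have "Q \<inter> outside triangle_boundary \<noteq> {}" by (rule enters_nonempty)
  then show ?thesis
    using connected_side[OF assms(1)] assms(2) triangle_boundary_sub(1) jordan_triangle(3) by blast
qed

text \<open>The direction in which the triangle edge on \<open>q\<close> leaves its vertex on \<open>s\<close>.\<close>

definition forward :: "'a strand \<Rightarrow> 'a strand \<Rightarrow> 'a strand \<Rightarrow> real" where
  "forward q s r = (if crossing_param C q s < crossing_param C q r then 1 else -1)"

text \<open>At the vertex on \<open>s\<close> and \<open>q\<close>, the side of \<open>s\<close> away from the edge on \<open>q\<close> is the side of the tail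
  of \<open>q\<close>, which is outside.  Which side that is depends on the direction of the edge on \<open>q\<close> and on
  the sign of the crossing.\<close>

lemma vertex_outside:
  assumes S: "S = {s, q, r}" "s \<noteq> q" "s \<noteq> r" "q \<noteq> r"
  shows "\<exists>\<epsilon>>0. \<forall>x. x \<noteq> 0 \<and> \<bar>x\<bar> < \<epsilon> \<longrightarrow>
    enters (C (fst s) (crossing_param C s q + x))
      (- (of_real (crossing_sign s q * forward q s r) * \<i> * tangent C (fst s, crossing_param C s q + x)))
      (outside triangle_boundary)"
proof -
  have in_S: "s \<in> S" "q \<in> S" "r \<in> S" using S by auto
  have S': "S = {q, s, r}" using S by auto
  let ?t = "crossing_param C s q" and ?u = "crossing_param C q s" and ?i = "fst s" and ?j = "fst q"
  let ?O = "outside triangle_boundary"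
  have meet: "C ?i ?t = C ?i ?t" "C ?j ?u = C ?i ?t" using crossing_param_point_sym[OF in_S(1,2) S(2)] by auto
  have nz: "det2 (tangent C (?i, ?t)) (tangent C (?j, ?u)) \<noteq> 0"
    using transversal[OF gen crossing_param_point_sym crossing_distinct] in_S S(2) by blast
  have ne: "crossing_param C q s \<noteq> crossing_param C q r" using crossing_param_neq[of q s r] in_S S by auto
  have E: "edge_params C S q = {min ?u (crossing_param C q r)..max ?u (crossing_param C q r)}"
    using edge_params_eq[OF S' S(2)[symmetric] S(4,3)] by (auto simp: closed_segment_eq_real_ivl)
  note b = crossing_param_bounds[OF in_S(2,1) S(2)[symmetric]]
  \<comment> \<open>The edge on \<open>q\<close> starts at this vertex in the direction \<open>forward q s r\<close>, so the other direction is a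
    tail.  It runs between the two sectors next to it, and puts both of them outside.\<close>
  have tail: "C ?j (?u - forward q s r * x) \<in> ?O" if "0 < x" "x < min (?u - lo q) (hi q - ?u)" for x
    by (rule tail_outside[OF S' S(2)[symmetric] S(4,3)]) (use that b ne in \<open>auto simp: E forward_def\<close>)
  define h where "h = min (?u - lo q) (hi q - ?u)"
  have h: "h > 0" using b by (simp add: h_def)
  show ?thesis
  proof (cases "det2 (tangent C (?i, ?t)) (tangent C (?j, ?u)) > 0")
    case True
    then have sign: "crossing_sign s q = 1" by (simp add: crossing_sign_def)
    show ?thesis
    proof (rule crossing_neighbourhood[OF gen meet True open_UNIV UNIV_I])
      fix U \<epsilon> Q1 Q2 Q3 Q4
      assume \<epsilon>: "\<epsilon> > 0" and con: "connected Q1" "connected Q2" "connected Q3" "connected Q4"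
        and Q: "U - curve_image C = Q1 \<union> Q2 \<union> Q3 \<union> Q4"
        and e: "\<And>x. 0 < x \<Longrightarrow> x < \<epsilon> \<Longrightarrow> enters (C ?i (?t + x)) (\<i> * tangent C (?i, ?t + x)) Q1 \<and>
           enters (C ?i (?t + x)) (- (\<i> * tangent C (?i, ?t + x))) Q4"
        "\<And>x. 0 < x \<Longrightarrow> x < \<epsilon> \<Longrightarrow> enters (C ?i (?t - x)) (\<i> * tangent C (?i, ?t - x)) Q2 \<and>
           enters (C ?i (?t - x)) (- (\<i> * tangent C (?i, ?t - x))) Q3"
        "\<And>x. 0 < x \<Longrightarrow> x < \<epsilon> \<Longrightarrow> enters (C ?j (?u + x)) (\<i> * tangent C (?j, ?u + x)) Q2 \<and>
           enters (C ?j (?u + x)) (- (\<i> * tangent C (?j, ?u + x))) Q1"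
        "\<And>x. 0 < x \<Longrightarrow> x < \<epsilon> \<Longrightarrow> enters (C ?j (?u - x)) (\<i> * tangent C (?j, ?u - x)) Q3 \<and>
           enters (C ?j (?u - x)) (- (\<i> * tangent C (?j, ?u - x))) Q4"
      define w where "w = min h \<epsilon> / 2"
      have w: "0 < w" "w < h" "w < \<epsilon>" using h \<epsilon> by (auto simp: w_def)
      have tw: "C ?j (?u - forward q s r * w) \<in> ?O" using tail w by (simp add: h_def)
      have K: "Q1 \<inter> curve_image C = {}" "Q2 \<inter> curve_image C = {}" "Q3 \<inter> curve_image C = {}" "Q4 \<inter> curve_image C = {}"
        using Q by blast+
      have "enters (C ?i (?t + x)) (- (of_real (forward q s r) * \<i> * tangent C (?i, ?t + x))) ?O"
        if x: "x \<noteq> 0" "\<bar>x\<bar> < \<epsilon>" for x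
      proof (cases "forward q s r = 1")
        case True
        then have "C ?j (?u - w) \<in> ?O" using tw by simp
        then have "Q3 \<subseteq> ?O" "Q4 \<subseteq> ?O"
          using region_outside[OF con(3) K(3)] region_outside[OF con(4) K(4)] e(4)[OF w(1,3)] by blast+
        then show ?thesis using e(1)[of x] e(2)[of "-x"] x True enters_mono by (cases "x > 0") fastforce+
      next
        case False
        then have f: "forward q s r = -1" unfolding forward_def by metis
        then have "C ?j (?u + w) \<in> ?O" using tw by simp
        then have "Q2 \<subseteq> ?O" "Q1 \<subseteq> ?O"
          using region_outside[OF con(2) K(2)] region_outside[OF con(1) K(1)] e(3)[OF w(1,3)] by blast+
        then show ?thesis using e(1)[of x] e(2)[of "-x"] x f enters_mono by (cases "x > 0") fastforce+
      qed
      then show ?thesis using \<epsilon> sign by auto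
    qed
  next
    case False
    then have neg: "det2 (tangent C (?i, ?t)) (tangent C (?j, ?u)) < 0" using nz by simp
    then have sign: "crossing_sign s q = -1" by (simp add: crossing_sign_def)
    have pos: "det2 (tangent C (?j, ?u)) (tangent C (?i, ?t)) > 0" using neg by (simp add: det2_eq mult.commute)
    show ?thesis
    proof (rule crossing_neighbourhood[OF gen meet(2,1) pos open_UNIV UNIV_I])
      fix U \<epsilon> Q1 Q2 Q3 Q4
      assume \<epsilon>: "\<epsilon> > 0" and con: "connected Q1" "connected Q2" "connected Q3" "connected Q4"
        and Q: "U - curve_image C = Q1 \<union> Q2 \<union> Q3 \<union> Q4"
        and e: "\<And>x. 0 < x \<Longrightarrow> x < \<epsilon> \<Longrightarrow> enters (C ?j (?u + x)) (\<i> * tangent C (?j, ?u + x)) Q1 \<and>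
           enters (C ?j (?u + x)) (- (\<i> * tangent C (?j, ?u + x))) Q4"
        "\<And>x. 0 < x \<Longrightarrow> x < \<epsilon> \<Longrightarrow> enters (C ?j (?u - x)) (\<i> * tangent C (?j, ?u - x)) Q2 \<and>
           enters (C ?j (?u - x)) (- (\<i> * tangent C (?j, ?u - x))) Q3"
        "\<And>x. 0 < x \<Longrightarrow> x < \<epsilon> \<Longrightarrow> enters (C ?i (?t + x)) (\<i> * tangent C (?i, ?t + x)) Q2 \<and>
           enters (C ?i (?t + x)) (- (\<i> * tangent C (?i, ?t + x))) Q1"
        "\<And>x. 0 < x \<Longrightarrow> x < \<epsilon> \<Longrightarrow> enters (C ?i (?t - x)) (\<i> * tangent C (?i, ?t - x)) Q3 \<and>
           enters (C ?i (?t - x)) (- (\<i> * tangent C (?i, ?t - x))) Q4"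
      define w where "w = min h \<epsilon> / 2"
      have w: "0 < w" "w < h" "w < \<epsilon>" using h \<epsilon> by (auto simp: w_def)
      have tw: "C ?j (?u - forward q s r * w) \<in> ?O" using tail w by (simp add: h_def)
      have K: "Q1 \<inter> curve_image C = {}" "Q2 \<inter> curve_image C = {}" "Q3 \<inter> curve_image C = {}" "Q4 \<inter> curve_image C = {}"
        using Q by blast+
      have "enters (C ?i (?t + x)) (of_real (forward q s r) * \<i> * tangent C (?i, ?t + x)) ?O"
        if x: "x \<noteq> 0" "\<bar>x\<bar> < \<epsilon>" for x
      proof (cases "forward q s r = 1")
        case True
        then have "C ?j (?u - w) \<in> ?O" using tw by simp
        then have "Q2 \<subseteq> ?O" "Q3 \<subseteq> ?O"
          using region_outside[OF con(2) K(2)] region_outside[OF con(3) K(3)] e(2)[OF w(1,3)] by blast+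
        then show ?thesis using e(3)[of x] e(4)[of "-x"] x True enters_mono by (cases "x > 0") fastforce+
      next
        case False
        then have f: "forward q s r = -1" unfolding forward_def by metis
        then have "C ?j (?u + w) \<in> ?O" using tw by simp
        then have "Q1 \<subseteq> ?O" "Q4 \<subseteq> ?O"
          using region_outside[OF con(1) K(1)] region_outside[OF con(4) K(4)] e(1)[OF w(1,3)] by blast+
        then show ?thesis using e(3)[of x] e(4)[of "-x"] x f enters_mono by (cases "x > 0") fastforce+
      qed
      then show ?thesis using \<epsilon> sign by auto
    qed
  qed
qed

text \<open>For \<open>\<kappa> = 1\<close> the inside of the triangle is to the left of the strand, for \<open>\<kappa> = -1\<close> to the right.\<close>

definition inner_side :: "'a strand \<Rightarrow> real \<Rightarrow> real \<Rightarrow> bool" where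
  "inner_side s t \<kappa> \<longleftrightarrow>
     enters (C (fst s) t) (of_real \<kappa> * \<i> * tangent C (fst s, t)) (inside triangle_boundary) \<and>
     enters (C (fst s) t) (- (of_real \<kappa> * \<i> * tangent C (fst s, t))) (outside triangle_boundary)"

text \<open>Each of the two local sides is inside or outside.  They are not both outside and not both
  inside, because the edge lies in the frontiers of the inside and of the outside.\<close>

lemma inner_side_locally:
  assumes S: "S = {s, q, r}" "s \<noteq> q" "s \<noteq> r" "q \<noteq> r"
    and t: "t \<in> open_segment (crossing_param C s q) (crossing_param C s r)"
  shows "\<exists>\<kappa> \<in> {1, -1}. \<exists>\<epsilon>>0. \<forall>x. \<bar>x - t\<bar> < \<epsilon> \<longrightarrow> inner_side s x \<kappa>"
proof -
  have in_S: "s \<in> S" "q \<in> S" "r \<in> S" using S by auto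
  let ?T = "triangle_boundary" and ?I = "inside triangle_boundary" and ?O = "outside triangle_boundary"
  have te: "t \<in> edge_params C S s" using t by (auto simp: edge_params_eq[OF S] open_segment_def)
  then have tb: "t \<in> {lo s..hi s}" using edge_params_sub[OF S] by fastforce
  have simple: "C (fst s) t \<notin> double_points C"
    using strand_double_iff[OF in_S(1) tb] t S by (auto simp: open_segment_def)
  have onT: "C (fst s) t \<in> ?T" using te in_S(1) unfolding triangle_boundary_def by blast
  show ?thesis
  proof (rule simple_neighbourhood[OF gen simple open_UNIV UNIV_I])
    fix U \<epsilon> L R
    assume U: "open U" "C (fst s) t \<in> U" "\<epsilon> > 0" and con: "connected L" "connected R"
      and LR: "U - curve_image C = L \<union> R"
      and eL: "\<And>x. \<bar>x\<bar> < \<epsilon> \<Longrightarrow> enters (C (fst s) (t + x)) (\<i> * tangent C (fst s, t + x)) L"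
      and eR: "\<And>x. \<bar>x\<bar> < \<epsilon> \<Longrightarrow> enters (C (fst s) (t + x)) (- (\<i> * tangent C (fst s, t + x))) R"
    have off: "L \<inter> ?T = {}" "R \<inter> ?T = {}" using LR triangle_boundary_sub(1) by blast+
    note side = connected_side[OF con(1) off(1)] connected_side[OF con(2) off(2)]
    have meets: "\<exists>z \<in> U \<inter> A. z \<in> L \<union> R" if "open A" "C (fst s) t \<in> frontier A" for A
    proof -
      have "C (fst s) t \<in> closure A" using that(2) by (simp add: frontier_def)
      then have ne: "U \<inter> A \<noteq> {}" using U(1,2) open_Int_closure_eq_empty by blast
      have "open (U \<inter> A)" using U(1) that(1) by (rule open_Int)
      then obtain z where "z \<in> U \<inter> A" "z \<notin> curve_image C"
        using curve_image_nowhere_dense[OF gen _ ne] by blast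
      then show ?thesis using LR by blast
    qed
    have "\<exists>z \<in> U \<inter> ?I. z \<in> L \<union> R" "\<exists>z \<in> U \<inter> ?O. z \<in> L \<union> R"
      using meets[OF jordan_triangle(1)] meets[OF jordan_triangle(2)] jordan_triangle(5,6) onT by auto
    then consider "L \<subseteq> ?I" "R \<subseteq> ?O" | "L \<subseteq> ?O" "R \<subseteq> ?I"
      using side jordan_triangle(3) by blast
    then show ?thesis
    proof cases
      case 1
      have "inner_side s x 1" if "\<bar>x - t\<bar> < \<epsilon>" for x
        using enters_mono[OF eL[OF that] 1(1)] enters_mono[OF eR[OF that] 1(2)] by (simp add: inner_side_def)
      then show ?thesis using U(3) by blast
    next
      case 2
      have "inner_side s x (-1)" if "\<bar>x - t\<bar> < \<epsilon>" for x
        using enters_mono[OF eL[OF that] 2(1)] enters_mono[OF eR[OF that] 2(2)] by (simp add: inner_side_def)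
      then show ?thesis using U(3) by blast
    qed
  qed
qed

lemma inner_side_unique:
  assumes "inner_side s t \<kappa>" "enters (C (fst s) t) (- (of_real \<kappa>' * \<i> * tangent C (fst s, t))) (outside triangle_boundary)"
    "\<kappa> \<in> {1, -1}" "\<kappa>' \<in> {1, -1}"
  shows "\<kappa>' = \<kappa>"
proof (rule ccontr)
  assume "\<kappa>' \<noteq> \<kappa>"
  then have "\<kappa>' = - \<kappa>" using assms(3,4) by auto
  then have "enters (C (fst s) t) (of_real \<kappa> * \<i> * tangent C (fst s, t)) (inside triangle_boundary \<inter> outside triangle_boundary)"
    using assms(1,2) by (intro enters_Int) (auto simp: inner_side_def)
  then show False using enters_nonempty jordan_triangle(3) by blast
qed

text \<open>The inner side is locally constant along the edge, and close to the vertex with \<open>q\<close> the outer side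
  is known.\<close>

lemma inner_side_edge:
  assumes S: "S = {s, q, r}" "s \<noteq> q" "s \<noteq> r" "q \<noteq> r"
    and t: "t \<in> open_segment (crossing_param C s q) (crossing_param C s r)"
  shows "inner_side s t (crossing_sign s q * forward q s r)"
proof -
  have in_S: "s \<in> S" "q \<in> S" "r \<in> S" using S by auto
  let ?\<kappa> = "crossing_sign s q * forward q s r" and ?J = "open_segment (crossing_param C s q) (crossing_param C s r)"
  have \<kappa>: "?\<kappa> \<in> {1, -1}" using crossing_sign_cases[OF in_S(1,2) S(2)] by (auto simp: forward_def)
  obtain \<epsilon> where e: "\<epsilon> > 0" "\<And>x. x \<noteq> 0 \<Longrightarrow> \<bar>x\<bar> < \<epsilon> \<Longrightarrow>
    enters (C (fst s) (crossing_param C s q + x)) (- (of_real ?\<kappa> * \<i> * tangent C (fst s, crossing_param C s q + x))) (outside triangle_boundary)"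
    using vertex_outside[OF S] by blast
  have ne: "crossing_param C s q \<noteq> crossing_param C s r" using crossing_param_neq[of s q r] in_S S by auto
  define w where "w = min (\<epsilon> / 2) (\<bar>crossing_param C s r - crossing_param C s q\<bar> / 2)"
  define x where "x = (if crossing_param C s q < crossing_param C s r then w else - w)"
  have w: "0 < w" "w < \<epsilon>" "w < \<bar>crossing_param C s r - crossing_param C s q\<bar>" using e(1) ne by (auto simp: w_def min_less_iff_disj)
  have xJ: "crossing_param C s q + x \<in> ?J" "x \<noteq> 0" "\<bar>x\<bar> < \<epsilon>"
    using w ne by (auto simp: x_def open_segment_eq_real_ivl)
  show ?thesis
  proof (rule connected_induction_simple[of ?J "crossing_param C s q + x" t "\<lambda>t. inner_side s t ?\<kappa>"])
    show "connected ?J" by (intro convex_connected convex_open_segment)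
    obtain \<kappa>' where "\<kappa>' \<in> {1, -1}" "inner_side s (crossing_param C s q + x) \<kappa>'"
      using inner_side_locally[OF S xJ(1)] by force
    then show "inner_side s (crossing_param C s q + x) ?\<kappa>"
      using inner_side_unique[OF _ e(2)[OF xJ(2,3)] _ \<kappa>] by metis
    fix a assume a: "a \<in> ?J"
    obtain \<kappa>' d where d: "\<kappa>' \<in> {1, -1}" "d > 0" "\<And>x. \<bar>x - a\<bar> < d \<Longrightarrow> inner_side s x \<kappa>'"
      using inner_side_locally[OF S a] by blast
    show "\<exists>T. openin (top_of_set ?J) T \<and> a \<in> T \<and>
        (\<forall>x\<in>T. \<forall>y\<in>T. inner_side s x ?\<kappa> \<longrightarrow> inner_side s y ?\<kappa>)"
    proof (intro exI[of _ "?J \<inter> ball a d"] conjI ballI impI)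
      fix x y assume xy: "x \<in> ?J \<inter> ball a d" "y \<in> ?J \<inter> ball a d" and "inner_side s x ?\<kappa>"
      then have "?\<kappa> = \<kappa>'"
        using inner_side_unique[OF d(3)[of x] _ d(1) \<kappa>] by (auto simp: inner_side_def dist_real_def abs_minus_commute)
      then show "inner_side s y ?\<kappa>" using d(3)[of y] xy by (simp add: dist_real_def abs_minus_commute)
    qed (use a d(2) in \<open>simp_all add: openin_open_Int\<close>)
  qed (use xJ t in auto)
qed

text \<open>Outwardness of an edge is a matter of the sign of the crossing at one of its vertices and the
  direction of the other edge there.  The vertex may be chosen freely.\<close>

lemma outward_iff:
  assumes S: "S = {s, q, r}" "s \<noteq> q" "s \<noteq> r" "q \<noteq> r" and \<sigma>: "\<sigma> \<in> {1, -1}"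
  shows "outward \<sigma> C S s \<longleftrightarrow> \<sigma> * crossing_sign s q * forward q s r = -1"
proof -
  have in_S: "s \<in> S" "q \<in> S" "r \<in> S" using S by auto
  let ?\<kappa> = "crossing_sign s q * forward q s r" and ?J = "open_segment (crossing_param C s q) (crossing_param C s r)"
  have \<kappa>: "?\<kappa> \<in> {1, -1}" using crossing_sign_cases[OF in_S(1,2) S(2)] by (auto simp: forward_def)
  have ne: "crossing_param C s q \<noteq> crossing_param C s r" using crossing_param_neq[of s q r] in_S S by auto
  have J: "interior (edge_params C S s) = ?J"
    unfolding edge_params_eq[OF S] closed_segment_eq_real_ivl open_segment_eq_real_ivl by simp
  have out: "outward \<sigma> C S s \<longleftrightarrow> (\<forall>t\<in>?J. enters (C (fst s) t) (coorientation \<sigma> C (fst s, t)) (- inside triangle_boundary))"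
    unfolding outward_def J triangle_eq enters_def by simp
  show ?thesis
  proof (cases "\<sigma> * crossing_sign s q * forward q s r = -1")
    case True
    then have "\<sigma> = - ?\<kappa>" using \<sigma> \<kappa> by (auto simp: mult.assoc)
    then have co: "coorientation \<sigma> C (fst s, t) = - (of_real ?\<kappa> * \<i> * tangent C (fst s, t))" for t
      unfolding coorientation_def by simp
    have "outside triangle_boundary \<subseteq> - inside triangle_boundary" using jordan_triangle(3) by blast
    then have "outward \<sigma> C S s"
      unfolding out co using inner_side_edge[OF S] enters_mono unfolding inner_side_def by blast
    then show ?thesis using True by simp
  next
    case False
    then have eq: "\<sigma> = ?\<kappa>" using \<sigma> \<kappa> by (auto simp: mult.assoc)
    obtain t where t: "t \<in> ?J" using ne by (metis all_not_in_conv open_segment_eq_empty)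
    have "enters (C (fst s) t) (coorientation \<sigma> C (fst s, t)) (inside triangle_boundary)"
      using inner_side_edge[OF S t] unfolding inner_side_def coorientation_def eq by blast
    then have "\<not> enters (C (fst s) t) (coorientation \<sigma> C (fst s, t)) (- inside triangle_boundary)"
      using enters_Int enters_nonempty by fastforce
    then show ?thesis using False t out by blast
  qed
qed

end

section \<open>The change of the invariant\<close>

context strands
begin

text \<open>Both orders of the two crossings in one formula: a crossing is counted in full in the index of
  each later one, and by half in its own.\<close>

lemma strand_indices:
  assumes S: "S = {s, q, r}" "s \<noteq> q" "s \<noteq> r" "q \<noteq> r"
    and N: "numbering UNIV \<sigma> (\<lambda>z. N (region C z)) C"
    and x: "x < lo s" "hi s < y"
    and simple: "\<And>z. x \<le> z \<Longrightarrow> z < lo s \<Longrightarrow> C (fst s) z \<notin> double_points C"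
      "\<And>z. hi s < z \<Longrightarrow> z \<le> y \<Longrightarrow> C (fst s) z \<notin> double_points C"
    and lev: "level \<sigma> (\<lambda>z. N (region C z)) C (fst s) x n"
  shows "ind C N (C (fst s) (crossing_param C s q)) = n - \<sigma> * crossing_sign s q / 2
      - (if crossing_param C s q < crossing_param C s r then 0 else \<sigma> * crossing_sign s r)" (is ?i1)
    and "ind C N (C (fst s) (crossing_param C s r)) = n - \<sigma> * crossing_sign s r / 2
      - (if crossing_param C s q < crossing_param C s r then \<sigma> * crossing_sign s q else 0)" (is ?i2)
    and "level \<sigma> (\<lambda>z. N (region C z)) C (fst s) y (n - \<sigma> * crossing_sign s q - \<sigma> * crossing_sign s r)" (is ?l)
proof -
  have S': "S = {s, r, q}" using S by auto
  have ne: "crossing_param C s q \<noteq> crossing_param C s r" using crossing_param_neq[of s q r] S by auto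
  have "?i1 \<and> ?i2 \<and> ?l"
  proof (cases "crossing_param C s q < crossing_param C s r")
    case True
    show ?thesis using strand_levels[OF S N x simple lev True] True by simp
  next
    case False
    then have lt: "crossing_param C s r < crossing_param C s q" using ne by simp
    show ?thesis using strand_levels[OF S' S(3,2) S(4)[symmetric] N x simple lev lt] False
      by (simp add: algebra_simps)
  qed
  then show ?i1 ?i2 ?l by blast+
qed

text \<open>The strand itself is the connection: the piece from the crossing to that end avoids the
  crossing with \<open>r\<close>.\<close>

lemma crossing_reaches_end:
  assumes S: "S = {s, q, r}" "s \<noteq> q" "s \<noteq> r" "q \<noteq> r"
  shows "crossing_param C s q < crossing_param C s r \<Longrightarrow>
      connected_component (D - strand_arc C r) (C (fst s) (crossing_param C s q)) (C (fst s) (lo s))"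
    and "crossing_param C s r < crossing_param C s q \<Longrightarrow>
      connected_component (D - strand_arc C r) (C (fst s) (crossing_param C s q)) (C (fst s) (hi s))"
proof -
  have in_S: "s \<in> S" "q \<in> S" "r \<in> S" using S by auto
  have main: "connected_component (D - strand_arc C r) (C (fst s) x) (C (fst s) y)"
    if "connected J" "x \<in> J" "y \<in> J" "J \<subseteq> {lo s..hi s} - {crossing_param C s r}" for J x y
  proof -
    have "C (fst s) ` J \<subseteq> D - strand_arc C r"
      using that(4) crossing_param_iff[OF in_S(1,3) S(3)] three_strands_in_D[OF ts] strand_pointsI in_S(1) by blast
    moreover have "connected (C (fst s) ` J)"
      by (intro connected_continuous_image generic_continuous[OF gen] that(1))
    ultimately show ?thesis using that(2,3) unfolding connected_component_def by blast
  qed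
  note b = crossing_param_bounds[OF in_S(1,2) S(2)]
  show "connected_component (D - strand_arc C r) (C (fst s) (crossing_param C s q)) (C (fst s) (lo s))"
    if "crossing_param C s q < crossing_param C s r"
    by (rule main[of "{lo s..crossing_param C s q}"]) (use that b in auto)
  show "connected_component (D - strand_arc C r) (C (fst s) (crossing_param C s q)) (C (fst s) (hi s))"
    if "crossing_param C s r < crossing_param C s q"
    by (rule main[of "{crossing_param C s q..hi s}"]) (use that b in auto)
qed

lemma St1_split:
  assumes S: "S = {s, q, r}" "s \<noteq> q" "s \<noteq> r" "q \<noteq> r"
  shows "St1 C N = (\<Sum>d\<in>double_points C - D. ind C N d) + ind C N (C (fst s) (crossing_param C s q))
    + ind C N (C (fst s) (crossing_param C s r)) + ind C N (C (fst q) (crossing_param C q r))"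
proof -
  have in_S: "s \<in> S" "q \<in> S" "r \<in> S" using S by auto
  let ?X = "C (fst s) (crossing_param C s q)" and ?Y = "C (fst s) (crossing_param C s r)" and ?Z = "C (fst q) (crossing_param C q r)"
  note sym = crossing_param_point_sym[OF in_S(1,2) S(2)] crossing_param_point_sym[OF in_S(1,3) S(3)] crossing_param_point_sym[OF in_S(2,3) S(4)]
  have inD: "C (fst s') (crossing_param C s' s'') \<in> D" if "s' \<in> S" "s'' \<in> S" "s' \<noteq> s''" for s' s''
    using three_strands_in_D[OF ts] strand_pointsI[OF crossing_param_in[OF that]] that by blast
  have distinct: "?X \<noteq> ?Y" "?X \<noteq> ?Z" "?Y \<noteq> ?Z"
  proof -
    have ne: "C (fst s') (crossing_param C s' u) \<noteq> C (fst s') (crossing_param C s' v)"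
      if "s' \<in> S" "u \<in> S" "v \<in> S" "s' \<noteq> u" "s' \<noteq> v" "u \<noteq> v" for s' u v
      using inj_onD[OF three_strandsD(3)[OF ts that(1)]] crossing_param_neq[OF that] crossing_param_in that by metis
    show "?X \<noteq> ?Y" using ne in_S S(2-4) by blast
    show "?X \<noteq> ?Z" unfolding sym(1) using ne[of q s r] in_S S(2-4) by auto
    show "?Y \<noteq> ?Z" unfolding sym(2,3) using ne[of r s q] in_S S(2-4) by auto
  qed
  have "double_points C \<inter> D = {?X, ?Y, ?Z}"
  proof
    show "{?X, ?Y, ?Z} \<subseteq> double_points C \<inter> D"
      using crossing_param_double inD in_S S(2-4) by auto
    show "double_points C \<inter> D \<subseteq> {?X, ?Y, ?Z}"
    proof
      fix d assume d: "d \<in> double_points C \<inter> D"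
      then obtain i t where it: "C i t = d" using double_points_on_curve[of d C] curve_image_iff[of d C] by auto
      then obtain s' where s': "s' \<in> S" "(i, t) \<in> strand_points s'" using three_strands_in_D[OF ts] d by auto
      then obtain n :: int where n: "i = fst s'" "t + of_int n \<in> {lo s'..hi s'}" by (auto elim: strand_pointsE)
      then have dn: "d = C (fst s') (t + of_int n)" using it generic_periodic[OF gen] by simp
      then obtain s'' where "s'' \<in> S" "s'' \<noteq> s'" "t + of_int n = crossing_param C s' s''"
        using strand_double_iff[OF s'(1) n(2)] d by auto
      then show "d \<in> {?X, ?Y, ?Z}" using s'(1) dn sym S(1) by auto
    qed
  qed
  then have split: "double_points C = (double_points C - D) \<union> {?X, ?Y, ?Z}" "(double_points C - D) \<inter> {?X, ?Y, ?Z} = {}"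
    by blast+
  have "St1 C N = (\<Sum>d\<in>double_points C - D. ind C N d) + (\<Sum>d\<in>{?X, ?Y, ?Z}. ind C N d)"
    unfolding St1_def
    by (subst split(1), rule sum.union_disjoint) (use finite_double_points[OF gen] split(2) in auto)
  then show ?thesis using distinct by simp
qed

end

text \<open>The index is determined by the level just before the double point, which is the same for both
  curves.\<close>

lemma agree_off_ind:
  fixes C C' :: "('i::finite) curve"
  assumes ag: "agree_off D C C'" and gen: "generic_curve C" "generic_curve C'"
    and D: "compact D" "connected (- D)"
    and \<sigma>: "\<sigma> \<in> {1, -1}" and N: "alexander_numbering \<sigma> \<kappa> C N" and N': "alexander_numbering \<sigma> \<kappa> C' N'"
    and d: "d \<in> double_points C" "d \<notin> D"
  shows "ind C' N' d = ind C N d"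
proof -
  obtain i t j u where ij: "C i t = d" "C j u = d" "(i, frac t) \<noteq> (j, frac u)"
    using double_point_cases[OF gen(1) d(1)] by metis
  have ij': "C' i t = d" "C' j u = d" using ag ij(1,2) d(2) unfolding agree_off_def by metis+
  have cl: "closed D" using D(1) by (rule compact_imp_closed)
  have tan: "tangent C' (i, t) = tangent C (i, t)" "tangent C' (j, u) = tangent C (j, u)"
    using agree_off_tangent[OF ag gen cl] ij d(2) by auto
  let ?e = "sgn (det2 (tangent C (i, t)) (tangent C (j, u)))"
  obtain \<epsilon> where e: "\<epsilon> > 0" "\<And>x. 0 < x \<Longrightarrow> x < \<epsilon> \<Longrightarrow> level \<sigma> (\<lambda>z. N (region C z)) C i (t - x) (ind C N d + \<sigma> * ?e/2)"
    using numbering_crossing[OF gen(1) numbering_alexander[OF N \<sigma>] ij] by blast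
  obtain \<epsilon>' where e': "\<epsilon>' > 0" "\<And>x. 0 < x \<Longrightarrow> x < \<epsilon>' \<Longrightarrow> level \<sigma> (\<lambda>z. N' (region C' z)) C' i (t - x) (ind C' N' d + \<sigma> * ?e/2)"
    using numbering_crossing[OF gen(2) numbering_alexander[OF N' \<sigma>] ij' ij(3)] unfolding tan by blast
  have "open (C i -` (- D))" "t \<in> C i -` (- D)"
    using cl generic_continuous[OF gen(1), of UNIV i] ij(1) d(2) by (auto simp: continuous_on_open_vimage)
  then obtain \<delta> where \<delta>: "\<delta> > 0" "ball t \<delta> \<subseteq> C i -` (- D)" by (meson openE)
  define x where "x = min (min \<epsilon> \<epsilon>') \<delta> / 2"
  have x: "0 < x" "x < \<epsilon>" "x < \<epsilon>'" "x < \<delta>" using e(1) e'(1) \<delta>(1) by (auto simp: x_def min_less_iff_disj)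
  have "C i (t - x) \<notin> D" using \<delta>(2) x by (auto simp: dist_real_def subset_iff)
  from agree_off_level[OF ag gen D \<sigma> N N' this e(2)[OF x(1,2)]]
  have "ind C' N' d + \<sigma> * ?e/2 = ind C N d + \<sigma> * ?e/2"
    using level_unique[OF e'(2)[OF x(1,3)]] by blast
  then show ?thesis by simp
qed

text \<open>The strands are \<open>a\<close>, \<open>b\<close> and \<open>m\<close>, with initial levels \<open>na\<close>, \<open>nb\<close>, \<open>nm\<close>.  The numbers \<open>x\<close>, \<open>y\<close>, \<open>z\<close> are
  \<open>\<sigma>\<close> times the signs of the crossings \<open>ab\<close>, \<open>am\<close>, \<open>bm\<close>, seen from the first strand named; seen
  from the other strand a crossing has the opposite sign.  The flags tell the order of crossings
  on a strand: \<open>A\<close> that \<open>a\<close> meets \<open>b\<close> before \<open>m\<close>, \<open>B\<close> that \<open>b\<close> meets \<open>a\<close> before \<open>m\<close>, and \<open>M\<close> that \<open>m\<close> meets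
  \<open>a\<close> before \<open>b\<close>.  The index of each crossing is given along both of its strands, and the comparison
  forces the order on \<open>m\<close> to be reversed, too.\<close>

lemma triangle_index_arithmetic:
  fixes x y z :: real
  assumes xyz: "x = 1 \<or> x = -1" "y = 1 \<or> y = -1" "z = 1 \<or> z = -1"
    and before: "cab = na - x/2 - (if A then 0 else y)" "cam = na - y/2 - (if A then x else 0)"
      "cab = nb + x/2 - (if B then 0 else z)" "cbm = nb - z/2 - (if B then - x else 0)"
      "cam = nm + y/2 - (if M then 0 else - z)" "cbm = nm + z/2 - (if M then - y else 0)"
    and after: "cab' = na - x/2 - (if A' then 0 else y)" "cam' = na - y/2 - (if A' then x else 0)"
      "cab' = nb + x/2 - (if B' then 0 else z)" "cbm' = nb - z/2 - (if B' then - x else 0)"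
      "cam' = nm + y/2 - (if M' then 0 else - z)" "cbm' = nm + z/2 - (if M' then - y else 0)"
    and flip: "A' \<longleftrightarrow> \<not> A" "B' \<longleftrightarrow> \<not> B"
  shows "(cab' + cam' + cbm') - (cab + cam + cbm) =
    2 * ((if x * (if B then 1 else -1) = -1 then 1 else 0) +
         (if z * (if M then -1 else 1) = -1 then 1 else 0) +
         (if - y * (if A then -1 else 1) = -1 then 1 else 0)) - 3"
proof -
  have half: "(if u = -1 then 1 else 0) = (1 - u) / 2" if "u = 1 \<or> u = -1" for u :: real
    using that by auto
  have ox: "(if x * (if B then 1 else -1) = -1 then 1 else 0) = (1 - x * (if B then 1 else -1)) / 2"
    by (rule half) (use xyz(1) in auto)
  have oz: "(if z * (if M then -1 else 1) = -1 then 1 else 0) = (1 - z * (if M then -1 else 1)) / 2"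
    by (rule half) (use xyz(3) in auto)
  have oy: "(if - y * (if A then -1 else 1) = -1 then 1 else 0) = (1 - (- y) * (if A then -1 else 1)) / 2"
    by (rule half) (use xyz(2) in auto)
  have ab: "cab' - cab = (if A then - y else y)" using before(1) after(1) flip(1) by (cases A) auto
  have am: "cam' - cam = (if A then x else - x)" using before(2) after(2) flip(1) by (cases A) auto
  have bm: "cbm' - cbm = (if B then - x else x)" using before(4) after(4) flip(2) by (cases B) auto
  have "M' \<noteq> M"
  proof
    assume "M' = M"
    then have "cam' = cam" using before(5) after(5) by simp
    then show False using am xyz(1) by (auto split: if_splits)
  qed
  then have am': "cam' - cam = (if M then z else - z)" using before(5) after(5) by (cases M; cases M') auto
  have "(cab' + cam' + cbm') - (cab + cam + cbm) = (cab' - cab) + (cam' - cam) + (cbm' - cbm)" by simp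
  also have "\<dots> = (if A then - y else y) + (if M then z else - z) + (if B then - x else x)"
    using ab am' bm by simp
  finally show ?thesis unfolding ox oy oz by (simp add: field_simps)
qed

lemma Omega3_agree_off:
  assumes "Omega3 D S m C C'"
  shows "agree_off D C C'"
proof -
  have st: "three_strands D C S" "three_strands D C' S" "m \<in> S"
    and eq: "\<And>i t. (i, t) \<notin> strand_points m \<Longrightarrow> C' i t = C i t"
    using assms unfolding Omega3_def by blast+
  show ?thesis
    unfolding agree_off_def using three_strands_in_D[OF st(1)] three_strands_in_D[OF st(2)] st(3) eq by blast
qed

theorem lemma3p1:
  fixes C C' :: "('i::finite) curve"
    and D :: "complex set" and S :: "'i strand set" and m :: "'i strand"
    and N N' :: "complex set \<Rightarrow> real" and \<sigma> \<kappa> :: real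
  assumes "\<sigma> \<in> {1, -1}"
    and "generic_curve C" and "generic_curve C'"
    and "Omega3 D S m C C'"
    and "alexander_numbering \<sigma> \<kappa> C N" and "alexander_numbering \<sigma> \<kappa> C' N'"
  shows "St1 C' N' - St1 C N = 2 * real (outward_count \<sigma> C S) - 3"
proof -
  note \<sigma> = assms(1) and gen = assms(2) and gen' = assms(3) and N = assms(5) and N' = assms(6)
  have hom: "D homeomorphic cball (0::complex) 1" and mS: "m \<in> S"
    and ts: "three_strands D C S" and ts': "three_strands D C' S"
    and eq: "\<And>i t. (i, t) \<notin> strand_points m \<Longrightarrow> C' i t = C i t"
    and sides: "\<And>p q. p \<in> (\<Inter>s \<in> S - {m}. strand_arc C s) \<Longrightarrow> q \<in> frontier D \<Longrightarrow>
      \<not> (connected_component (D - strand_arc C m) p q \<and> connected_component (D - strand_arc C' m) p q)"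
    using assms(4) unfolding Omega3_def by blast+
  have D: "compact D" "connected (- D)"
    using homeomorphic_compactness[OF hom] connected_complement_homeomorphic_convex_compact[OF hom] by auto
  interpret A: strands_in_disk D C S
    by unfold_locales (use gen ts D compact_imp_closed in auto)
  interpret B: strands_in_disk D C' S
    by unfold_locales (use gen' ts' D compact_imp_closed in auto)
  have ag: "agree_off D C C'" using assms(4) by (rule Omega3_agree_off)
  note num = numbering_alexander[OF N \<sigma>] and num' = numbering_alexander[OF N' \<sigma>]
  have "card S = 3" using ts unfolding three_strands_def by blast
  then have "card (S - {m}) = 2" using mS by simp
  then obtain a b where ab: "S - {m} = {a, b}" "a \<noteq> b" by (meson card_2_iff)
  have am: "a \<noteq> m" and bm: "b \<noteq> m" and in_S: "a \<in> S" "b \<in> S" using ab by auto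
  have S: "S = {a, b, m}" "S = {b, a, m}" "S = {m, a, b}" "S = {b, m, a}" "S = {a, m, b}" using ab mS by auto

  have fixed: "C' (fst s) x = C (fst s) x" if "s \<in> {a, b}" "x \<in> {lo s..hi s}" for s x
    using three_strandsD(7)[OF ts _ mS, of s] strand_pointsI[OF that(2)] that(1) am bm in_S eq by blast
  have arcs: "strand_arc C' s = strand_arc C s" if "s \<in> {a, b}" for s
    unfolding strand_arc_eq using fixed[OF that] by (auto intro!: image_cong)
  have param_ab: "crossing_param C' s q = crossing_param C s q" if "s \<in> {a, b}" "q \<in> {a, b}" "s \<noteq> q" for s q
  proof -
    have sq: "s \<in> S" "q \<in> S" using that in_S by auto
    have "crossing_param C s q \<in> {lo s..hi s}" by (rule A.crossing_param_in[OF sq that(3)])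
    moreover from this have "C' (fst s) (crossing_param C s q) \<in> strand_arc C' q"
      using A.crossing_param_iff[OF sq that(3)] fixed[OF that(1)] arcs[OF that(2)] by simp
    ultimately show ?thesis using B.crossing_param_iff[OF sq that(3)] by metis
  qed
  have tan_ab: "tangent C' (fst s, x) = tangent C (fst s, x)" if "s \<in> {a, b}" "lo s < x" "x < hi s" for s x
  proof -
    have "(C' (fst s) has_vector_derivative tangent C (fst s, x)) (at x)"
      by (rule has_vector_derivative_transform_within_open[OF generic_vector_derivative[OF gen], of "{lo s<..<hi s}"])
        (use fixed[OF that(1)] that in auto)
    then show ?thesis
      using generic_vector_derivative[OF gen'] vector_derivative_unique_at by blast
  qed
  have sign_ab: "B.crossing_sign a b = A.crossing_sign a b"
    unfolding A.crossing_sign_def B.crossing_sign_def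
    using param_ab[of a b] param_ab[of b a] tan_ab[of a] tan_ab[of b] A.crossing_param_bounds[of a b] A.crossing_param_bounds[of b a] ab(2) in_S by simp

  \<comment> \<open>Just before its start and just after its end a strand is off \<open>D\<close>, so its levels there are the
    same for both curves.  The common initial level \<open>n\<close> gives the indices, and the common final level
    the equality of the sums of signs.\<close>
  have profile: "\<exists>n.
      ind C N (C (fst s) (crossing_param C s q)) = n - \<sigma> * A.crossing_sign s q / 2
        - (if crossing_param C s q < crossing_param C s r then 0 else \<sigma> * A.crossing_sign s r) \<and>
      ind C N (C (fst s) (crossing_param C s r)) = n - \<sigma> * A.crossing_sign s r / 2
        - (if crossing_param C s q < crossing_param C s r then \<sigma> * A.crossing_sign s q else 0) \<and>
      ind C' N' (C' (fst s) (crossing_param C' s q)) = n - \<sigma> * B.crossing_sign s q / 2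
        - (if crossing_param C' s q < crossing_param C' s r then 0 else \<sigma> * B.crossing_sign s r) \<and>
      ind C' N' (C' (fst s) (crossing_param C' s r)) = n - \<sigma> * B.crossing_sign s r / 2
        - (if crossing_param C' s q < crossing_param C' s r then \<sigma> * B.crossing_sign s q else 0) \<and>
      A.crossing_sign s q + A.crossing_sign s r = B.crossing_sign s q + B.crossing_sign s r"
    if sqr: "S = {s, q, r}" "s \<noteq> q" "s \<noteq> r" "q \<noteq> r" for s q r
  proof -
    have s: "s \<in> S" using sqr by auto
    have near: "\<exists>\<epsilon>>0. \<forall>y. \<bar>y - x\<bar> < \<epsilon> \<longrightarrow> C (fst s) y \<notin> double_points C \<and> C' (fst s) y \<notin> double_points C' \<and>
        (y \<notin> {lo s..hi s} \<longrightarrow> C (fst s) y \<notin> D)" if x: "x = lo s \<or> x = hi s" for x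
    proof -
      obtain \<epsilon> where e: "\<epsilon> > 0" "\<And>y. \<bar>y - x\<bar> < \<epsilon> \<Longrightarrow> C (fst s) y \<notin> double_points C"
        "\<And>y. \<bar>y - x\<bar> < \<epsilon> \<Longrightarrow> y \<notin> {lo s..hi s} \<Longrightarrow> C (fst s) y \<notin> D"
        using A.strand_beyond[OF s x] by metis
      obtain \<epsilon>' where e': "\<epsilon>' > 0" "\<And>y. \<bar>y - x\<bar> < \<epsilon>' \<Longrightarrow> C' (fst s) y \<notin> double_points C'"
        using B.strand_beyond[OF s x] by metis
      show ?thesis using e e' by (intro exI[of _ "min \<epsilon> \<epsilon>'"]) auto
    qed
    obtain \<epsilon> where e: "\<epsilon> > 0" "\<And>y. \<bar>y - lo s\<bar> < \<epsilon> \<Longrightarrow> C (fst s) y \<notin> double_points C \<and> C' (fst s) y \<notin> double_points C' \<and>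
        (y \<notin> {lo s..hi s} \<longrightarrow> C (fst s) y \<notin> D)" using near[of "lo s"] by blast
    obtain \<delta> where d: "\<delta> > 0" "\<And>y. \<bar>y - hi s\<bar> < \<delta> \<Longrightarrow> C (fst s) y \<notin> double_points C \<and> C' (fst s) y \<notin> double_points C' \<and>
        (y \<notin> {lo s..hi s} \<longrightarrow> C (fst s) y \<notin> D)" using near[of "hi s"] by blast
    define x where "x = lo s - \<epsilon>/2"
    define y where "y = hi s + \<delta>/2"
    have x: "x < lo s" "hi s < y" using e(1) d(1) by (auto simp: x_def y_def)
    have sim: "C (fst s) z \<notin> double_points C \<and> C' (fst s) z \<notin> double_points C'"
      if "x \<le> z \<and> z < lo s \<or> hi s < z \<and> z \<le> y" for z
      using e(2)[of z] d(2)[of z] e(1) d(1) that by (auto simp: x_def y_def)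
    have off: "C (fst s) x \<notin> D" "C (fst s) y \<notin> D"
      using e(2)[of x] d(2)[of y] e(1) d(1) three_strandsD(1)[OF ts s] by (auto simp: x_def y_def)
    have simx: "C (fst s) x \<notin> double_points C" using sim[of x] x by simp
    obtain n \<eta> where n0: "\<eta> > 0" "\<And>h. \<bar>h\<bar> < \<eta> \<Longrightarrow> level \<sigma> (\<lambda>z. N (region C z)) C (fst s) (x + h) n"
      using numbering_simple[OF gen num open_UNIV UNIV_I simx] by metis
    have n: "level \<sigma> (\<lambda>z. N (region C z)) C (fst s) x n" using n0(2)[of 0] n0(1) by simp
    have n': "level \<sigma> (\<lambda>z. N' (region C' z)) C' (fst s) x n"
      by (rule agree_off_level[OF ag gen gen' D \<sigma> N N' off(1) n])
    note iC = A.strand_indices[OF sqr num x _ _ n]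
    note iC' = B.strand_indices[OF sqr num' x _ _ n']
    have "level \<sigma> (\<lambda>z. N (region C z)) C (fst s) y (n - \<sigma> * A.crossing_sign s q - \<sigma> * A.crossing_sign s r)"
      by (rule iC(3)) (use sim in auto)
    then have "level \<sigma> (\<lambda>z. N' (region C' z)) C' (fst s) y (n - \<sigma> * A.crossing_sign s q - \<sigma> * A.crossing_sign s r)"
      by (rule agree_off_level[OF ag gen gen' D \<sigma> N N' off(2)])
    moreover have "level \<sigma> (\<lambda>z. N' (region C' z)) C' (fst s) y (n - \<sigma> * B.crossing_sign s q - \<sigma> * B.crossing_sign s r)"
      by (rule iC'(3)) (use sim in auto)
    ultimately have "n - \<sigma> * A.crossing_sign s q - \<sigma> * A.crossing_sign s r = n - \<sigma> * B.crossing_sign s q - \<sigma> * B.crossing_sign s r"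
      by (rule level_unique)
    then have "A.crossing_sign s q + A.crossing_sign s r = B.crossing_sign s q + B.crossing_sign s r"
      using \<sigma> by auto
    then show ?thesis
      using iC(1,2) iC'(1,2) sim by (intro exI[of _ n]) blast
  qed
  obtain na where na: "ind C N (C (fst a) (crossing_param C a b)) = na - \<sigma> * A.crossing_sign a b / 2
        - (if crossing_param C a b < crossing_param C a m then 0 else \<sigma> * A.crossing_sign a m)"
      "ind C N (C (fst a) (crossing_param C a m)) = na - \<sigma> * A.crossing_sign a m / 2
        - (if crossing_param C a b < crossing_param C a m then \<sigma> * A.crossing_sign a b else 0)"
      "ind C' N' (C' (fst a) (crossing_param C' a b)) = na - \<sigma> * B.crossing_sign a b / 2
        - (if crossing_param C' a b < crossing_param C' a m then 0 else \<sigma> * B.crossing_sign a m)"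
      "ind C' N' (C' (fst a) (crossing_param C' a m)) = na - \<sigma> * B.crossing_sign a m / 2
        - (if crossing_param C' a b < crossing_param C' a m then \<sigma> * B.crossing_sign a b else 0)"
      "A.crossing_sign a b + A.crossing_sign a m = B.crossing_sign a b + B.crossing_sign a m"
    using profile[OF S(1) ab(2) am bm] by blast
  obtain nb where nb: "ind C N (C (fst b) (crossing_param C b a)) = nb - \<sigma> * A.crossing_sign b a / 2
        - (if crossing_param C b a < crossing_param C b m then 0 else \<sigma> * A.crossing_sign b m)"
      "ind C N (C (fst b) (crossing_param C b m)) = nb - \<sigma> * A.crossing_sign b m / 2
        - (if crossing_param C b a < crossing_param C b m then \<sigma> * A.crossing_sign b a else 0)"
      "ind C' N' (C' (fst b) (crossing_param C' b a)) = nb - \<sigma> * B.crossing_sign b a / 2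
        - (if crossing_param C' b a < crossing_param C' b m then 0 else \<sigma> * B.crossing_sign b m)"
      "ind C' N' (C' (fst b) (crossing_param C' b m)) = nb - \<sigma> * B.crossing_sign b m / 2
        - (if crossing_param C' b a < crossing_param C' b m then \<sigma> * B.crossing_sign b a else 0)"
      "A.crossing_sign b a + A.crossing_sign b m = B.crossing_sign b a + B.crossing_sign b m"
    using profile[OF S(2) ab(2)[symmetric] bm am] by blast
  obtain nm where nm: "ind C N (C (fst m) (crossing_param C m a)) = nm - \<sigma> * A.crossing_sign m a / 2
        - (if crossing_param C m a < crossing_param C m b then 0 else \<sigma> * A.crossing_sign m b)"
      "ind C N (C (fst m) (crossing_param C m b)) = nm - \<sigma> * A.crossing_sign m b / 2
        - (if crossing_param C m a < crossing_param C m b then \<sigma> * A.crossing_sign m a else 0)"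
      "ind C' N' (C' (fst m) (crossing_param C' m a)) = nm - \<sigma> * B.crossing_sign m a / 2
        - (if crossing_param C' m a < crossing_param C' m b then 0 else \<sigma> * B.crossing_sign m b)"
      "ind C' N' (C' (fst m) (crossing_param C' m b)) = nm - \<sigma> * B.crossing_sign m b / 2
        - (if crossing_param C' m a < crossing_param C' m b then \<sigma> * B.crossing_sign m a else 0)"
    using profile[OF S(3) am[symmetric] bm[symmetric] ab(2)] by blast
  have signs: "B.crossing_sign a m = A.crossing_sign a m" "B.crossing_sign b m = A.crossing_sign b m"
    "A.crossing_sign b a = - A.crossing_sign a b" "B.crossing_sign b a = - A.crossing_sign a b"
    "A.crossing_sign m a = - A.crossing_sign a m" "B.crossing_sign m a = - A.crossing_sign a m"
    "A.crossing_sign m b = - A.crossing_sign b m" "B.crossing_sign m b = - A.crossing_sign b m"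
    using na(5) nb(5) sign_ab A.crossing_sign_antisym[of b a] B.crossing_sign_antisym[of b a]
      A.crossing_sign_antisym[of m a] B.crossing_sign_antisym[of m a]
      A.crossing_sign_antisym[of m b] B.crossing_sign_antisym[of m b] by linarith+

  \<comment> \<open>With the same order before and after, a piece of the fixed strand \<open>s\<close> would join the crossing to an
    end point of \<open>s\<close> off both positions of \<open>m\<close>.\<close>
  have flip: "crossing_param C' s q < crossing_param C' s m \<longleftrightarrow> \<not> crossing_param C s q < crossing_param C s m"
    if sq: "S = {s, q, m}" "s \<noteq> q" "s \<noteq> m" "q \<noteq> m" for s q
  proof -
    have sq': "s \<in> {a, b}" "q \<in> {a, b}" "s \<in> S" "q \<in> S" using sq ab by auto
    let ?p = "C (fst s) (crossing_param C s q)"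
    have p': "C' (fst s) (crossing_param C' s q) = ?p" "C' (fst s) (lo s) = C (fst s) (lo s)" "C' (fst s) (hi s) = C (fst s) (hi s)"
      using param_ab[OF sq'(1,2) sq(2)] fixed[OF sq'(1)] A.crossing_param_in[OF sq'(3,4) sq(2)] three_strandsD(1)[OF ts sq'(3)] by auto
    have "?p \<in> strand_arc C s" "?p \<in> strand_arc C q"
      using A.crossing_param_iff[OF sq'(3,4) sq(2)] A.crossing_param_in[OF sq'(3,4) sq(2)] by (auto simp: strand_arc_eq)
    moreover have "S - {m} = {s, q}" using sq by auto
    ultimately have p: "?p \<in> (\<Inter>s \<in> S - {m}. strand_arc C s)" by simp
    note fr = three_strandsD(4,5)[OF ts sq'(3)]
    have ne: "crossing_param C s q \<noteq> crossing_param C s m" "crossing_param C' s q \<noteq> crossing_param C' s m"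
      using A.crossing_param_neq[of s q m] B.crossing_param_neq[of s q m] sq mS sq' by auto
    note rC = A.crossing_reaches_end[OF sq] and rC' = B.crossing_reaches_end[OF sq, unfolded p']
    show ?thesis
      using sides[OF p fr(1)] sides[OF p fr(2)] rC rC' ne by (meson linorder_neqE_linordered_idom not_less_iff_gr_or_eq)
  qed
  note flips = flip[OF S(1) ab(2) am bm] flip[OF S(2) ab(2)[symmetric] bm am]

  have point_sym: "C (fst b) (crossing_param C b a) = C (fst a) (crossing_param C a b)" "C' (fst b) (crossing_param C' b a) = C' (fst a) (crossing_param C' a b)"
    "C (fst m) (crossing_param C m a) = C (fst a) (crossing_param C a m)" "C' (fst m) (crossing_param C' m a) = C' (fst a) (crossing_param C' a m)"
    "C (fst m) (crossing_param C m b) = C (fst b) (crossing_param C b m)" "C' (fst m) (crossing_param C' m b) = C' (fst b) (crossing_param C' b m)"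
    using A.crossing_param_point_sym B.crossing_param_point_sym in_S mS ab(2) am bm by metis+

  \<comment> \<open>The edges on \<open>a\<close>, \<open>b\<close> and \<open>m\<close> are tested at the vertices \<open>ab\<close>, \<open>bm\<close> and \<open>ma\<close>, so that every
    crossing is used once.\<close>
  have out: "outward \<sigma> C S a \<longleftrightarrow> \<sigma> * A.crossing_sign a b * (if crossing_param C b a < crossing_param C b m then 1 else -1) = -1"
    "outward \<sigma> C S b \<longleftrightarrow> \<sigma> * A.crossing_sign b m * (if crossing_param C m a < crossing_param C m b then -1 else 1) = -1"
    "outward \<sigma> C S m \<longleftrightarrow> - (\<sigma> * A.crossing_sign a m) * (if crossing_param C a b < crossing_param C a m then -1 else 1) = -1"
  proof -
    show "outward \<sigma> C S a \<longleftrightarrow> \<sigma> * A.crossing_sign a b * (if crossing_param C b a < crossing_param C b m then 1 else -1) = -1"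
      using A.outward_iff[OF S(1) ab(2) am bm \<sigma>] by (simp add: A.forward_def)
    have "crossing_param C m a \<noteq> crossing_param C m b" "crossing_param C a b \<noteq> crossing_param C a m"
      using A.crossing_param_neq[of m a b] A.crossing_param_neq[of a b m] in_S mS ab(2) am bm by auto
    then have "A.forward m b a = (if crossing_param C m a < crossing_param C m b then -1 else 1)"
      "A.forward a m b = (if crossing_param C a b < crossing_param C a m then -1 else 1)"
      by (auto simp: A.forward_def)
    then show "outward \<sigma> C S b \<longleftrightarrow> \<sigma> * A.crossing_sign b m * (if crossing_param C m a < crossing_param C m b then -1 else 1) = -1"
      "outward \<sigma> C S m \<longleftrightarrow> - (\<sigma> * A.crossing_sign a m) * (if crossing_param C a b < crossing_param C a m then -1 else 1) = -1"
      using A.outward_iff[OF S(4) bm ab(2)[symmetric] am[symmetric] \<sigma>]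
        A.outward_iff[OF S(3) am[symmetric] bm[symmetric] ab(2) \<sigma>] signs(5) by simp_all
  qed
  have "{s \<in> S. outward \<sigma> C S s} = (if outward \<sigma> C S a then {a} else {}) \<union>
      (if outward \<sigma> C S b then {b} else {}) \<union> (if outward \<sigma> C S m then {m} else {})"
    using S(1) by auto
  then have count: "real (outward_count \<sigma> C S) = (if outward \<sigma> C S a then 1 else 0) +
      (if outward \<sigma> C S b then 1 else 0) + (if outward \<sigma> C S m then 1 else 0)"
    unfolding outward_count_def using ab(2) am bm by auto

  have "(\<Sum>d\<in>double_points C' - D. ind C' N' d) = (\<Sum>d\<in>double_points C - D. ind C N d)"
  proof (rule sum.cong)
    show "double_points C' - D = double_points C - D" using agree_off_double_points[OF ag] by auto
    show "ind C' N' d = ind C N d" if "d \<in> double_points C - D" for d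
      using agree_off_ind[OF ag gen gen' D \<sigma> N N'] that by blast
  qed
  then have "St1 C' N' - St1 C N =
      (ind C' N' (C' (fst a) (crossing_param C' a b)) + ind C' N' (C' (fst a) (crossing_param C' a m)) + ind C' N' (C' (fst b) (crossing_param C' b m)))
      - (ind C N (C (fst a) (crossing_param C a b)) + ind C N (C (fst a) (crossing_param C a m)) + ind C N (C (fst b) (crossing_param C b m)))"
    using A.St1_split[OF S(1) ab(2) am bm, of N] B.St1_split[OF S(1) ab(2) am bm, of N'] by simp
  also have "\<dots> = 2 * real (outward_count \<sigma> C S) - 3"
    unfolding count out
  proof (rule triangle_index_arithmetic[where na=na and nb=nb and nm=nm, OF _ _ _ _ _ _ _ _ _ _ _ _ _ _ _ flips])
    show "\<sigma> * A.crossing_sign a b = 1 \<or> \<sigma> * A.crossing_sign a b = -1"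
      "\<sigma> * A.crossing_sign a m = 1 \<or> \<sigma> * A.crossing_sign a m = -1"
      "\<sigma> * A.crossing_sign b m = 1 \<or> \<sigma> * A.crossing_sign b m = -1"
      using \<sigma> A.crossing_sign_cases in_S mS ab(2) am bm by fastforce+
    note at_a = na[unfolded signs sign_ab] and at_b = nb[unfolded signs point_sym] and at_m = nm[unfolded signs point_sym]
    show "ind C N (C (fst a) (crossing_param C a b)) = na - \<sigma> * A.crossing_sign a b / 2
        - (if crossing_param C a b < crossing_param C a m then 0 else \<sigma> * A.crossing_sign a m)"
      "ind C N (C (fst a) (crossing_param C a m)) = na - \<sigma> * A.crossing_sign a m / 2
        - (if crossing_param C a b < crossing_param C a m then \<sigma> * A.crossing_sign a b else 0)"
      "ind C' N' (C' (fst a) (crossing_param C' a b)) = na - \<sigma> * A.crossing_sign a b / 2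
        - (if crossing_param C' a b < crossing_param C' a m then 0 else \<sigma> * A.crossing_sign a m)"
      "ind C' N' (C' (fst a) (crossing_param C' a m)) = na - \<sigma> * A.crossing_sign a m / 2
        - (if crossing_param C' a b < crossing_param C' a m then \<sigma> * A.crossing_sign a b else 0)"
      using at_a(1-4) .
    show "ind C N (C (fst a) (crossing_param C a b)) = nb + \<sigma> * A.crossing_sign a b / 2
        - (if crossing_param C b a < crossing_param C b m then 0 else \<sigma> * A.crossing_sign b m)"
      by (subst at_b(1)) simp
    show "ind C N (C (fst b) (crossing_param C b m)) = nb - \<sigma> * A.crossing_sign b m / 2
        - (if crossing_param C b a < crossing_param C b m then - (\<sigma> * A.crossing_sign a b) else 0)"
      by (subst at_b(2)) simp
    show "ind C N (C (fst a) (crossing_param C a m)) = nm + \<sigma> * A.crossing_sign a m / 2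
        - (if crossing_param C m a < crossing_param C m b then 0 else - (\<sigma> * A.crossing_sign b m))"
      by (subst at_m(1)) simp
    show "ind C N (C (fst b) (crossing_param C b m)) = nm + \<sigma> * A.crossing_sign b m / 2
        - (if crossing_param C m a < crossing_param C m b then - (\<sigma> * A.crossing_sign a m) else 0)"
      by (subst at_m(2)) simp
    show "ind C' N' (C' (fst a) (crossing_param C' a b)) = nb + \<sigma> * A.crossing_sign a b / 2
        - (if crossing_param C' b a < crossing_param C' b m then 0 else \<sigma> * A.crossing_sign b m)"
      by (subst at_b(3)) simp
    show "ind C' N' (C' (fst b) (crossing_param C' b m)) = nb - \<sigma> * A.crossing_sign b m / 2
        - (if crossing_param C' b a < crossing_param C' b m then - (\<sigma> * A.crossing_sign a b) else 0)"
      by (subst at_b(4)) simp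
    show "ind C' N' (C' (fst a) (crossing_param C' a m)) = nm + \<sigma> * A.crossing_sign a m / 2
        - (if crossing_param C' m a < crossing_param C' m b then 0 else - (\<sigma> * A.crossing_sign b m))"
      by (subst at_m(3)) simp
    show "ind C' N' (C' (fst b) (crossing_param C' b m)) = nm + \<sigma> * A.crossing_sign b m / 2
        - (if crossing_param C' m a < crossing_param C' m b then - (\<sigma> * A.crossing_sign a m) else 0)"
      by (subst at_m(4)) simp
  qed
  finally show ?thesis .
qed

end
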